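(* Let $F$ be a free group and let $R$ be a normal subgroup of $F$. Then $$R\cap \bigl(1+\Delta^{4}(R)+\Delta^{2}(R)\Delta(R\cap F')+\Delta(R)\Delta([R,R\cap F'])\bigr)=\gamma_{4}(R)[R,R\cap F',R\cap F'].$$
   Context: For a group $G$, $\mathbb{Z}G$ is its integral group ring, $\Delta(G)$ is the augmentation ideal of $\mathbb{Z}G$, and $\Delta^n(G)$ is the $n$-th associative power of $\Delta(G)$. For a subgroup $H$ of $R$, $\Delta(H)$ is the augmentation ideal of $\mathbb{Z}H$, regarded as a subset of $\mathbb{Z}R$; a product such as $\Delta^n(R)\Delta(H)$ is the additive subgroup of $\mathbb{Z}R$ generated by all products $xy$ with $x\in\Delta^n(R)$, $y\in\Delta(H)$, and sums are sums of additive subgroups. For an additive subgroup $J$ of $\mathbb{Z}R$, $R\cap(1+J)=\{w\in R: w-1\in J\}$. $\{\gamma_n(G)\}_{n\ge1}$ is the lower central series of $G$ (with $\gamma_1(G)=G$) and $G'=\gamma_2(G)=[G,G]$. For subgroups $A,B$ of a group, $[A,B]$ is the subgroup generated by all commutators $[a,b]$ with $a\in A$, $b\in B$, and longer commutators are left-normed: $[A,B,C]=[[A,B],C]$. The right-hand side of the claim is a product of subgroups. *)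

theory Defs
  imports "HOL-Algebra.Algebra"
begin

section \<open>Free groups\<close>

text \<open>A letter \<open>(x, True)\<close> stands for \<open>x\<close>, a letter \<open>(x, False)\<close> for its inverse.\<close>

definition letter_val :: "('a, 'b) monoid_scheme \<Rightarrow> 'a \<times> bool \<Rightarrow> 'a" where
  "letter_val G l = (if snd l then fst l else inv\<^bsub>G\<^esub> (fst l))"

definition word_val :: "('a, 'b) monoid_scheme \<Rightarrow> ('a \<times> bool) list \<Rightarrow> 'a" where
  "word_val G w = foldr (\<lambda>l g. letter_val G l \<otimes>\<^bsub>G\<^esub> g) w \<one>\<^bsub>G\<^esub>"

definition reduced_words :: "'a set \<Rightarrow> ('a \<times> bool) list set" where
  "reduced_words B =
     {w \<in> lists (B \<times> UNIV). successively (\<lambda>l m. \<not> (fst l = fst m \<and> snd l \<noteq> snd m)) w}"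

text \<open>Normal form definition: every element of \<open>G\<close> is the value of exactly one reduced word
  over the basis \<open>B\<close>. The basis may be empty or infinite.\<close>

definition free_basis :: "('a, 'b) monoid_scheme \<Rightarrow> 'a set \<Rightarrow> bool" where
  "free_basis G B \<longleftrightarrow>
     B \<subseteq> carrier G \<and> bij_betw (word_val G) (reduced_words B) (carrier G)"

definition free_group :: "('a, 'b) monoid_scheme \<Rightarrow> bool" where
  "free_group G \<longleftrightarrow> group G \<and> (\<exists>B. free_basis G B)"


section \<open>Commutator subgroups and the lower central series\<close>

text \<open>The commutator convention \<open>a b a\<^sup>-\<^sup>1 b\<^sup>-\<^sup>1\<close> is that of \<^const>\<open>derived\<close>; the subgroup
  generated does not depend on it when \<open>A\<close> and \<open>B\<close> are subgroups.\<close>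

definition comm_subgroup :: "('a, 'b) monoid_scheme \<Rightarrow> 'a set \<Rightarrow> 'a set \<Rightarrow> 'a set" where
  "comm_subgroup G A B =
     generate G (\<Union>a\<in>A. \<Union>b\<in>B. {a \<otimes>\<^bsub>G\<^esub> b \<otimes>\<^bsub>G\<^esub> inv\<^bsub>G\<^esub> a \<otimes>\<^bsub>G\<^esub> inv\<^bsub>G\<^esub> b})"

lemma comm_subgroup_self: "comm_subgroup G H H = derived G H"
  by (simp add: comm_subgroup_def derived_def)

text \<open>\<open>lower_central G H n\<close> is the \<open>n\<close>-th term of the lower central series of the subgroup
  \<open>H\<close> of \<open>G\<close>, numbered from 1; the value at 0 is a dummy.\<close>

fun lower_central :: "('a, 'b) monoid_scheme \<Rightarrow> 'a set \<Rightarrow> nat \<Rightarrow> 'a set" where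
  "lower_central G H 0 = H"
| "lower_central G H (Suc 0) = H"
| "lower_central G H (Suc (Suc n)) = comm_subgroup G (lower_central G H (Suc n)) H"


section \<open>The integral group ring\<close>

text \<open>Elements are the finitely supported integer functions vanishing outside the carrier. Hence,
  for a subgroup \<open>H\<close> of \<open>G\<close>, the carrier of the group ring of \<open>H\<close> is literally a subset of the
  carrier of the group ring of \<open>G\<close>.\<close>

definition supp :: "('a \<Rightarrow> int) \<Rightarrow> 'a set" where
  "supp f = {x. f x \<noteq> 0}"

definition group_ring_of :: "'a \<Rightarrow> 'a \<Rightarrow> int" where
  "group_ring_of g = (\<lambda>x. if x = g then 1 else 0)"

definition group_ring :: "('a, 'b) monoid_scheme \<Rightarrow> ('a \<Rightarrow> int) ring" where
  "group_ring G =
     \<lparr>carrier = {f. finite (supp f) \<and> supp f \<subseteq> carrier G},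
      monoid.mult = (\<lambda>f g x. \<Sum>y\<in>supp f. \<Sum>z\<in>supp g. if y \<otimes>\<^bsub>G\<^esub> z = x then f y * g z else 0),
      one = group_ring_of \<one>\<^bsub>G\<^esub>,
      ring.zero = (\<lambda>x. 0),
      add = (\<lambda>f g x. f x + g x)\<rparr>"

definition augmentation :: "('a \<Rightarrow> int) \<Rightarrow> int" where
  "augmentation f = (\<Sum>x\<in>supp f. f x)"

definition aug_ideal :: "('a, 'b) monoid_scheme \<Rightarrow> ('a \<Rightarrow> int) set" where
  "aug_ideal G = {f \<in> carrier (group_ring G). augmentation f = 0}"

text \<open>The additive subgroup generated by all products \<open>x y\<close> with \<open>x \<in> A\<close> and \<open>y \<in> B\<close>. The
  constant \<^const>\<open>ideal_prod\<close> is not used since \<open>A\<close> and \<open>B\<close> need not be ideals.\<close>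

definition additive_prod :: "('c, 'd) ring_scheme \<Rightarrow> 'c set \<Rightarrow> 'c set \<Rightarrow> 'c set" where
  "additive_prod S A B = generate (add_monoid S) (A <#>\<^bsub>S\<^esub> B)"

primrec aug_power :: "('a, 'b) monoid_scheme \<Rightarrow> nat \<Rightarrow> ('a \<Rightarrow> int) set" where
  "aug_power G 0 = carrier (group_ring G)"
| "aug_power G (Suc n) = additive_prod (group_ring G) (aug_power G n) (aug_ideal G)"

text \<open>The set \<open>G \<inter> (1 + J)\<close> for an additive subgroup \<open>J\<close> of the group ring of \<open>G\<close>.\<close>

definition group_meet :: "('a, 'b) monoid_scheme \<Rightarrow> ('a \<Rightarrow> int) set \<Rightarrow> 'a set" where
  "group_meet G J =
     {w \<in> carrier G. group_ring_of w \<ominus>\<^bsub>group_ring G\<^esub> \<one>\<^bsub>group_ring G\<^esub> \<in> J}"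

lemma group_ring_carrier_iff:
  "f \<in> carrier (group_ring G) \<longleftrightarrow> finite (supp f) \<and> supp f \<subseteq> carrier G"
  by (simp add: group_ring_def)

lemma group_ring_mult_superset:
  assumes "finite A" "supp f \<subseteq> A" "finite B" "supp g \<subseteq> B"
  shows "(f \<otimes>\<^bsub>group_ring G\<^esub> g) x =
    (\<Sum>y\<in>A. \<Sum>z\<in>B. if y \<otimes>\<^bsub>G\<^esub> z = x then f y * g z else 0)"
proof -
  have "(\<Sum>z\<in>supp g. if y \<otimes>\<^bsub>G\<^esub> z = x then f y * g z else 0) =
        (\<Sum>z\<in>B. if y \<otimes>\<^bsub>G\<^esub> z = x then f y * g z else 0)" for y
    using assms by (intro sum.mono_neutral_left) (auto simp: supp_def)
  moreover have "(\<Sum>y\<in>supp f. \<Sum>z\<in>B. if y \<otimes>\<^bsub>G\<^esub> z = x then f y * g z else 0) =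
        (\<Sum>y\<in>A. \<Sum>z\<in>B. if y \<otimes>\<^bsub>G\<^esub> z = x then f y * g z else 0)"
    using assms by (intro sum.mono_neutral_left) (auto simp: supp_def intro!: sum.neutral)
  ultimately show ?thesis by (simp add: group_ring_def)
qed

lemma group_ring_mult:
  "(f \<otimes>\<^bsub>group_ring G\<^esub> g) x =
    (\<Sum>y\<in>supp f. \<Sum>z\<in>supp g. if y \<otimes>\<^bsub>G\<^esub> z = x then f y * g z else 0)"
  by (simp add: group_ring_def)

lemma group_ring_add: "f \<oplus>\<^bsub>group_ring G\<^esub> g = (\<lambda>x. f x + g x)"
  by (simp add: group_ring_def)

lemma group_ring_zero: "\<zero>\<^bsub>group_ring G\<^esub> = (\<lambda>x. 0)"
  by (simp add: group_ring_def)

lemma group_ring_one: "\<one>\<^bsub>group_ring G\<^esub> = group_ring_of \<one>\<^bsub>G\<^esub>"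
  by (simp add: group_ring_def)

lemma supp_add: "supp (\<lambda>x. f x + g x) \<subseteq> supp f \<union> supp g"
  by (auto simp: supp_def)

lemma supp_group_ring_of: "supp (group_ring_of g) = {g}"
  by (auto simp: supp_def group_ring_of_def)

lemma group_ring_of_self: "group_ring_of g g = 1"
  by (simp add: group_ring_of_def)

lemma supp_group_ring_mult:
  "supp (f \<otimes>\<^bsub>group_ring G\<^esub> g) \<subseteq> (\<lambda>(y, z). y \<otimes>\<^bsub>G\<^esub> z) ` (supp f \<times> supp g)"
proof
  fix x assume "x \<in> supp (f \<otimes>\<^bsub>group_ring G\<^esub> g)"
  hence "(\<Sum>y\<in>supp f. \<Sum>z\<in>supp g. if y \<otimes>\<^bsub>G\<^esub> z = x then f y * g z else 0) \<noteq> 0"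
    by (simp add: supp_def group_ring_def)
  then obtain y where y: "y \<in> supp f"
    and "(\<Sum>z\<in>supp g. if y \<otimes>\<^bsub>G\<^esub> z = x then f y * g z else 0) \<noteq> 0"
    by (rule sum.not_neutral_contains_not_neutral)
  then obtain z where z: "z \<in> supp g" "(if y \<otimes>\<^bsub>G\<^esub> z = x then f y * g z else 0) \<noteq> 0"
    by - (rule sum.not_neutral_contains_not_neutral)
  from z(2) have "x = y \<otimes>\<^bsub>G\<^esub> z" by (simp split: if_splits)
  with y z(1) show "x \<in> (\<lambda>(y, z). y \<otimes>\<^bsub>G\<^esub> z) ` (supp f \<times> supp g)"
    by force
qed

lemma group_ring_mult_closed:
  assumes "group G" "f \<in> carrier (group_ring G)" "g \<in> carrier (group_ring G)"
  shows "f \<otimes>\<^bsub>group_ring G\<^esub> g \<in> carrier (group_ring G)"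
proof -
  interpret group G by fact
  have "(\<lambda>(y, z). y \<otimes>\<^bsub>G\<^esub> z) ` (supp f \<times> supp g) \<subseteq> carrier G"
    using assms(2,3) by (auto simp: group_ring_carrier_iff subset_iff)
  moreover have "finite ((\<lambda>(y, z). y \<otimes>\<^bsub>G\<^esub> z) ` (supp f \<times> supp g))"
    using assms(2,3) by (auto simp: group_ring_carrier_iff)
  ultimately show ?thesis
    using supp_group_ring_mult[of G f g] by (auto simp: group_ring_carrier_iff intro: finite_subset)
qed

lemma sum_push_right:
  fixes c :: int
  shows "(if P then (\<Sum>y\<in>A. \<Sum>z\<in>B. if Q y z then a y z else 0) * c else 0) =
    (\<Sum>y\<in>A. \<Sum>z\<in>B. if Q y z then (if P then a y z * c else 0) else 0)"
  by (cases P) (simp_all add: sum_distrib_right if_distrib[of "\<lambda>t. t * c"] cong: if_cong)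

lemma sum_push_left:
  fixes c :: int
  shows "(if P then c * (\<Sum>y\<in>A. \<Sum>z\<in>B. if Q y z then a y z else 0) else 0) =
    (\<Sum>y\<in>A. \<Sum>z\<in>B. if Q y z then (if P then c * a y z else 0) else 0)"
  by (cases P) (simp_all add: sum_distrib_left if_distrib[of "\<lambda>t. c * t"] cong: if_cong)

lemma group_ring_mult_assoc:
  assumes "group G" and f: "f \<in> carrier (group_ring G)" and g: "g \<in> carrier (group_ring G)"
    and h: "h \<in> carrier (group_ring G)"
  shows "(f \<otimes>\<^bsub>group_ring G\<^esub> g) \<otimes>\<^bsub>group_ring G\<^esub> h = f \<otimes>\<^bsub>group_ring G\<^esub> (g \<otimes>\<^bsub>group_ring G\<^esub> h)"
proof
  fix x
  interpret group G by fact
  let ?P = "\<lambda>a b. (\<lambda>(y, z). y \<otimes>\<^bsub>G\<^esub> z) ` (supp a \<times> supp b)"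
  have fin: "finite (supp f)" "finite (supp g)" "finite (supp h)"
    and sub: "supp f \<subseteq> carrier G" "supp g \<subseteq> carrier G" "supp h \<subseteq> carrier G"
    using f g h by (auto simp: group_ring_carrier_iff)
  have finP: "finite (?P f g)" "finite (?P g h)" using fin by auto
  have "((f \<otimes>\<^bsub>group_ring G\<^esub> g) \<otimes>\<^bsub>group_ring G\<^esub> h) x =
     (\<Sum>u\<in>?P f g. \<Sum>w\<in>supp h. if u \<otimes>\<^bsub>G\<^esub> w = x then (f \<otimes>\<^bsub>group_ring G\<^esub> g) u * h w else 0)"
    by (rule group_ring_mult_superset) (rule fin finP supp_group_ring_mult subset_refl)+
  also have "\<dots> = (\<Sum>u\<in>?P f g. \<Sum>w\<in>supp h. \<Sum>y\<in>supp f. \<Sum>z\<in>supp g.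
      if u = y \<otimes>\<^bsub>G\<^esub> z then (if y \<otimes>\<^bsub>G\<^esub> z \<otimes>\<^bsub>G\<^esub> w = x then f y * g z * h w else 0) else 0)"
    by (intro sum.cong refl, unfold group_ring_mult sum_push_right, intro sum.cong refl) simp
  also have "\<dots> = (\<Sum>w\<in>supp h. \<Sum>y\<in>supp f. \<Sum>z\<in>supp g. \<Sum>u\<in>?P f g.
      if u = y \<otimes>\<^bsub>G\<^esub> z then (if y \<otimes>\<^bsub>G\<^esub> z \<otimes>\<^bsub>G\<^esub> w = x then f y * g z * h w else 0) else 0)"
    by (subst sum.swap, rule sum.cong[OF refl], subst sum.swap, rule sum.cong[OF refl], rule sum.swap)
  also have "\<dots> = (\<Sum>w\<in>supp h. \<Sum>y\<in>supp f. \<Sum>z\<in>supp g.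
      if y \<otimes>\<^bsub>G\<^esub> z \<otimes>\<^bsub>G\<^esub> w = x then f y * g z * h w else 0)"
    by (intro sum.cong refl, subst sum.delta[OF finP(1)]) force
  also have "\<dots> = (\<Sum>y\<in>supp f. \<Sum>z\<in>supp g. \<Sum>w\<in>supp h.
      if y \<otimes>\<^bsub>G\<^esub> (z \<otimes>\<^bsub>G\<^esub> w) = x then f y * (g z * h w) else 0)"
    by (subst sum.swap, rule sum.cong[OF refl], subst sum.swap, intro sum.cong refl)
       (use sub in \<open>auto simp: m_assoc subset_iff\<close>)
  also have "\<dots> = (\<Sum>y\<in>supp f. \<Sum>z\<in>supp g. \<Sum>w\<in>supp h. \<Sum>u\<in>?P g h.
      if u = z \<otimes>\<^bsub>G\<^esub> w then (if y \<otimes>\<^bsub>G\<^esub> (z \<otimes>\<^bsub>G\<^esub> w) = x then f y * (g z * h w) else 0) else 0)"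
    by (intro sum.cong refl, subst sum.delta[OF finP(2)]) force
  also have "\<dots> = (\<Sum>y\<in>supp f. \<Sum>u\<in>?P g h. \<Sum>z\<in>supp g. \<Sum>w\<in>supp h.
      if u = z \<otimes>\<^bsub>G\<^esub> w then (if y \<otimes>\<^bsub>G\<^esub> (z \<otimes>\<^bsub>G\<^esub> w) = x then f y * (g z * h w) else 0) else 0)"
    by (rule sum.cong[OF refl], subst (2) sum.swap, rule sum.cong[OF refl], rule sum.swap)
  also have "\<dots> = (\<Sum>y\<in>supp f. \<Sum>u\<in>?P g h.
      if y \<otimes>\<^bsub>G\<^esub> u = x then f y * (g \<otimes>\<^bsub>group_ring G\<^esub> h) u else 0)"
    by (intro sum.cong refl, unfold group_ring_mult sum_push_left, intro sum.cong refl) simp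
  also have "\<dots> = (f \<otimes>\<^bsub>group_ring G\<^esub> (g \<otimes>\<^bsub>group_ring G\<^esub> h)) x"
    by (rule group_ring_mult_superset[symmetric]) (rule fin finP supp_group_ring_mult subset_refl)+
  finally show "((f \<otimes>\<^bsub>group_ring G\<^esub> g) \<otimes>\<^bsub>group_ring G\<^esub> h) x =
      (f \<otimes>\<^bsub>group_ring G\<^esub> (g \<otimes>\<^bsub>group_ring G\<^esub> h)) x" .
qed

lemma group_ring_one_mult:
  assumes "group G" "f \<in> carrier (group_ring G)"
  shows "\<one>\<^bsub>group_ring G\<^esub> \<otimes>\<^bsub>group_ring G\<^esub> f = f" "f \<otimes>\<^bsub>group_ring G\<^esub> \<one>\<^bsub>group_ring G\<^esub> = f"
proof -
  interpret group G by fact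
  have fin: "finite (supp f)" and sub: "\<And>z. z \<in> supp f \<Longrightarrow> z \<in> carrier G"
    using assms(2) by (auto simp: group_ring_carrier_iff)
  have *: "(\<Sum>z\<in>supp f. if z = x then f z else 0) = f x" for x
    using fin by (simp add: sum.delta') (simp add: supp_def)
  show "\<one>\<^bsub>group_ring G\<^esub> \<otimes>\<^bsub>group_ring G\<^esub> f = f"
  proof
    fix x
    have "(\<one>\<^bsub>group_ring G\<^esub> \<otimes>\<^bsub>group_ring G\<^esub> f) x = (\<Sum>z\<in>supp f. if z = x then f z else 0)"
      by (simp add: group_ring_mult group_ring_one supp_group_ring_of sub group_ring_of_self cong: sum.cong if_cong)
    thus "(\<one>\<^bsub>group_ring G\<^esub> \<otimes>\<^bsub>group_ring G\<^esub> f) x = f x" by (simp only: *)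
  qed
  show "f \<otimes>\<^bsub>group_ring G\<^esub> \<one>\<^bsub>group_ring G\<^esub> = f"
  proof
    fix x
    have "(f \<otimes>\<^bsub>group_ring G\<^esub> \<one>\<^bsub>group_ring G\<^esub>) x = (\<Sum>z\<in>supp f. if z = x then f z else 0)"
      by (simp add: group_ring_mult group_ring_one supp_group_ring_of sub group_ring_of_self cong: sum.cong if_cong)
    thus "(f \<otimes>\<^bsub>group_ring G\<^esub> \<one>\<^bsub>group_ring G\<^esub>) x = f x" by (simp only: *)
  qed
qed

lemma group_ring_abelian_group: "abelian_group (group_ring G)"
proof (rule abelian_groupI)
  fix f g assume "f \<in> carrier (group_ring G)" "g \<in> carrier (group_ring G)"
  thus "f \<oplus>\<^bsub>group_ring G\<^esub> g \<in> carrier (group_ring G)"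
    using supp_add[of f g] by (auto simp: group_ring_carrier_iff group_ring_add intro: finite_subset)
next
  fix f assume f: "f \<in> carrier (group_ring G)"
  have "supp (\<lambda>x. - f x) = supp f" by (simp add: supp_def)
  with f show "\<exists>g\<in>carrier (group_ring G). g \<oplus>\<^bsub>group_ring G\<^esub> f = \<zero>\<^bsub>group_ring G\<^esub>"
    by (intro bexI[of _ "\<lambda>x. - f x"])
       (auto simp: group_ring_carrier_iff group_ring_add group_ring_zero)
qed (auto simp: group_ring_carrier_iff group_ring_add group_ring_zero supp_def add_ac)

lemma group_ring_ring:
  assumes "group G"
  shows "ring (group_ring G)"
proof (rule ringI)
  show "monoid (group_ring G)"
    using assms
    by (intro monoidI)
       (auto simp: group_ring_mult_closed group_ring_mult_assoc group_ring_one_mult group_ring_one_mult[unfolded group_ring_one]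
         group_ring_one
         group_ring_carrier_iff[of "group_ring_of _"] supp_group_ring_of group.is_monoid)
next
  fix f g h
  assume *: "f \<in> carrier (group_ring G)" "g \<in> carrier (group_ring G)" "h \<in> carrier (group_ring G)"
  let ?A = "supp f \<union> supp g"
  have A: "finite ?A" "finite (supp h)" using * by (auto simp: group_ring_carrier_iff)
  have D: "((f \<oplus>\<^bsub>group_ring G\<^esub> g) \<otimes>\<^bsub>group_ring G\<^esub> h) x =
      (\<Sum>y\<in>?A. \<Sum>z\<in>supp h. if y \<otimes>\<^bsub>G\<^esub> z = x then (f y + g y) * h z else 0)"
    "(h \<otimes>\<^bsub>group_ring G\<^esub> (f \<oplus>\<^bsub>group_ring G\<^esub> g)) x =
      (\<Sum>y\<in>supp h. \<Sum>z\<in>?A. if y \<otimes>\<^bsub>G\<^esub> z = x then h y * (f z + g z) else 0)"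
    "(f \<otimes>\<^bsub>group_ring G\<^esub> h) x = (\<Sum>y\<in>?A. \<Sum>z\<in>supp h. if y \<otimes>\<^bsub>G\<^esub> z = x then f y * h z else 0)"
    "(g \<otimes>\<^bsub>group_ring G\<^esub> h) x = (\<Sum>y\<in>?A. \<Sum>z\<in>supp h. if y \<otimes>\<^bsub>G\<^esub> z = x then g y * h z else 0)"
    "(h \<otimes>\<^bsub>group_ring G\<^esub> f) x = (\<Sum>y\<in>supp h. \<Sum>z\<in>?A. if y \<otimes>\<^bsub>G\<^esub> z = x then h y * f z else 0)"
    "(h \<otimes>\<^bsub>group_ring G\<^esub> g) x = (\<Sum>y\<in>supp h. \<Sum>z\<in>?A. if y \<otimes>\<^bsub>G\<^esub> z = x then h y * g z else 0)"
    for x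
    unfolding group_ring_add
    by (rule group_ring_mult_superset; use A supp_add[of f g] in auto)+
  show "(f \<oplus>\<^bsub>group_ring G\<^esub> g) \<otimes>\<^bsub>group_ring G\<^esub> h =
      f \<otimes>\<^bsub>group_ring G\<^esub> h \<oplus>\<^bsub>group_ring G\<^esub> g \<otimes>\<^bsub>group_ring G\<^esub> h"
    by (rule ext)
       (simp only: group_ring_add[of G "f \<otimes>\<^bsub>group_ring G\<^esub> h"] D flip: sum.distrib,
        intro sum.cong refl, simp add: algebra_simps)
  show "h \<otimes>\<^bsub>group_ring G\<^esub> (f \<oplus>\<^bsub>group_ring G\<^esub> g) =
      h \<otimes>\<^bsub>group_ring G\<^esub> f \<oplus>\<^bsub>group_ring G\<^esub> h \<otimes>\<^bsub>group_ring G\<^esub> g"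
    by (rule ext)
       (simp only: group_ring_add[of G "h \<otimes>\<^bsub>group_ring G\<^esub> f"] D flip: sum.distrib,
        intro sum.cong refl, simp add: algebra_simps)
qed (rule group_ring_abelian_group)

lemma aug_ideal_subgroup_subset:
  assumes "H \<subseteq> carrier G"
  shows "aug_ideal (G\<lparr>carrier := H\<rparr>) \<subseteq> carrier (group_ring G)"
  using assms by (auto simp: aug_ideal_def group_ring_carrier_iff)

end

theory Submission
  imports Defs
begin

text \<open>Write \<open>S = R \<inter> F'\<close>. As \<open>R / S\<close> embeds into \<open>F / F'\<close>, it is free abelian, so \<open>R\<close> is generated by
  \<open>S\<close> and a set \<open>X\<close> that is independent modulo \<open>S\<close>. Let \<open>E\<close> be generated by the pairs \<open>(1 + z, z)\<close>,
  \<open>z \<in> X \<union> S\<close>, in the product of the group of Magnus power series modulo degree 4 with \<open>R\<close>. As a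
  subgroup of a free group, \<open>R\<close> is projective, so \<open>E \<rightarrow> R\<close> has a section \<open>s\<close>; thus \<open>E\<close> replaces a
  free basis of \<open>R\<close> adapted to \<open>S\<close>. If \<open>w - 1\<close> lies in the given additive subgroup, the linear and
  quadratic Magnus coefficients of \<open>s w\<close> vanish, and so do the cubic ones at \<open>(z, x, x')\<close> with
  \<open>x, x' \<in> X\<close>. Modulo \<open>\<gamma>\<^sub>4\<close> and the commutators \<open>[e, t, t']\<close> with \<open>t\<close> and \<open>t'\<close> over \<open>S\<close>, the group
  \<open>\<gamma>\<^sub>3(E)\<close> is generated by commutators whose exponents are detected by precisely these coefficients.
  Hence \<open>s w\<close> lies in the corresponding subgroup of \<open>E\<close>, and \<open>w\<close> in its image. The other inclusion
  follows from \<open>[a, b] - 1 = a b ((a\<^sup>-\<^sup>1 - 1)(b\<^sup>-\<^sup>1 - 1) - (b\<^sup>-\<^sup>1 - 1)(a\<^sup>-\<^sup>1 - 1))\<close>.\<close>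

section \<open>Commutators\<close>

text \<open>A free basis of \<open>R\<close> adapted to \<open>S\<close> would consist of lifts of a
  basis of \<open>R\<close> modulo \<open>S\<close> and of elements of \<open>S\<close>. Since
  \<open>R\<close> may have infinite rank, a given free basis cannot be turned into one by finitely
  many Nielsen moves. The argument uses just two properties of it: generators outside
  \<open>Xs\<close> lie in \<open>S\<close>, and linear coefficients at \<open>Xs\<close> vanish on
  \<open>S\<close>. \<open>E\<close> is built to have both. Taking all of \<open>S\<close> as
  further letters makes the projection to \<open>R\<close> onto, and the second component ties the
  linear coefficients at \<open>Xs\<close> to the coset modulo \<open>S\<close>. The cubic positions
  are dictated by the two mixed summands. In a product from the second one, a quadratic coefficient
  of the left factor meets a linear coefficient over \<open>S\<close> at the last letter. In the
  third, a linear coefficient meets a quadratic one over [R,S] at the last two letters; each of its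
  terms contains a linear coefficient over \<open>S\<close> at one of them. Both vanish if the last
  two letters are in \<open>Xs\<close>. The double commutators with two entries over
  \<open>S\<close> vanish at the same positions, which is why these separate exactly the
  rest.\<close>

context group
begin

lemma cancel_left [simp]:
  assumes "x \<in> carrier G" "y \<in> carrier G"
  shows "x \<otimes> (inv x \<otimes> y) = y" "inv x \<otimes> (x \<otimes> y) = y"
  using assms by (simp_all flip: m_assoc)

definition comm :: "'a \<Rightarrow> 'a \<Rightarrow> 'a" where
  "comm a b = a \<otimes> b \<otimes> inv a \<otimes> inv b"

lemma comm_closed [simp, intro]:
  "a \<in> carrier G \<Longrightarrow> b \<in> carrier G \<Longrightarrow> comm a b \<in> carrier G"
  by (simp add: comm_def)

lemma inv_comm: "a \<in> carrier G \<Longrightarrow> b \<in> carrier G \<Longrightarrow> inv (comm a b) = comm b a"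
  by (simp add: comm_def inv_mult_group m_assoc)

lemma comm_swap_mult:
  "a \<in> carrier G \<Longrightarrow> b \<in> carrier G \<Longrightarrow> comm a b \<otimes> (b \<otimes> a) = a \<otimes> b"
  by (simp add: comm_def m_assoc)

lemma comm_self: "a \<in> carrier G \<Longrightarrow> comm a a = \<one>"
  by (simp add: comm_def m_assoc)

lemma comm_one [simp]: "a \<in> carrier G \<Longrightarrow> comm a \<one> = \<one>" "a \<in> carrier G \<Longrightarrow> comm \<one> a = \<one>"
  by (simp_all add: comm_def)

lemma conj_eq_comm: "a \<in> carrier G \<Longrightarrow> b \<in> carrier G \<Longrightarrow> b \<otimes> a \<otimes> inv b = comm b a \<otimes> a"
  by (simp add: comm_def m_assoc)

lemma comm_mult_right:
  "\<lbrakk>a \<in> carrier G; e \<in> carrier G; f \<in> carrier G\<rbrakk>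
    \<Longrightarrow> comm a (e \<otimes> f) = comm a e \<otimes> (comm e (comm a f) \<otimes> comm a f)"
  by (simp add: comm_def m_assoc inv_mult_group)

lemma comm_mult_left:
  "\<lbrakk>a \<in> carrier G; e \<in> carrier G; f \<in> carrier G\<rbrakk>
    \<Longrightarrow> comm (a \<otimes> e) f = comm a (comm e f) \<otimes> comm e f \<otimes> comm a f"
  by (simp add: comm_def m_assoc inv_mult_group)

lemma Hall_Witt:
  assumes "a \<in> carrier G" "b \<in> carrier G" "c \<in> carrier G"
  shows "comm (comm a b) (b \<otimes> c \<otimes> inv b) \<otimes> comm (comm b c) (c \<otimes> a \<otimes> inv c)
    \<otimes> comm (comm c a) (a \<otimes> b \<otimes> inv a) = \<one>"
  using assms by (simp add: comm_def m_assoc inv_mult_group)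

text \<open>The conjugation is moved from \<open>c\<close> to \<open>p\<close>:
  \<open>inv b \<otimes> p \<otimes> b\<close> equals \<open>comm (inv b) p \<otimes> p\<close>, so
  \<open>p\<close> changes only by a factor one step deeper in the lower central series.\<close>

lemma comm_conj:
  assumes "p \<in> carrier G" "b \<in> carrier G" "c \<in> carrier G"
  shows "comm p (b \<otimes> c \<otimes> inv b) = b \<otimes> comm (comm (inv b) p \<otimes> p) c \<otimes> inv b"
  using assms by (simp add: comm_def m_assoc inv_mult_group)

lemma subgroup_mult_cancel_left:
  assumes "subgroup T G" "x \<in> T" "y \<in> carrier G"
  shows "x \<otimes> y \<in> T \<longleftrightarrow> y \<in> T"
  using assms by (metis cancel_left(2) subgroup.m_closed subgroup.m_inv_closed subgroup.mem_carrier)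

lemma subgroup_mult_cancel_right:
  assumes "subgroup T G" "x \<in> T" "y \<in> carrier G"
  shows "y \<otimes> x \<in> T \<longleftrightarrow> y \<in> T"
proof
  assume "y \<otimes> x \<in> T"
  hence "(y \<otimes> x) \<otimes> inv x \<in> T" using assms subgroup.m_closed subgroup.m_inv_closed by metis
  thus "y \<in> T" using assms subgroup.mem_carrier[OF assms(1,2)] by (simp add: m_assoc)
qed (use assms subgroup.m_closed in metis)

lemma subgroup_comm_closed:
  assumes "subgroup H G" "a \<in> H" "b \<in> H"
  shows "comm a b \<in> H"
  using assms unfolding comm_def
  by (simp add: subgroup.m_closed subgroup.m_inv_closed)

lemma comm_subgroup_mem:
  "a \<in> A \<Longrightarrow> b \<in> B \<Longrightarrow> comm a b \<in> comm_subgroup G A B"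
  unfolding comm_subgroup_def comm_def by (rule generate.incl) auto

lemma comm_subgroup_is_subgroup:
  assumes "A \<subseteq> carrier G" "B \<subseteq> carrier G"
  shows "subgroup (comm_subgroup G A B) G"
  unfolding comm_subgroup_def by (rule generate_is_subgroup) (use assms in \<open>auto simp: subset_iff\<close>)

lemma comm_subgroup_least:
  assumes "subgroup T G" "\<And>a b. a \<in> A \<Longrightarrow> b \<in> B \<Longrightarrow> comm a b \<in> T"
  shows "comm_subgroup G A B \<subseteq> T"
  unfolding comm_subgroup_def
  by (rule generate_subgroup_incl[OF _ assms(1)]) (use assms(2) in \<open>auto simp: comm_def\<close>)

text \<open>By \<open>comm_mult_right\<close>, \<open>comm a (e \<otimes> f)\<close> is
  \<open>comm a e\<close> times \<open>comm a f\<close> with \<open>comm e (comm a f)\<close>, an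
  element of \<open>T\<close>, in between. So \<open>comm a\<close> behaves like a homomorphism
  modulo \<open>T\<close>, without normality of \<open>T\<close>, and claims about it reduce to
  generators.\<close>

lemma subgroup_comm_right:
  assumes T: "subgroup T G" and a: "a \<in> carrier G"
    and central: "\<And>e f. e \<in> carrier G \<Longrightarrow> f \<in> carrier G \<Longrightarrow> comm e (comm a f) \<in> T"
  shows "subgroup {e \<in> carrier G. comm a e \<in> T} G"
proof (rule subgroupI)
  have one: "\<one> \<in> T" using T by (rule subgroup.one_closed)
  show "{e \<in> carrier G. comm a e \<in> T} \<noteq> {}" using a one by (auto intro!: exI[of _ \<one>])
  fix e assume "e \<in> {e \<in> carrier G. comm a e \<in> T}"
  hence e: "e \<in> carrier G" "comm a e \<in> T" by auto
  have "comm a e \<otimes> (comm e (comm a (inv e)) \<otimes> comm a (inv e)) \<in> T"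
    using comm_mult_right[of a e "inv e"] a e one by simp
  with e a show "inv e \<in> {e \<in> carrier G. comm a e \<in> T}"
    by (simp add: subgroup_mult_cancel_left[OF T] central)
  fix f assume "f \<in> {e \<in> carrier G. comm a e \<in> T}"
  with e a show "e \<otimes> f \<in> {e \<in> carrier G. comm a e \<in> T}"
    by (auto simp: comm_mult_right intro!: subgroup.m_closed[OF T] central)
qed auto

text \<open>The counterpart from \<open>comm_mult_left\<close>. The domain \<open>P\<close> is a
  parameter because in degree three the assumption is available only on \<open>\<gamma> 2\<close>,
  where \<open>comm p (comm q e)\<close> lies in \<open>\<gamma> 4\<close>.\<close>

lemma subgroup_comm_left:
  assumes T: "subgroup T G" and e: "e \<in> carrier G" and P: "subgroup P G"
    and central: "\<And>p q. p \<in> P \<Longrightarrow> q \<in> P \<Longrightarrow> comm p (comm q e) \<in> T"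
  shows "subgroup {p \<in> P. comm p e \<in> T} G"
proof (rule subgroupI)
  have one: "\<one> \<in> T" using T by (rule subgroup.one_closed)
  have PG: "p \<in> carrier G" if "p \<in> P" for p using that P by (rule subgroup.mem_carrier[rotated])
  show "{p \<in> P. comm p e \<in> T} \<noteq> {}"
    using e one subgroup.one_closed[OF P] by (auto intro!: exI[of _ \<one>])
  show "{p \<in> P. comm p e \<in> T} \<subseteq> carrier G" using PG by auto
  fix p assume "p \<in> {p \<in> P. comm p e \<in> T}"
  hence p: "p \<in> P" "comm p e \<in> T" "inv p \<in> P" by (auto intro: subgroup.m_inv_closed[OF P])
  have "comm p (comm (inv p) e) \<otimes> comm (inv p) e \<otimes> comm p e \<in> T"
    using comm_mult_left[of p "inv p" e] e p PG[of p] one by simp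
  with e p PG[of p] show "inv p \<in> {p \<in> P. comm p e \<in> T}"
    by (simp add: subgroup_mult_cancel_left[OF T] subgroup_mult_cancel_right[OF T] central)
  fix q assume "q \<in> {p \<in> P. comm p e \<in> T}"
  with e p show "p \<otimes> q \<in> {p \<in> P. comm p e \<in> T}"
    by (auto simp: comm_mult_left PG intro!: subgroup.m_closed[OF T] central subgroup.m_closed[OF P])
qed

abbreviation \<gamma> :: "nat \<Rightarrow> 'a set" where
  "\<gamma> n \<equiv> lower_central G (carrier G) n"

lemma lower_central_subgroup:
  assumes "subgroup H G"
  shows "subgroup (lower_central G H n) G"
proof (induction n)
  case (Suc n)
  thus ?case
    using assms by (cases n) (simp_all add: comm_subgroup_is_subgroup subgroup.subset)
qed (use assms in simp)

lemma lower_central_comm: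
  assumes "subgroup H G" "a \<in> lower_central G H (Suc n)" "e \<in> H"
  shows "comm a e \<in> lower_central G H (Suc (Suc n))" "comm e a \<in> lower_central G H (Suc (Suc n))"
proof -
  show *: "comm a e \<in> lower_central G H (Suc (Suc n))"
    using assms by (simp add: comm_subgroup_mem)
  have "a \<in> carrier G" "e \<in> carrier G"
    using subgroup.mem_carrier[OF lower_central_subgroup[OF assms(1)] assms(2)]
      subgroup.mem_carrier[OF assms(1,3)] by auto
  with subgroup.m_inv_closed[OF lower_central_subgroup[OF assms(1)] *]
  show "comm e a \<in> lower_central G H (Suc (Suc n))" by (simp only: inv_comm)
qed

lemma lower_central_antimono:
  assumes H: "subgroup H G"
  shows "lower_central G H (Suc (Suc n)) \<subseteq> lower_central G H (Suc n)"
proof (induction n)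
  case 0
  show ?case using comm_subgroup_least[OF H subgroup_comm_closed[OF H]] by simp
next
  case (Suc n)
  have "comm_subgroup G (lower_central G H (Suc (Suc n))) H \<subseteq> lower_central G H (Suc (Suc n))"
    by (rule comm_subgroup_least[OF lower_central_subgroup[OF H]])
       (use Suc lower_central_comm[OF H] in blast)
  thus ?case by simp
qed

section \<open>Elements of an abelian quotient detected by integer coordinates\<close>

lemma generate_finite_subset:
  assumes "x \<in> generate G A"
  shows "\<exists>A'\<subseteq>A. finite A' \<and> x \<in> generate G A'"
  using assms
proof induction
  case one
  show ?case by (intro exI[of _ "{}"]) (auto intro: generate.one)
next
  case (incl h)
  thus ?case by (intro exI[of _ "{h}"]) (auto intro: generate.incl)
next
  case (inv h)
  thus ?case by (intro exI[of _ "{h}"]) (auto intro: generate.inv)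
next
  case (eng h k)
  then obtain A' A'' where *: "A' \<subseteq> A" "finite A'" "h \<in> generate G A'"
    "A'' \<subseteq> A" "finite A''" "k \<in> generate G A''" by blast
  hence "h \<in> generate G (A' \<union> A'')" "k \<in> generate G (A' \<union> A'')"
    using mono_generate[of A' "A' \<union> A''"] mono_generate[of A'' "A' \<union> A''"] by auto
  with * show ?case by (intro exI[of _ "A' \<union> A''"]) (auto intro: generate.eng)
qed

lemma additive_int_pow:
  fixes \<phi> :: "'a \<Rightarrow> int"
  assumes P: "subgroup P G" and \<phi>: "\<And>p q. p \<in> P \<Longrightarrow> q \<in> P \<Longrightarrow> \<phi> (p \<otimes> q) = \<phi> p + \<phi> q"
    and p: "p \<in> P"
  shows "\<phi> \<one> = 0" "\<phi> (inv p) = - \<phi> p" "\<phi> (p [^] (n::int)) = n * \<phi> p"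
proof -
  have 1: "\<one> \<in> P" and i: "inv p \<in> P" and c: "p \<in> carrier G"
    using P p by (auto intro: subgroup.one_closed subgroup.m_inv_closed subgroup.mem_carrier)
  show z: "\<phi> \<one> = 0" using \<phi>[OF 1 1] by simp
  have inv: "\<phi> (inv q) = - \<phi> q" if "q \<in> P" for q
    using \<phi>[OF that subgroup.m_inv_closed[OF P that]] subgroup.mem_carrier[OF P that] z by simp
  show "\<phi> (inv p) = - \<phi> p" using p by (rule inv)
  have nat: "p [^] k \<in> P \<and> \<phi> (p [^] k) = int k * \<phi> p" for k :: nat
  proof (induction k)
    case (Suc k)
    have "p [^] Suc k = p [^] k \<otimes> p" by simp
    moreover have "\<phi> (p [^] k \<otimes> p) = \<phi> (p [^] k) + \<phi> p" using Suc p by (blast intro: \<phi>)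
    moreover have "p [^] k \<otimes> p \<in> P" using Suc p by (blast intro: subgroup.m_closed[OF P])
    ultimately show ?case using Suc by (simp only: int_Suc distrib_right mult_1)
  qed (simp add: 1 z)
  show "\<phi> (p [^] n) = n * \<phi> p"
  proof (cases "n < 0")
    case True
    hence "\<phi> (p [^] n) = \<phi> (inv (p [^] nat (- n)))" by (simp only: int_pow_def2 if_True)
    also have "\<dots> = - (int (nat (- n)) * \<phi> p)"
      by (simp only: inv nat)
    also have "\<dots> = n * \<phi> p" using True by simp
    finally show ?thesis .
  next
    case False
    hence "\<phi> (p [^] n) = \<phi> (p [^] nat n)" by (simp only: int_pow_def2 if_False)
    with nat[of "nat n"] False show ?thesis by (simp only: int_nat_eq) simp
  qed
qed

text \<open>\<open>P\<close> modulo \<open>N\<close> is abelian and generated by the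
  \<open>b i\<close>, and the \<open>\<phi> i\<close> induce homomorphisms from it to the integers.
  Coordinate \<open>i\<close> of a product of powers of the \<open>b j\<close> is the exponent of
  \<open>b i\<close> times a nonzero number, so if all coordinates vanish, all exponents do. The
  diagonal is only required to be nonzero since some later coordinates have -1 there.\<close>

lemma mem_if_dual_coordinates_vanish:
  fixes \<phi> :: "'i \<Rightarrow> 'a \<Rightarrow> int"
  assumes P: "subgroup P G" and N: "subgroup N G" "N \<subseteq> P"
    and ab: "\<And>p q. p \<in> P \<Longrightarrow> q \<in> P \<Longrightarrow> comm p q \<in> N"
    and b: "b ` I \<subseteq> P" and gen: "P \<subseteq> generate G (b ` I \<union> N)"
    and add: "\<And>i p q. i \<in> I \<Longrightarrow> p \<in> P \<Longrightarrow> q \<in> P \<Longrightarrow> \<phi> i (p \<otimes> q) = \<phi> i p + \<phi> i q"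
    and zero: "\<And>i n. i \<in> I \<Longrightarrow> n \<in> N \<Longrightarrow> \<phi> i n = 0"
    and dual: "\<And>i j. i \<in> I \<Longrightarrow> j \<in> I \<Longrightarrow> \<phi> i (b j) = 0 \<longleftrightarrow> i \<noteq> j"
    and p: "p \<in> P" "\<And>i. i \<in> I \<Longrightarrow> \<phi> i p = 0"
  shows "p \<in> N"
proof -
  have PG: "x \<in> carrier G" if "x \<in> P" for x using subgroup.mem_carrier[OF P that] .
  have "\<exists>A\<subseteq>b ` I \<union> N. finite A \<and> p \<in> generate G A"
    using p(1) gen by (intro generate_finite_subset) auto
  then obtain A where A: "A \<subseteq> b ` I \<union> N" "finite A" "p \<in> generate G A" by blast
  have "A - N \<subseteq> b ` I" "finite (A - N)" using A by auto
  then obtain J0 where J0: "J0 \<subseteq> I" "finite J0" "A - N = b ` J0"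
    by (meson finite_subset_image)
  have "A \<subseteq> b ` J0 \<union> N" using J0 by auto
  hence "p \<in> generate G (b ` J0 \<union> N)" using A(3) mono_generate by blast
  moreover have "p \<in> N" if "finite J" "J \<subseteq> I" "p \<in> generate G (b ` J \<union> N)" for J
    using that
  proof (induction J rule: finite_induct)
    case empty
    hence "p \<in> generate G N" by simp
    thus ?case using generate_subgroup_incl[OF subset_refl N(1)] by auto
  next
    case (insert i J)
    define H where "H = generate G (b ` J \<union> N)"
    have sub: "b ` J \<union> N \<subseteq> P" using b N insert.prems by auto
    have H: "subgroup H G" unfolding H_def
      by (rule generate_is_subgroup) (use sub subgroup.subset[OF P] in auto)
    have HP: "H \<subseteq> P" unfolding H_def by (rule generate_subgroup_incl[OF sub P])
    have NH: "N \<subseteq> H" unfolding H_def by (auto intro: generate.incl)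
    have i: "i \<in> I" "b i \<in> P" and J: "j \<in> I" "i \<noteq> j" if "j \<in> J" for j
      using insert b that by auto
    have i: "i \<in> I" "b i \<in> P" using insert b by auto
    have pow: "b i [^] n \<in> P" for n :: int using subgroup_int_pow_closed[OF P i(2)] .
    \<comment> \<open>Commutators of \<open>P\<close> lie in \<open>N\<close> and hence in
      \<open>H\<close>, so membership in \<open>H\<close> does not depend on the order of two
      factors. This replaces computing in the quotient by \<open>N\<close>.\<close>
    have swap: "v \<otimes> u \<in> H" if "u \<otimes> v \<in> H" "u \<in> P" "v \<in> P" for u v
    proof -
      have "comm v u \<otimes> (u \<otimes> v) \<in> H"
        by (rule subgroup.m_closed[OF H subsetD[OF NH ab[OF that(3,2)]] that(1)])
      thus ?thesis using that PG by (simp add: comm_swap_mult)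
    qed
    \<comment> \<open>\<open>M\<close> collects the elements that are a power of \<open>b i\<close>
      times an element of \<open>H\<close>. It is a subgroup containing all generators, so
      \<open>p\<close> has this form and the index \<open>i\<close> can be split off.\<close>
    define M where "M = {q \<in> P. \<exists>n::int. b i [^] n \<otimes> q \<in> H}"
    have M: "subgroup M G"
    proof (rule subgroupI)
      have "\<one> \<in> M" unfolding M_def using subgroup.one_closed[OF P] subgroup.one_closed[OF H]
        by (auto intro!: exI[of _ 0])
      thus "M \<noteq> {}" by auto
      show "M \<subseteq> carrier G" using PG by (auto simp: M_def)
      fix q assume "q \<in> M"
      then obtain n :: int where q: "q \<in> P" "b i [^] n \<otimes> q \<in> H" by (auto simp: M_def)
      have "inv (q \<otimes> b i [^] n) \<in> H"
        using swap[OF q(2) pow q(1)] by (rule subgroup.m_inv_closed[OF H])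
      hence "b i [^] (- n) \<otimes> inv q \<in> H"
        using q PG i by (simp add: inv_mult_group int_pow_neg)
      thus "inv q \<in> M" using q subgroup.m_inv_closed[OF P] by (auto simp: M_def)
      fix r assume "r \<in> M"
      then obtain m :: int where r: "r \<in> P" "b i [^] m \<otimes> r \<in> H" by (auto simp: M_def)
      have "r \<otimes> b i [^] m \<otimes> (b i [^] n \<otimes> q) \<in> H"
        using swap[OF r(2) pow r(1)] q(2) by (rule subgroup.m_closed[OF H])
      hence "r \<otimes> (b i [^] (m + n) \<otimes> q) \<in> H"
        using q r PG i pow by (simp add: m_assoc int_pow_mult)
      hence "b i [^] (m + n) \<otimes> q \<otimes> r \<in> H"
        by (rule swap) (use q r pow in \<open>auto intro: subgroup.m_closed[OF P]\<close>)
      thus "q \<otimes> r \<in> M" using q r PG i pow by (auto simp: M_def m_assoc subgroup.m_closed[OF P])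
    qed
    have "b ` insert i J \<union> N \<subseteq> M"
    proof -
      have "b i [^] (-1::int) \<otimes> b i = \<one>" using i PG by (simp add: int_pow_neg)
      hence "b i \<in> M" using i subgroup.one_closed[OF H] by (metis (mono_tags, lifting) M_def mem_Collect_eq)
      moreover have "b ` J \<union> N \<subseteq> M"
        using sub PG by (auto simp: M_def H_def intro!: exI[of _ 0] generate.incl)
      ultimately show ?thesis by simp
    qed
    hence "p \<in> M" using generate_subgroup_incl[OF _ M] insert.prems(2) by blast
    then obtain n :: int where n: "b i [^] n \<otimes> p \<in> H" by (auto simp: M_def)
    have \<phi>H: "\<phi> i h = 0" if "h \<in> H" for h
      using that unfolding H_def
    proof induction
      case one thus ?case using additive_int_pow(1)[OF P add[OF i(1)] i(2)] by simp
    next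
      case (incl h) thus ?case using zero dual J i by auto
    next
      case (inv h)
      hence "\<phi> i h = 0" "h \<in> P" using zero dual J i sub by auto
      thus ?case using additive_int_pow(2)[OF P add[OF i(1)]] by simp
    next
      case (eng h k)
      hence "h \<in> P" "k \<in> P" using HP unfolding H_def by auto
      with eng show ?case using add[OF i(1)] by simp
    qed
    \<comment> \<open>\<open>\<phi> i\<close> vanishes on \<open>H\<close> and at \<open>p\<close>,
      so it sees only the exponent of \<open>b i\<close>.\<close>
    hence "0 = n * \<phi> i (b i)"
      using \<phi>H[OF n] add[OF i(1) pow p(1), of n] p(2)[OF i(1)] additive_int_pow(3)[OF P add[OF i(1)] i(2)] by simp
    hence "n = 0" using dual i by auto
    hence "p \<in> H" using n p PG by simp
    thus ?case using insert H_def by auto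
  qed
  ultimately show ?thesis using J0 by blast
qed

end


section \<open>Magnus coefficients\<close>

context group
begin

lemma lower_central_2: "lower_central G H 2 = comm_subgroup G H H"
  and lower_central_3: "lower_central G H 3 = comm_subgroup G (lower_central G H 2) H"
  and lower_central_4: "lower_central G H 4 = comm_subgroup G (lower_central G H 3) H"
  by (simp_all add: eval_nat_numeral)

lemma lower_central_comm_numeral:
  assumes "subgroup H G" "e \<in> H"
  shows "a \<in> H \<Longrightarrow> comm a e \<in> lower_central G H 2"
    and "a \<in> lower_central G H 2 \<Longrightarrow> comm a e \<in> lower_central G H 3"
    and "a \<in> lower_central G H 3 \<Longrightarrow> comm a e \<in> lower_central G H 4"
    and "a \<in> lower_central G H 2 \<Longrightarrow> comm e a \<in> lower_central G H 3"
    and "a \<in> lower_central G H 3 \<Longrightarrow> comm e a \<in> lower_central G H 4"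
  using lower_central_comm[OF assms(1) _ assms(2), of a 0]
    lower_central_comm[OF assms(1) _ assms(2), of a 1]
    lower_central_comm[OF assms(1) _ assms(2), of a 2]
  by (simp_all add: eval_nat_numeral)

lemma lower_central_numeral_subset:
  assumes "subgroup H G"
  shows "lower_central G H 3 \<subseteq> lower_central G H 2"
    and "lower_central G H 4 \<subseteq> lower_central G H 3"
  using lower_central_antimono[OF assms, of 1] lower_central_antimono[OF assms, of 2]
  by (simp_all add: eval_nat_numeral)

lemmas \<gamma>_subgroup = lower_central_subgroup[OF subgroup_self]
lemmas \<gamma>_comm = lower_central_comm_numeral[OF subgroup_self]
lemmas \<gamma>_subset = lower_central_numeral_subset[OF subgroup_self]

lemma \<gamma>_closed: "a \<in> \<gamma> n \<Longrightarrow> a \<in> carrier G"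
  using subgroup.mem_carrier[OF \<gamma>_subgroup] .

text \<open>\<open>comm_conj\<close> turns the conjugated entry into an outer conjugation by
  \<open>b\<close> and a factor \<open>q\<close> in \<open>\<gamma> 3\<close> at the first entry.
  Both cost only factors in \<open>\<gamma> 4\<close>. As \<open>T\<close> is just a subgroup, these
  are stripped off one at a time at the left or right end.\<close>

lemma double_comm_conj_iff:
  assumes T: "subgroup T G" "\<gamma> 4 \<subseteq> T" and abc: "a \<in> carrier G" "b \<in> carrier G" "c \<in> carrier G"
  shows "comm (comm a b) (b \<otimes> c \<otimes> inv b) \<in> T \<longleftrightarrow> comm (comm a b) c \<in> T"
proof -
  define p where "p = comm a b"
  define q where "q = comm (inv b) p"
  define x where "x = comm (q \<otimes> p) c"
  have p: "p \<in> \<gamma> 2" unfolding p_def using abc by (intro \<gamma>_comm)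
  have q: "q \<in> \<gamma> 3" unfolding q_def using abc p by (intro \<gamma>_comm) auto
  have pq: "p \<in> carrier G" "q \<in> carrier G" using p q \<gamma>_closed by auto
  have pc: "comm p c \<in> \<gamma> 3" using p abc by (intro \<gamma>_comm)
  have x_eq: "x = comm q (comm p c) \<otimes> comm p c \<otimes> comm q c"
    using pq abc by (simp add: x_def comm_mult_left)
  have qT: "comm q (comm p c) \<in> \<gamma> 4" "comm q c \<in> \<gamma> 4"
    using q pq abc by (auto intro: \<gamma>_comm)
  have "x \<in> \<gamma> 3"
    unfolding x_eq using qT pc \<gamma>_subset by (intro subgroup.m_closed[OF \<gamma>_subgroup]) auto
  hence bx: "comm b x \<in> \<gamma> 4" using abc by (intro \<gamma>_comm)
  have xG: "x \<in> carrier G" using pq abc by (simp add: x_def)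
  have "comm p (b \<otimes> c \<otimes> inv b) = b \<otimes> x \<otimes> inv b"
    unfolding x_def q_def using pq(1) abc(2,3) by (rule comm_conj)
  also have "\<dots> = comm b x \<otimes> x" using xG abc by (simp add: conj_eq_comm)
  also have "\<dots> \<in> T \<longleftrightarrow> x \<in> T"
    using bx T xG by (intro subgroup_mult_cancel_left) auto
  also have "x \<in> T \<longleftrightarrow> comm q (comm p c) \<otimes> comm p c \<in> T"
    unfolding x_eq using qT T pq abc by (intro subgroup_mult_cancel_right) auto
  also have "\<dots> \<longleftrightarrow> comm p c \<in> T"
    using qT T pq abc by (intro subgroup_mult_cancel_left) auto
  finally show ?thesis by (simp add: p_def)
qed

text \<open>Modulo \<open>\<gamma> 4\<close> the conjugations in \<open>Hall_Witt\<close> disappear,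
  and it becomes the Jacobi identity.\<close>

lemma Jacobi_mod_\<gamma>4:
  assumes T: "subgroup T G" "\<gamma> 4 \<subseteq> T" and abc: "a \<in> carrier G" "b \<in> carrier G" "c \<in> carrier G"
    and bca: "comm (comm b c) a \<in> T" and cab: "comm (comm c a) b \<in> T"
  shows "comm (comm a b) c \<in> T"
proof -
  have 1: "comm (comm b c) (c \<otimes> a \<otimes> inv c) \<in> T" "comm (comm c a) (a \<otimes> b \<otimes> inv a) \<in> T"
    using double_comm_conj_iff[OF T] abc bca cab by auto
  have "comm (comm a b) (b \<otimes> c \<otimes> inv b) \<otimes> comm (comm b c) (c \<otimes> a \<otimes> inv c)
      \<otimes> comm (comm c a) (a \<otimes> b \<otimes> inv a) \<in> T"
    using Hall_Witt[OF abc] subgroup.one_closed[OF T(1)] by simp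
  hence "comm (comm a b) (b \<otimes> c \<otimes> inv b) \<in> T"
    using subgroup_mult_cancel_right[OF T(1) 1(1)] subgroup_mult_cancel_right[OF T(1) 1(2)] abc
    by simp
  thus ?thesis using double_comm_conj_iff[OF T abc] by simp
qed

text \<open>Commutators are bilinear modulo \<open>T\<close>: the second entry is extended from
  generators to the whole group first, then the first entry.\<close>

lemma comm_in_subgroup_if_generators:
  assumes T: "subgroup T G"
    and central: "\<And>a e f. \<lbrakk>a \<in> carrier G; e \<in> carrier G; f \<in> carrier G\<rbrakk> \<Longrightarrow> comm e (comm a f) \<in> T"
    and A: "A \<subseteq> carrier G" "carrier G \<subseteq> generate G A"
    and "\<And>a b. a \<in> A \<Longrightarrow> b \<in> A \<Longrightarrow> comm a b \<in> T"
    and ef: "e \<in> carrier G" "f \<in> carrier G"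
  shows "comm e f \<in> T"
proof -
  have "comm a f \<in> T" if a: "a \<in> A" for a
  proof -
    have aG: "a \<in> carrier G" using a A by auto
    have "generate G A \<subseteq> {e \<in> carrier G. comm a e \<in> T}"
      by (rule generate_subgroup_incl[OF _ subgroup_comm_right[OF T aG]]) (use A assms(5) a central aG in auto)
    thus ?thesis using A ef by auto
  qed
  hence "generate G A \<subseteq> {e \<in> carrier G. comm e f \<in> T}"
    by (intro generate_subgroup_incl[OF _ subgroup_comm_left[OF T ef(2) subgroup_self]])
       (use A central ef in auto)
  thus ?thesis using A ef by auto
qed

end

text \<open>An abstract Magnus map: the series with constant term 1 and these coefficients at the
  monomials of degree 1, 2, 3 depends multiplicatively on \<open>a\<close> modulo degree 4. The same
  facts then serve the product of the Magnus group with the free group, its subgroup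
  \<open>E\<close>, and \<open>R\<close> with coefficients pulled back along the section.\<close>

locale magnus_coefficients = group G for G (structure) +
  fixes c1 :: "'a \<Rightarrow> 'z \<Rightarrow> int" and c2 :: "'a \<Rightarrow> 'z \<Rightarrow> 'z \<Rightarrow> int"
    and c3 :: "'a \<Rightarrow> 'z \<Rightarrow> 'z \<Rightarrow> 'z \<Rightarrow> int"
  assumes c1_mult: "\<lbrakk>a \<in> carrier G; b \<in> carrier G\<rbrakk> \<Longrightarrow> c1 (a \<otimes> b) p = c1 a p + c1 b p"
    and c2_mult: "\<lbrakk>a \<in> carrier G; b \<in> carrier G\<rbrakk>
      \<Longrightarrow> c2 (a \<otimes> b) p q = c2 a p q + c1 a p * c1 b q + c2 b p q"
    and c3_mult: "\<lbrakk>a \<in> carrier G; b \<in> carrier G\<rbrakk>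
      \<Longrightarrow> c3 (a \<otimes> b) p q r = c3 a p q r + c2 a p q * c1 b r + c1 a p * c2 b q r + c3 b p q r"
begin

lemma c1_one [simp]: "c1 \<one> p = 0"
  using c1_mult[of \<one> \<one>] by simp

lemma c2_one [simp]: "c2 \<one> p q = 0"
  using c2_mult[of \<one> \<one>] by simp

lemma c3_one [simp]: "c3 \<one> p q r = 0"
  using c3_mult[of \<one> \<one>] by simp

lemma c1_inv: "a \<in> carrier G \<Longrightarrow> c1 (inv a) p = - c1 a p"
  using c1_mult[of a "inv a" p] by simp

lemma c2_inv: "a \<in> carrier G \<Longrightarrow> (\<And>p. c1 a p = 0) \<Longrightarrow> c2 (inv a) p q = - c2 a p q"
  using c2_mult[of a "inv a" p q] by simp

lemma c3_inv:
  "a \<in> carrier G \<Longrightarrow> (\<And>p. c1 a p = 0) \<Longrightarrow> (\<And>p q. c2 a p q = 0) \<Longrightarrow> c3 (inv a) p q r = - c3 a p q r"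
  using c3_mult[of a "inv a" p q r] by (simp add: c1_inv)

lemma c1_comm: "a \<in> carrier G \<Longrightarrow> b \<in> carrier G \<Longrightarrow> c1 (comm a b) p = 0"
  by (simp add: comm_def c1_mult c1_inv)

text \<open>Comparing coefficients in
  \<open>comm a b \<otimes> (b \<otimes> a) = a \<otimes> b\<close> avoids expanding inverses: the
  commutator has no linear coefficients, so no mixed term survives. In \<open>c3_comm\<close> the
  assumption on \<open>a\<close> removes its quadratic coefficients as well.\<close>

lemma c2_comm:
  assumes "a \<in> carrier G" "b \<in> carrier G"
  shows "c2 (comm a b) p q = c1 a p * c1 b q - c1 b p * c1 a q"
  using c2_mult[of "comm a b" "b \<otimes> a" p q] assms
  by (simp add: comm_swap_mult c1_comm c2_mult)

lemma c3_comm: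
  assumes "a \<in> carrier G" "b \<in> carrier G" "\<And>p. c1 a p = 0"
  shows "c3 (comm a b) p q r = c2 a p q * c1 b r - c1 b p * c2 a q r"
  using c3_mult[of "comm a b" "b \<otimes> a" p q r] assms
  by (simp add: comm_swap_mult c1_comm c2_comm c3_mult)

lemma c1_vanishing_subgroup: "subgroup {a \<in> carrier G. \<forall>p\<in>A. c1 a p = 0} G"
  by (rule subgroupI) (auto simp: c1_mult c1_inv intro!: exI[of _ \<one>])

text \<open>\<open>c2\<close> is additive where all linear coefficients vanish. Hence the lower
  degree condition is imposed at every position, while the top one may be restricted to arbitrary
  positions \<open>A\<close>; likewise for \<open>c3\<close>.\<close>

lemma c2_vanishing_subgroup:
  "subgroup {a \<in> carrier G. (\<forall>p. c1 a p = 0) \<and> (\<forall>p q. A p q \<longrightarrow> c2 a p q = 0)} G"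
  by (rule subgroupI) (auto simp: c1_mult c1_inv c2_mult c2_inv intro!: exI[of _ \<one>])

lemma c3_vanishing_subgroup:
  "subgroup {a \<in> carrier G. (\<forall>p. c1 a p = 0) \<and> (\<forall>p q. c2 a p q = 0) \<and> (\<forall>p q r. A p q r \<longrightarrow> c3 a p q r = 0)} G"
  by (rule subgroupI)
     (auto simp: c1_mult c1_inv c2_mult c2_inv c3_mult c3_inv intro!: exI[of _ \<one>])

lemma c1_\<gamma>2:
  assumes "a \<in> \<gamma> 2"
  shows "c1 a p = 0"
proof -
  have "\<gamma> 2 \<subseteq> {a \<in> carrier G. \<forall>p\<in>UNIV. c1 a p = 0}"
    unfolding lower_central_2
    by (rule comm_subgroup_least[OF c1_vanishing_subgroup]) (simp add: c1_comm)
  thus ?thesis using assms by auto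
qed

lemma c2_\<gamma>3:
  assumes "a \<in> \<gamma> 3"
  shows "c2 a p q = 0"
proof -
  have "\<gamma> 3 \<subseteq> {a \<in> carrier G. (\<forall>p. c1 a p = 0) \<and> (\<forall>p q. True \<longrightarrow> c2 a p q = 0)}"
    unfolding lower_central_3
    by (rule comm_subgroup_least[OF c2_vanishing_subgroup])
       (auto simp: c1_comm c2_comm c1_\<gamma>2 \<gamma>_closed)
  thus ?thesis using assms by auto
qed

lemma c3_\<gamma>4:
  assumes "a \<in> \<gamma> 4"
  shows "c3 a p q r = 0"
proof -
  have "c1 a p = 0" if "a \<in> \<gamma> 3" for a p using that c1_\<gamma>2 \<gamma>_subset by blast
  hence "\<gamma> 4 \<subseteq> {a \<in> carrier G. (\<forall>p. c1 a p = 0) \<and> (\<forall>p q. c2 a p q = 0) \<and>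
      (\<forall>p q r. True \<longrightarrow> c3 a p q r = 0)}"
    unfolding lower_central_4
    by (intro comm_subgroup_least[OF c3_vanishing_subgroup])
       (auto simp: c1_comm c2_comm c3_comm c2_\<gamma>3 \<gamma>_closed)
  thus ?thesis using assms by auto
qed

end

text \<open>Fixing the linear coefficients of the letters determines, by \<open>c2_comm\<close> and
  \<open>c3_comm\<close>, the quadratic coefficients of their commutators and the cubic ones of
  their double commutators. The order \<open>lt\<close> serves to single out basic
  commutators.\<close>

locale magnus_generated = magnus_coefficients G c1 c2 c3
  for G (structure) and c1 :: "'a \<Rightarrow> 'z \<Rightarrow> int" and c2 c3 +
  fixes l :: "'z \<Rightarrow> 'a" and Z :: "'z set" and lt :: "'z \<Rightarrow> 'z \<Rightarrow> bool"
  assumes l_closed: "z \<in> Z \<Longrightarrow> l z \<in> carrier G"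
    and gen: "carrier G \<subseteq> generate G (l ` Z)"
    and c1_l: "z \<in> Z \<Longrightarrow> c1 (l z) p = (if p = z then 1 else 0)"
    and asym: "lt p q \<Longrightarrow> \<not> lt q p"
    and trans: "lt p q \<Longrightarrow> lt q r \<Longrightarrow> lt p r"
    and total: "lt p q \<or> p = q \<or> lt q p"
begin

lemma irrefl [simp]: "\<not> lt p p"
  using asym by blast

lemma in_\<gamma>2_if_c1_vanishes:
  assumes "a \<in> carrier G" "\<And>z. z \<in> Z \<Longrightarrow> c1 a z = 0"
  shows "a \<in> \<gamma> 2"
proof (rule mem_if_dual_coordinates_vanish[where P = "carrier G" and b = l and I = Z
      and \<phi> = "\<lambda>z a. c1 a z"])
  show "carrier G \<subseteq> generate G (l ` Z \<union> \<gamma> 2)"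
    using gen mono_generate[of "l ` Z" "l ` Z \<union> \<gamma> 2"] by auto
qed (use assms l_closed in
  \<open>auto simp: subgroup_self \<gamma>_subgroup \<gamma>_closed \<gamma>_comm c1_mult c1_\<gamma>2 c1_l\<close>)

text \<open>\<open>\<gamma> 2\<close> modulo \<open>\<gamma> 3\<close> is generated by commutators
  of letters. Swapping the letters inverts them, so those with \<open>lt q p\<close> suffice, and
  \<open>c2\<close> at \<open>(p, q)\<close> is the dual coordinate.\<close>

lemma in_\<gamma>3_if_c2_vanishes:
  assumes "a \<in> \<gamma> 2" "\<And>p q. c2 a p q = 0"
  shows "a \<in> \<gamma> 3"
proof (rule mem_if_dual_coordinates_vanish[where P = "\<gamma> 2" and b = "\<lambda>(p, q). comm (l p) (l q)"
      and I = "{(p, q). p \<in> Z \<and> q \<in> Z \<and> lt q p}" and \<phi> = "\<lambda>(p, q) a. c2 a p q"])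
  let ?B = "(\<lambda>(p, q). comm (l p) (l q)) ` {(p, q). p \<in> Z \<and> q \<in> Z \<and> lt q p}"
  let ?T = "generate G (?B \<union> \<gamma> 3)"
  show "?B \<subseteq> \<gamma> 2" by (auto simp: l_closed intro!: \<gamma>_comm)
  hence T: "subgroup ?T G" by (intro generate_is_subgroup) (auto dest!: \<gamma>_closed)
  have \<gamma>3: "x \<in> ?T" if "x \<in> \<gamma> 3" for x using that by (auto intro: generate.incl)
  have "comm e f \<in> ?T" if ef: "e \<in> carrier G" "f \<in> carrier G" for e f
  proof (rule comm_in_subgroup_if_generators[OF T _ _ gen _ ef])
    fix x y assume "x \<in> l ` Z" "y \<in> l ` Z"
    then obtain p q where pq: "p \<in> Z" "q \<in> Z" "x = l p" "y = l q" by auto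
    consider "lt q p" | "p = q" | "lt p q" using total by blast
    thus "comm x y \<in> ?T"
    proof cases
      case 1
      thus ?thesis using pq by (auto intro!: generate.incl)
    next
      case 2
      thus ?thesis using pq by (simp add: comm_self l_closed generate.one)
    next
      case 3
      hence "comm y x \<in> ?B" using pq by auto
      hence "inv (comm y x) \<in> ?T" by (intro generate.inv) simp
      thus ?thesis using pq by (simp add: inv_comm l_closed)
    qed
  qed (use l_closed in \<open>auto intro!: \<gamma>3 \<gamma>_comm\<close>)
  thus "\<gamma> 2 \<subseteq> ?T"
    unfolding lower_central_2[of "carrier G"] by (intro comm_subgroup_least[OF T])
  show "(case i of (p, q) \<Rightarrow> \<lambda>a. c2 a p q) (case j of (p, q) \<Rightarrow> comm (l p) (l q)) = 0 \<longleftrightarrow> i \<noteq> j"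
    if "i \<in> {(p, q). p \<in> Z \<and> q \<in> Z \<and> lt q p}" "j \<in> {(p, q). p \<in> Z \<and> q \<in> Z \<and> lt q p}" for i j
    using that asym by (auto simp: c2_comm l_closed c1_l split: if_splits)
  show "comm p q \<in> \<gamma> 3" if "p \<in> \<gamma> 2" "q \<in> \<gamma> 2" for p q
    using that by (blast intro: \<gamma>_comm \<gamma>_closed)
  show "(case i of (p, q) \<Rightarrow> \<lambda>a. c2 a p q) (x \<otimes> y) =
      (case i of (p, q) \<Rightarrow> \<lambda>a. c2 a p q) x + (case i of (p, q) \<Rightarrow> \<lambda>a. c2 a p q) y"
    if "x \<in> \<gamma> 2" "y \<in> \<gamma> 2" for i x y
    using that[THEN \<gamma>_closed] that by (simp add: split_def c2_mult c1_\<gamma>2)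
  show "(case i of (p, q) \<Rightarrow> \<lambda>a. c2 a p q) n = 0" if "n \<in> \<gamma> 3" for i n
    using that by (simp add: split_def c2_\<gamma>3)
  show "(case i of (p, q) \<Rightarrow> \<lambda>a. c2 a p q) a = 0" for i
    using assms(2) by (simp add: split_def)
qed (rule \<gamma>_subgroup \<gamma>_subset assms(1))+

text \<open>The cubic part of a double commutator of letters is the Lie bracket [[X_i, X_j], X_k],
  that is, X_i X_j X_k - X_j X_i X_k - X_k X_i X_j + X_k X_j X_i.\<close>

lemma c3_double_comm:
  assumes "i \<in> Z" "j \<in> Z" "k \<in> Z"
  shows "c3 (comm (comm (l i) (l j)) (l k)) p q r =
    (if i = p \<and> j = q \<and> k = r then 1 else 0) - (if j = p \<and> i = q \<and> k = r then 1 else 0)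
    - (if k = p \<and> i = q \<and> j = r then 1 else 0) + (if k = p \<and> j = q \<and> i = r then 1 else 0)"
proof -
  have "c3 (comm (comm (l i) (l j)) (l k)) p q r =
      (c1 (l i) p * c1 (l j) q - c1 (l j) p * c1 (l i) q) * c1 (l k) r
      - c1 (l k) p * (c1 (l i) q * c1 (l j) r - c1 (l j) q * c1 (l i) r)"
    using assms by (simp add: c3_comm c2_comm c1_comm l_closed)
  thus ?thesis
    unfolding assms[THEN c1_l] of_bool_def[symmetric] of_bool_conj left_diff_distrib right_diff_distrib
    unfolding eq_commute[of p] eq_commute[of q] eq_commute[of r] by (simp only: mult.assoc)
qed

text \<open>The index set consists of the triples \<open>i > j \<le> k\<close> of the basic commutators in the letters
  from \<open>Xs\<close> and of the triples \<open>x, y, x'\<close> with only \<open>y\<close> outside \<open>Xs\<close>; these span the complement of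
  \<open>[V, B, B]\<close> in the third component of the free Lie ring on \<open>V = A \<oplus> B\<close>, where \<open>A\<close> is spanned by
  \<open>Xs\<close> and \<open>B\<close> by the other letters.\<close>

lemma in_subgroup_if_c3_vanishes:
  assumes Xs: "Xs \<subseteq> Z" and S: "S \<subseteq> carrier G" "\<And>z. z \<in> Z \<Longrightarrow> z \<notin> Xs \<Longrightarrow> l z \<in> S"
    and c1_S: "\<And>s x. s \<in> S \<Longrightarrow> x \<in> Xs \<Longrightarrow> c1 s x = 0"
    and N: "subgroup N G" "\<gamma> 4 \<subseteq> N"
    and NS: "\<And>e s t. e \<in> carrier G \<Longrightarrow> s \<in> S \<Longrightarrow> t \<in> S \<Longrightarrow> comm (comm e s) t \<in> N"
    and a: "a \<in> \<gamma> 3" "\<And>p q r. q \<in> Xs \<Longrightarrow> r \<in> Xs \<Longrightarrow> c3 a p q r = 0"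
  shows "a \<in> N"
proof -
  \<comment> \<open>\<open>N\<close> may contain elements outside \<open>\<gamma> 3\<close> or with
    nonzero coordinates. The detection lemma is therefore applied to the part \<open>M\<close> of
    \<open>N\<close> on which the coordinates vanish.\<close>
  define M where "M = {b \<in> N \<inter> \<gamma> 3. \<forall>p. \<forall>q\<in>Xs. \<forall>r\<in>Xs. c3 b p q r = 0}"
  define I where "I = {(i, j, k). i \<in> Xs \<and> j \<in> Xs \<and> k \<in> Xs \<and> lt j i \<and> \<not> lt k j}
    \<union> {(i, j, k). i \<in> Xs \<and> j \<in> Z - Xs \<and> k \<in> Xs}"
  define b where "b = (\<lambda>(i, j, k). comm (comm (l i) (l j)) (l k))"
  \<comment> \<open>The coordinate of \<open>(i, j, k)\<close> is read at the monomial
    \<open>(j, i, k)\<close>, where its own commutator has coefficient -1. The letter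
    \<open>j\<close>, the only one possibly outside \<open>Xs\<close>, stands first there, so the
    vanishing hypothesis on \<open>a\<close> applies. For \<open>j = k\<close> that coefficient
    would be -2, and \<open>(i, j, j)\<close> with coefficient 1 is taken.\<close>
  define \<phi> where "\<phi> = (\<lambda>(i, j, k) a. if j = k then c3 a i j j else c3 a j i k)"
  have c12: "c1 e p = 0" "c2 e p q = 0" if "e \<in> \<gamma> 3" for e p q
    using that c1_\<gamma>2 c2_\<gamma>3 \<gamma>_subset by blast+
  have G: "e \<in> carrier G" if "e \<in> \<gamma> 3 \<or> e \<in> S \<or> e \<in> N" for e
    using that \<gamma>_closed S(1) subgroup.mem_carrier[OF N(1)] by auto
  have "M = N \<inter> \<gamma> 3 \<inter> {b \<in> carrier G. (\<forall>p. c1 b p = 0) \<and> (\<forall>p q. c2 b p q = 0) \<and>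
      (\<forall>p q r. q \<in> Xs \<and> r \<in> Xs \<longrightarrow> c3 b p q r = 0)}"
    unfolding M_def using c12 G by blast
  moreover have "subgroup \<dots> G"
    by (intro subgroups_Inter_pair N(1) \<gamma>_subgroup c3_vanishing_subgroup)
  ultimately have M: "subgroup M G" by simp
  have M\<gamma>: "\<gamma> 4 \<subseteq> M" using N(2) \<gamma>_subset c3_\<gamma>4 unfolding M_def by blast
  have MS: "comm (comm e s) t \<in> M" "comm (comm s e) t \<in> M"
    if e: "e \<in> carrier G" and st: "s \<in> S" "t \<in> S" for e s t
  proof -
    have es: "comm e s \<in> \<gamma> 2" using e G st by (auto intro: \<gamma>_comm)
    \<comment> \<open>By \<open>c3_comm\<close> and \<open>c2_comm\<close> every term contains a
      linear coefficient of \<open>s\<close> or \<open>t\<close> at \<open>q\<close> or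
      \<open>r\<close>.\<close>
    have "c3 (comm (comm e s) t) p q r = 0" if "q \<in> Xs" "r \<in> Xs" for p q r
      using that st e by (simp add: c3_comm c2_comm c1_comm c1_S G)
    thus 1: "comm (comm e s) t \<in> M"
      unfolding M_def using NS es e st G by (auto intro: \<gamma>_comm)
    have "subgroup {p \<in> \<gamma> 2. comm p t \<in> M} G"
    proof (rule subgroup_comm_left[OF M _ \<gamma>_subgroup])
      show "comm p (comm q t) \<in> M" if "p \<in> \<gamma> 2" "q \<in> \<gamma> 2" for p q
        using that M\<gamma> G[of t] st by (blast intro: \<gamma>_comm \<gamma>_closed)
    qed (use G st in auto)
    from subgroup.m_inv_closed[OF this, of "comm e s"] 1 es
    show "comm (comm s e) t \<in> M" using e G st by (simp add: inv_comm)
  qed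
  let ?T = "generate G (b ` I \<union> M)"
  have IZ: "i \<in> Z \<and> j \<in> Z \<and> k \<in> Z" if "(i, j, k) \<in> I" for i j k
    using that Xs by (auto simp: I_def)
  have b\<gamma>: "b ` I \<subseteq> \<gamma> 3"
    using IZ by (auto simp: b_def intro!: \<gamma>_comm(2)[OF l_closed \<gamma>_comm(1)[OF l_closed l_closed]])
  hence T: "subgroup ?T G"
    by (intro generate_is_subgroup) (auto simp: M_def dest!: \<gamma>_closed)
  have TM: "x \<in> ?T" if "x \<in> M" for x using that by (auto intro: generate.incl)
  have T\<gamma>: "\<gamma> 4 \<subseteq> ?T" using M\<gamma> TM by blast
  have basic: "comm (comm (l i) (l j)) (l k) \<in> ?T" if "(i, j, k) \<in> I" for i j k
    using that by (force simp: b_def intro!: generate.incl)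
  have left: "subgroup {p \<in> \<gamma> 2. comm p e \<in> ?T} G" if e: "e \<in> carrier G" for e
  proof (rule subgroup_comm_left[OF T e \<gamma>_subgroup])
    show "comm p (comm q e) \<in> ?T" if "p \<in> \<gamma> 2" "q \<in> \<gamma> 2" for p q
      using that T\<gamma> e by (blast intro: \<gamma>_comm \<gamma>_closed)
  qed
  have swap: "comm (comm (l j) (l i)) (l k) \<in> ?T"
    if "comm (comm (l i) (l j)) (l k) \<in> ?T" "i \<in> Z" "j \<in> Z" "k \<in> Z" for i j k
  proof -
    have "comm (l i) (l j) \<in> \<gamma> 2" using that by (intro \<gamma>_comm(1) l_closed)
    with subgroup.m_inv_closed[OF left[OF l_closed[OF that(4)]], of "comm (l i) (l j)"] that(1)
    have "inv (comm (l i) (l j)) \<in> {p \<in> \<gamma> 2. comm p (l k) \<in> ?T}" by blast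
    thus ?thesis using that(2,3) l_closed by (simp only: inv_comm mem_Collect_eq)
  qed
  have Jacobi: "comm (comm (l i) (l j)) (l k) \<in> ?T"
    if "comm (comm (l j) (l k)) (l i) \<in> ?T" "comm (comm (l k) (l i)) (l j) \<in> ?T"
      "i \<in> Z" "j \<in> Z" "k \<in> Z" for i j k
    by (rule Jacobi_mod_\<gamma>4[OF T T\<gamma> l_closed l_closed l_closed]) (rule that)+
  have Y: "l z \<in> S \<and> l z \<in> carrier G" if "z \<in> Z" "z \<notin> Xs" for z using that S by auto
  have xyx_yxx: "comm (comm (l i) (l j)) (l k) \<in> ?T \<and> comm (comm (l j) (l i)) (l k) \<in> ?T"
    if "i \<in> Xs" "j \<in> Z" "j \<notin> Xs" "k \<in> Xs" for i j k
  proof -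
    have "(i, j, k) \<in> I" using that unfolding I_def by blast
    hence "comm (comm (l i) (l j)) (l k) \<in> ?T" by (rule basic)
    thus ?thesis using swap that Xs by blast
  qed
  have xxx_less: "comm (comm (l i) (l j)) (l k) \<in> ?T"
    if ijk: "i \<in> Xs" "j \<in> Xs" "k \<in> Xs" "lt j i" for i j k
  proof (cases "lt k j")
    \<comment> \<open>Now \<open>k\<close>, \<open>j\<close>, \<open>i\<close> increase, so the
      commutator is not basic. Of the other two in the Jacobi identity, \<open>(j, k, i)\<close> is
      basic and \<open>(k, i, j)\<close> becomes basic when its first two letters are
      swapped.\<close>
    case True
    have Z: "i \<in> Z" "j \<in> Z" "k \<in> Z" using ijk Xs by auto
    have "lt k i" using True ijk(4) by (rule trans)
    show ?thesis
    proof (rule Jacobi[OF _ _ Z])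
      show "comm (comm (l j) (l k)) (l i) \<in> ?T"
        by (rule basic) (use ijk True \<open>lt k i\<close> asym in \<open>auto simp: I_def\<close>)
      show "comm (comm (l k) (l i)) (l j) \<in> ?T"
        by (rule swap[OF basic Z(1,3,2)]) (use ijk True \<open>lt k i\<close> asym in \<open>auto simp: I_def\<close>)
    qed
  next
    case False
    thus ?thesis by (intro basic) (use ijk in \<open>auto simp: I_def\<close>)
  qed
  have letters: "comm (comm (l i) (l j)) (l k) \<in> ?T" if ijk: "i \<in> Z" "j \<in> Z" "k \<in> Z" for i j k
  proof -
    \<comment> \<open>In the case names \<open>x\<close> is a letter of \<open>Xs\<close> and
      \<open>y\<close> any other letter. Jacobi reduces \<open>xxy\<close> to \<open>xyx\<close> and
      \<open>yxx\<close>, and \<open>yyx\<close> to commutators that end in a \<open>y\<close> and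
      have another \<open>y\<close> before it; these are in \<open>M\<close>, as in the case
      \<open>yy\<close>.\<close>
    consider (xxx) "i \<in> Xs" "j \<in> Xs" "k \<in> Xs" | (xyx) "i \<in> Xs" "j \<notin> Xs" "k \<in> Xs" | (yxx) "i \<notin> Xs" "j \<in> Xs" "k \<in> Xs"
      | (xxy) "i \<in> Xs" "j \<in> Xs" "k \<notin> Xs" | (yyx) "i \<notin> Xs" "j \<notin> Xs" "k \<in> Xs"
      | (yy) "k \<notin> Xs" "j \<notin> Xs \<or> i \<notin> Xs" by blast
    thus ?thesis
    proof cases
      case xxx
      consider "lt j i" | "i = j" | "lt i j" using total by blast
      thus ?thesis
      proof cases
        case 1
        show ?thesis by (rule xxx_less[OF xxx 1])
      next
        case 2
        thus ?thesis using ijk by (simp add: comm_self l_closed generate.one)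
      next
        case 3
        show ?thesis by (rule swap[OF xxx_less[OF xxx(2,1,3) 3] ijk(2,1,3)])
      qed
    next
      case xyx
      thus ?thesis using xyx_yxx[of i j k] ijk by blast
    next
      case yxx
      thus ?thesis using xyx_yxx[of j i k] ijk by blast
    next
      case xxy
      show ?thesis
        by (rule Jacobi[OF _ _ ijk]) (use ijk xxy xyx_yxx[of j k i] xyx_yxx[of i k j] in blast)+
    next
      case yyx
      show ?thesis
        by (rule Jacobi[OF _ _ ijk]) (use TM MS[OF l_closed[OF ijk(3)]] Y ijk yyx in blast)+
    next
      case yy
      have k: "l k \<in> S" using Y yy ijk by blast
      from yy(2) show ?thesis
      proof
        assume "j \<notin> Xs"
        with k show ?thesis by (intro TM MS(1)) (use Y ijk l_closed in blast)+
      next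
        assume "i \<notin> Xs"
        with k show ?thesis by (intro TM MS(2)) (use Y ijk l_closed in blast)+
      qed
    qed
  qed
  have "a \<in> M"
  proof (rule mem_if_dual_coordinates_vanish[where P = "\<gamma> 3" and b = b and I = I and \<phi> = \<phi>])
    \<comment> \<open>By additivity in each entry, \<open>\<gamma> 3\<close> is generated modulo
      \<open>\<gamma> 4\<close> by double commutators of letters: \<open>?A\<close> and
      \<open>\<gamma> 3\<close> generate \<open>\<gamma> 2\<close>, so it is enough to treat
      \<open>comm p e\<close> for \<open>p\<close> in \<open>?A\<close>, and there for letters
      \<open>e\<close>.\<close>
    let ?A = "\<Union>i\<in>Z. \<Union>j\<in>Z. {comm (l i) (l j)}"
    have A: "?A \<subseteq> \<gamma> 2" using \<gamma>_comm(1) l_closed by blast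
    hence "?A \<union> \<gamma> 3 \<subseteq> carrier G" using \<gamma>_closed by blast
    hence A': "subgroup (generate G (?A \<union> \<gamma> 3)) G" by (rule generate_is_subgroup)
    have "comm e f \<in> generate G (?A \<union> \<gamma> 3)" if ef: "e \<in> carrier G" "f \<in> carrier G" for e f
    proof (rule comm_in_subgroup_if_generators[OF A' _ _ gen _ ef])
      show "l ` Z \<subseteq> carrier G" using l_closed by blast
      show "comm x (comm y z) \<in> generate G (?A \<union> \<gamma> 3)"
        if "y \<in> carrier G" "x \<in> carrier G" "z \<in> carrier G" for x y z
        using that by (intro generate.incl UnI2 \<gamma>_comm)
      show "comm x y \<in> generate G (?A \<union> \<gamma> 3)" if "x \<in> l ` Z" "y \<in> l ` Z" for x y
        using that by (intro generate.incl UnI1) blast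
    qed
    hence gen2: "\<gamma> 2 \<subseteq> generate G (?A \<union> \<gamma> 3)"
      unfolding lower_central_2[of "carrier G"] by (intro comm_subgroup_least[OF A'])
    have A_comm: "comm p e \<in> ?T" if p: "p \<in> ?A" and e: "e \<in> carrier G" for p e
    proof -
      have p\<gamma>: "p \<in> \<gamma> 2" "p \<in> carrier G" using p A \<gamma>_closed by auto
      have "generate G (l ` Z) \<subseteq> {e \<in> carrier G. comm p e \<in> ?T}"
      proof (rule generate_subgroup_incl[OF _ subgroup_comm_right[OF T p\<gamma>(2)]])
        show "l ` Z \<subseteq> {e \<in> carrier G. comm p e \<in> ?T}" using p letters l_closed by blast
        show "comm e (comm p f) \<in> ?T" if "e \<in> carrier G" "f \<in> carrier G" for e f
          using that T\<gamma> p\<gamma> by (blast intro: \<gamma>_comm)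
      qed
      thus ?thesis using gen e by auto
    qed
    have "comm p e \<in> ?T" if p: "p \<in> \<gamma> 2" and e: "e \<in> carrier G" for p e
    proof -
      have "?A \<union> \<gamma> 3 \<subseteq> {p \<in> \<gamma> 2. comm p e \<in> ?T}"
      proof (rule Un_least; rule subsetI)
        show "q \<in> {p \<in> \<gamma> 2. comm p e \<in> ?T}" if "q \<in> ?A" for q
          using A_comm[OF that e] subsetD[OF A that] by simp
        show "q \<in> {p \<in> \<gamma> 2. comm p e \<in> ?T}" if "q \<in> \<gamma> 3" for q
          using subsetD[OF T\<gamma> \<gamma>_comm(3)[OF e that]] subsetD[OF \<gamma>_subset(1) that] by simp
      qed
      hence "generate G (?A \<union> \<gamma> 3) \<subseteq> {p \<in> \<gamma> 2. comm p e \<in> ?T}"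
        by (rule generate_subgroup_incl[OF _ left[OF e]])
      thus ?thesis using gen2 p by auto
    qed
    thus "\<gamma> 3 \<subseteq> ?T"
      unfolding lower_central_3[of "carrier G"] by (intro comm_subgroup_least[OF T])
    show "comm p q \<in> M" if "p \<in> \<gamma> 3" "q \<in> \<gamma> 3" for p q
      using that M\<gamma> by (blast intro: \<gamma>_comm \<gamma>_closed)
    show "\<phi> i (b j) = 0 \<longleftrightarrow> i \<noteq> j" if I: "i \<in> I" "j \<in> I" for i j
    proof -
      obtain i1 i2 i3 j1 j2 j3 where ij: "i = (i1, i2, i3)" "j = (j1, j2, j3)"
        by (metis prod.exhaust)
      have "j1 \<in> Z" "j2 \<in> Z" "j3 \<in> Z" using I IZ unfolding ij by blast+
      note c3_j = c3_double_comm[OF this]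
      have i: "i1 \<in> Xs \<and> i3 \<in> Xs \<and> (i2 \<in> Xs \<and> lt i2 i1 \<and> \<not> lt i3 i2 \<or> i2 \<notin> Xs)"
        and j: "j1 \<in> Xs \<and> j3 \<in> Xs \<and> (j2 \<in> Xs \<and> lt j2 j1 \<and> \<not> lt j3 j2 \<or> j2 \<notin> Xs)"
        using I unfolding ij I_def by blast+
      show ?thesis
      \<comment> \<open>In both cases the conditions on the index triples exclude three of the four
        monomials of \<open>c3_double_comm\<close> at the position read by \<open>\<phi> i\<close>.
        The remaining one occurs there only if the triples agree.\<close>
      proof (cases "i2 = i3")
        case True
        have n: "\<not> (j2 = i1 \<and> j1 = i2 \<and> j3 = i2)" "\<not> (j3 = i1 \<and> j1 = i2 \<and> j2 = i2)"
          "\<not> (j3 = i1 \<and> j2 = i2 \<and> j1 = i2)" using i j asym by metis+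
        show ?thesis
          unfolding ij \<phi>_def b_def prod.case c3_j if_P[OF True] n[THEN if_not_P]
          by (simp, use True in blast)
      next
        case False
        have n: "\<not> (j1 = i2 \<and> j2 = i1 \<and> j3 = i3)" "\<not> (j3 = i2 \<and> j1 = i1 \<and> j2 = i3)"
          "\<not> (j3 = i2 \<and> j2 = i1 \<and> j1 = i3)" using i j asym total False by metis+
        show ?thesis
          unfolding ij \<phi>_def b_def prod.case c3_j if_not_P[OF False] n[THEN if_not_P]
          by (simp, blast)
      qed
    qed
    show "\<phi> i (p \<otimes> q) = \<phi> i p + \<phi> i q" if "p \<in> \<gamma> 3" "q \<in> \<gamma> 3" for i p q
      using that by (simp add: \<phi>_def split_def c3_mult c12 G)
    show "\<phi> i n = 0" if "i \<in> I" "n \<in> M" for i n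
      using that unfolding \<phi>_def I_def M_def by (cases i) auto
    show "\<phi> i a = 0" if "i \<in> I" for i
      using that a(2) unfolding \<phi>_def I_def by (cases i) auto
    show "M \<subseteq> \<gamma> 3" unfolding M_def by blast
  qed (rule \<gamma>_subgroup M b\<gamma> a(1))+
  thus ?thesis by (simp add: M_def)
qed

end

section \<open>Subgroups of free groups\<close>

lemma not_successively_split:
  "\<not> successively P w \<Longrightarrow> \<exists>u a b v. w = u @ a # b # v \<and> \<not> P a b"
proof (induction w rule: induct_list012)
  case (3 x y zs)
  show ?case
  proof (cases "P x y")
    case True
    with 3 obtain u a b v where "y # zs = u @ a # b # v" "\<not> P a b" by auto
    thus ?thesis by (metis append_Cons)
  next
    case False
    thus ?thesis by (metis append_Nil)
  qed
qed auto

section \<open>Words over a free basis\<close>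

context group
begin

lemma letter_val_closed: "B \<subseteq> carrier G \<Longrightarrow> l \<in> B \<times> UNIV \<Longrightarrow> letter_val G l \<in> carrier G"
  by (auto simp: letter_val_def)

lemma letter_val_cancel: "x \<in> carrier G \<Longrightarrow> letter_val G (x, b) \<otimes> letter_val G (x, \<not> b) = \<one>"
  by (simp add: letter_val_def)

lemma word_val_simps [simp]:
  "word_val G [] = \<one>" "word_val G (l # w) = letter_val G l \<otimes> word_val G w"
  by (simp_all add: word_val_def)

lemma word_val_closed:
  "B \<subseteq> carrier G \<Longrightarrow> w \<in> lists (B \<times> UNIV) \<Longrightarrow> word_val G w \<in> carrier G"
  by (induction w) (auto simp: letter_val_closed simp del: mem_Sigma_iff)

lemma word_val_append:
  assumes B: "B \<subseteq> carrier G" "u \<in> lists (B \<times> UNIV)" "v \<in> lists (B \<times> UNIV)"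
  shows "word_val G (u @ v) = word_val G u \<otimes> word_val G v"
  using B(2)
proof (induction u)
  case (Cons l u)
  hence "letter_val G l \<in> carrier G" "word_val G u \<in> carrier G" "word_val G v \<in> carrier G"
    using B word_val_closed letter_val_closed by auto
  with Cons show ?case by (simp add: m_assoc)
qed (use word_val_closed[OF B(1,3)] in simp)

lemma word_val_cancel:
  assumes B: "B \<subseteq> carrier G" "u \<in> lists (B \<times> UNIV)" "v \<in> lists (B \<times> UNIV)" and x: "x \<in> B"
  shows "word_val G (u @ (x, b) # (x, \<not> b) # v) = word_val G (u @ v)"
proof -
  have c: "letter_val G (x, c) \<in> carrier G" for c using B x letter_val_closed by auto
  have v: "word_val G v \<in> carrier G" using B word_val_closed by auto
  have "letter_val G (x, b) \<otimes> (letter_val G (x, \<not> b) \<otimes> word_val G v) = word_val G v"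
    using c v B x letter_val_cancel[of x b] by (simp flip: m_assoc add: subset_iff)
  thus ?thesis using B x by (simp add: word_val_append)
qed

text \<open>Uniqueness of reduced words enters here, in place of a universal property. Cancelling
  adjacent inverse letters changes neither the value nor \<open>\<Psi>\<close>, so both words may be
  reduced, and then equal values force equal words.\<close>

lemma free_basis_word_invariant:
  assumes B: "free_basis G B"
    and cancel: "\<And>u x b v. \<lbrakk>u \<in> lists (B \<times> UNIV); v \<in> lists (B \<times> UNIV); x \<in> B\<rbrakk>
      \<Longrightarrow> \<Psi> (u @ (x, b) # (x, \<not> b) # v) = \<Psi> (u @ v)"
    and uv: "u \<in> lists (B \<times> UNIV)" "v \<in> lists (B \<times> UNIV)" "word_val G u = word_val G v"
  shows "\<Psi> u = \<Psi> v"
proof -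
  have BG: "B \<subseteq> carrier G" using B by (simp add: free_basis_def)
  have red: "\<exists>w'\<in>reduced_words B. word_val G w' = word_val G w \<and> \<Psi> w' = \<Psi> w"
    if "w \<in> lists (B \<times> UNIV)" for w
    using that
  proof (induction "length w" arbitrary: w rule: less_induct)
    case less
    show ?case
    proof (cases "w \<in> reduced_words B")
      case False
      hence "\<not> successively (\<lambda>l m. \<not> (fst l = fst m \<and> snd l \<noteq> snd m)) w"
        using less.prems by (simp add: reduced_words_def)
      from not_successively_split[OF this] obtain u l m v where
        w: "w = u @ l # m # v" and lm: "fst l = fst m" "snd l \<noteq> snd m" by auto
      define x where "x = fst l"
      define b where "b = snd l"
      have lm: "l = (x, b)" "m = (x, \<not> b)" using lm by (simp_all add: x_def b_def prod_eq_iff)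
      have uvx: "u \<in> lists (B \<times> UNIV)" "v \<in> lists (B \<times> UNIV)" "x \<in> B"
        using less.prems by (auto simp: w lm)
      hence "u @ v \<in> lists (B \<times> UNIV)" "length (u @ v) < length w" by (auto simp: w)
      with less.hyps obtain w' where "w' \<in> reduced_words B" "word_val G w' = word_val G (u @ v)"
        "\<Psi> w' = \<Psi> (u @ v)" by blast
      moreover have "\<Psi> w = \<Psi> (u @ v)" unfolding w lm by (rule cancel[OF uvx])
      moreover have "word_val G w = word_val G (u @ v)"
        unfolding w lm by (rule word_val_cancel[OF BG uvx])
      ultimately show ?thesis by metis
    qed blast
  qed
  obtain u' where u': "u' \<in> reduced_words B" "word_val G u' = word_val G u" "\<Psi> u' = \<Psi> u"
    using red[OF uv(1)] by blast
  obtain v' where v': "v' \<in> reduced_words B" "word_val G v' = word_val G v" "\<Psi> v' = \<Psi> v"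
    using red[OF uv(2)] by blast
  have "inj_on (word_val G) (reduced_words B)"
    using B by (simp add: free_basis_def bij_betw_def)
  hence "u' = v'" by (rule inj_onD) (use u' v' uv(3) in simp_all)
  thus ?thesis using u' v' by simp
qed

lemma free_basis_words:
  assumes "free_basis G B"
  obtains wd where "\<And>g. g \<in> carrier G \<Longrightarrow> wd g \<in> lists (B \<times> UNIV)"
    "\<And>g. g \<in> carrier G \<Longrightarrow> word_val G (wd g) = g"
proof
  have *: "word_val G ` reduced_words B = carrier G"
    using assms by (simp add: free_basis_def bij_betw_def)
  show "word_val G (inv_into (reduced_words B) (word_val G) g) = g" if "g \<in> carrier G" for g
    using that * by (simp add: f_inv_into_f)
  show "inv_into (reduced_words B) (word_val G) g \<in> lists (B \<times> UNIV)" if "g \<in> carrier G" for g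
    using inv_into_into[of g "word_val G" "reduced_words B"] that *
    unfolding reduced_words_def by blast
qed

lemma free_basis_generate:
  assumes "free_basis G B"
  shows "carrier G \<subseteq> generate G B"
proof
  fix g assume "g \<in> carrier G"
  then obtain w where w: "w \<in> lists (B \<times> UNIV)" "word_val G w = g"
    using free_basis_words[OF assms] by metis
  have "word_val G w \<in> generate G B"
    using w(1)
  proof (induction w)
    case (Cons l w)
    hence "letter_val G l \<in> generate G B"
      by (auto simp: letter_val_def intro: generate.incl generate.inv)
    with Cons show ?case by (simp add: generate.eng)
  qed (simp add: generate.one)
  thus "g \<in> generate G B" using w by simp
qed

end

text \<open>A crossed homomorphism on words: the word is read as a path from \<open>t\<close> in the
  Schreier coset graph with steps \<open>act\<close>, whose edges carry labels \<open>a\<close> in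
  \<open>K\<close>.\<close>

fun cocycle_val :: "('k, 'd) monoid_scheme \<Rightarrow> ('t \<Rightarrow> 'l \<Rightarrow> 'k) \<Rightarrow> ('t \<Rightarrow> 'l \<Rightarrow> 't) \<Rightarrow> 't \<Rightarrow> 'l list \<Rightarrow> 'k" where
  "cocycle_val K a act t [] = \<one>\<^bsub>K\<^esub>"
| "cocycle_val K a act t (l # w) = a t l \<otimes>\<^bsub>K\<^esub> cocycle_val K a act (act t l) w"

context group
begin

text \<open>The Schreier cocycle \<open>t g \<tau>(t g)\<^sup>-\<^sup>1\<close> of a
  transversal is lifted through \<open>\<pi>\<close> letter by letter; freeness makes the lift independent of the
  word representing \<open>g\<close>, and on \<open>R\<close> at the trivial coset the cocycle is the identity.\<close>

lemma free_subgroup_projective: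
  assumes B: "free_basis G B" and R: "subgroup R G" and K: "group K"
    and \<pi>: "\<pi> \<in> hom K G" "\<pi> ` carrier K = R"
  obtains s where "s \<in> hom (G\<lparr>carrier := R\<rparr>) K" "\<And>r. r \<in> R \<Longrightarrow> \<pi> (s r) = r"
proof -
  interpret K: group K by fact
  interpret \<pi>: group_hom K G \<pi> by unfold_locales (rule \<pi>(1))
  have BG: "B \<subseteq> carrier G" using B by (simp add: free_basis_def)
  have RG: "r \<in> carrier G" if "r \<in> R" for r using subgroup.mem_carrier[OF R that] .
  \<comment> \<open>An arbitrary section of sets; it is evaluated only at the Schreier elements
    \<open>sch t x\<close> of \<open>R\<close>.\<close>
  define \<sigma> where "\<sigma> = (\<lambda>r. SOME k. k \<in> carrier K \<and> \<pi> k = r)"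
  have \<sigma>: "\<sigma> r \<in> carrier K" "\<pi> (\<sigma> r) = r" if "r \<in> R" for r
  proof -
    have "\<exists>k. k \<in> carrier K \<and> \<pi> k = r" using that \<pi>(2) by auto
    from someI_ex[OF this] show "\<sigma> r \<in> carrier K" "\<pi> (\<sigma> r) = r" by (auto simp: \<sigma>_def)
  qed
  \<comment> \<open>The representative is \<open>\<one>\<close> on \<open>R\<close>, so that words
    for elements of \<open>R\<close> are loops at \<open>\<one>\<close>. This makes \<open>s\<close>
    multiplicative and yields \<open>\<pi> (s r) = r\<close>.\<close>
  define \<tau> where "\<tau> = (\<lambda>g. if g \<in> R then \<one> else SOME h. h \<in> R #> g)"
  have \<tau>_mem: "\<tau> g \<in> R #> g" if "g \<in> carrier G" for g
  proof (cases "g \<in> R")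
    case True
    hence "R #> g = R" using R by (simp add: coset_join2 RG)
    thus ?thesis using True subgroup.one_closed[OF R] by (simp add: \<tau>_def)
  next
    case False
    have "g \<in> R #> g" using that R by (rule rcos_self)
    with False show ?thesis unfolding \<tau>_def by (auto intro: someI)
  qed
  have \<tau>_R: "\<tau> r = \<one>" if "r \<in> R" for r using that by (simp add: \<tau>_def)
  have \<tau>_closed: "\<tau> g \<in> carrier G" if "g \<in> carrier G" for g
    using \<tau>_mem[OF that] r_coset_subset_G[OF subgroup.subset[OF R] that] by auto
  have \<tau>_left: "\<tau> (r \<otimes> g) = \<tau> g" if "r \<in> R" "g \<in> carrier G" for r g
  proof -
    have "R #> (r \<otimes> g) = R #> g"
      using that R by (simp add: coset_mult_assoc[symmetric] RG subgroup.subset coset_join2)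
    moreover have "r \<otimes> g \<in> R \<longleftrightarrow> g \<in> R"
      using that R by (intro subgroup_mult_cancel_left)
    ultimately show ?thesis by (simp add: \<tau>_def)
  qed
  have \<tau>_quot: "g \<otimes> inv \<tau> g \<in> R" if g: "g \<in> carrier G" for g
  proof -
    obtain r where r: "r \<in> R" "\<tau> g = r \<otimes> g" using \<tau>_mem[OF g] by (auto simp: r_coset_def)
    hence "g \<otimes> inv \<tau> g = inv r" using g RG by (simp add: inv_mult_group)
    thus ?thesis using r subgroup.m_inv_closed[OF R] by simp
  qed
  have \<tau>_mult: "\<tau> (\<tau> g \<otimes> h) = \<tau> (g \<otimes> h)" if "g \<in> carrier G" "h \<in> carrier G" for g h
  proof -
    have "\<tau> (g \<otimes> h) = \<tau> ((g \<otimes> inv \<tau> g) \<otimes> (\<tau> g \<otimes> h))"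
      using that \<tau>_closed by (simp add: m_assoc)
    also have "\<dots> = \<tau> (\<tau> g \<otimes> h)"
      using that \<tau>_closed \<tau>_quot by (intro \<tau>_left) auto
    finally show ?thesis by simp
  qed
  have \<tau>_idem: "\<tau> (\<tau> g) = \<tau> g" if "g \<in> carrier G" for g
    using \<tau>_mult[OF that one_closed] that \<tau>_closed by simp
  define sch where "sch = (\<lambda>t g. t \<otimes> g \<otimes> inv \<tau> (t \<otimes> g))"
  have sch: "sch t g \<in> R" if "t \<in> carrier G" "g \<in> carrier G" for t g
    using that \<tau>_quot by (simp add: sch_def)
  define act where "act = (\<lambda>t l. \<tau> (t \<otimes> letter_val G l))"
  \<comment> \<open>An inverse letter runs backwards along the edge from
    \<open>\<tau> (t \<otimes> inv x)\<close> to \<open>t\<close>, so it gets the inverse of that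
    label. Cancellation therefore holds although \<open>\<sigma>\<close> is arbitrary.\<close>
  define a where "a = (\<lambda>t (x, b). if b then \<sigma> (sch t x) else inv\<^bsub>K\<^esub> \<sigma> (sch (\<tau> (t \<otimes> inv x)) x))"
  let ?m = "cocycle_val K a act"
  define T where "T = {t \<in> carrier G. \<tau> t = t}"
  have TG: "t \<in> carrier G" if "t \<in> T" for t using that by (simp add: T_def)
  have act_T: "act t l \<in> T" if "t \<in> T" "l \<in> B \<times> UNIV" for t l
    using that BG by (simp add: act_def T_def \<tau>_closed \<tau>_idem letter_val_closed del: mem_Sigma_iff)
  have a_closed: "a t l \<in> carrier K" if "t \<in> T" "l \<in> B \<times> UNIV" for t l
    using that BG by (auto simp: a_def T_def \<sigma> sch \<tau>_closed subset_iff)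
  have \<pi>_a: "\<pi> (a t l) = t \<otimes> letter_val G l \<otimes> inv act t l"
    if tl: "t \<in> T" "l \<in> B \<times> UNIV" for t l
  proof -
    obtain x b where l: "l = (x, b)" "x \<in> carrier G" using tl(2) BG by auto
    have t: "t \<in> carrier G" "\<tau> t = t" using tl by (auto simp: T_def)
    show ?thesis
    proof (cases b)
      case True
      thus ?thesis using l t by (simp add: a_def act_def letter_val_def \<sigma> sch) (simp add: sch_def)
    next
      case False
      define u where "u = \<tau> (t \<otimes> inv x)"
      have u: "u \<in> carrier G" using l t by (simp add: u_def \<tau>_closed)
      have "\<tau> (u \<otimes> x) = t" using l t \<tau>_mult[of "t \<otimes> inv x" x] by (simp add: u_def m_assoc)
      hence "sch u x = u \<otimes> x \<otimes> inv t" by (simp add: sch_def)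
      moreover have "\<pi> (a t l) = inv (sch u x)"
        using l t u False by (simp add: a_def \<sigma> sch flip: u_def)
      ultimately show ?thesis
        using l t u False by (simp add: act_def letter_val_def inv_mult_group m_assoc flip: u_def)
    qed
  qed
  have a_cancel: "a t (x, b) \<otimes>\<^bsub>K\<^esub> a (act t (x, b)) (x, \<not> b) = \<one>\<^bsub>K\<^esub>"
    and act_cancel: "act (act t (x, b)) (x, \<not> b) = t" if "t \<in> T" "x \<in> B" for t x b
  proof -
    have t: "t \<in> carrier G" "\<tau> t = t" and x: "x \<in> carrier G" using that BG by (auto simp: T_def)
    have *: "\<tau> (\<tau> (t \<otimes> x) \<otimes> inv x) = t" "\<tau> (\<tau> (t \<otimes> inv x) \<otimes> x) = t"
      using t x by (simp_all add: \<tau>_mult m_assoc)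
    show "act (act t (x, b)) (x, \<not> b) = t" using * by (cases b) (simp_all add: act_def letter_val_def)
    show "a t (x, b) \<otimes>\<^bsub>K\<^esub> a (act t (x, b)) (x, \<not> b) = \<one>\<^bsub>K\<^esub>"
      using * t x by (cases b) (simp_all add: a_def act_def letter_val_def \<sigma> sch \<tau>_closed)
  qed
  have m_closed: "?m t w \<in> carrier K" if "t \<in> T" "w \<in> lists (B \<times> UNIV)" for t w
    using that(2,1) by (induction w arbitrary: t) (auto simp: a_closed act_T simp del: mem_Sigma_iff)
  have m_append: "?m t (u @ v) = ?m t u \<otimes>\<^bsub>K\<^esub> ?m (\<tau> (t \<otimes> word_val G u)) v"
    if "t \<in> T" "u \<in> lists (B \<times> UNIV)" "v \<in> lists (B \<times> UNIV)" for t u v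
    using that(2,1)
  proof (induction u arbitrary: t)
    case Nil
    thus ?case using m_closed that(3) by (simp add: T_def)
  next
    case (Cons l u)
    have l: "letter_val G l \<in> carrier G" using Cons BG letter_val_closed by auto
    have u: "word_val G u \<in> carrier G" using Cons BG word_val_closed by auto
    have t: "t \<in> carrier G" using Cons by (simp add: T_def)
    have "\<tau> (act t l \<otimes> word_val G u) = \<tau> (t \<otimes> word_val G (l # u))"
      using l u t by (simp add: act_def \<tau>_mult m_assoc)
    moreover have "\<tau> (act t l \<otimes> word_val G u) \<in> T"
      using l u t by (simp add: act_def T_def \<tau>_closed \<tau>_idem)
    ultimately show ?case
      using Cons that(3) by (simp add: act_T a_closed m_closed K.m_assoc del: mem_Sigma_iff)
  qed
  \<comment> \<open>Each letter contributes
    \<open>t \<otimes> letter_val G l \<otimes> inv act t l\<close> at its current \<open>t\<close>,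
    and these factors telescope.\<close>
  have \<pi>_m: "\<pi> (?m t w) = t \<otimes> word_val G w \<otimes> inv \<tau> (t \<otimes> word_val G w)"
    if "t \<in> T" "w \<in> lists (B \<times> UNIV)" for t w
    using that(2,1)
  proof (induction w arbitrary: t)
    case Nil
    thus ?case by (simp add: T_def)
  next
    case (Cons l w)
    have l: "letter_val G l \<in> carrier G" using Cons BG letter_val_closed by auto
    have w: "word_val G w \<in> carrier G" using Cons BG word_val_closed by auto
    have t: "t \<in> carrier G" "act t l \<in> carrier G" using Cons act_T TG by auto
    have "\<tau> (act t l \<otimes> word_val G w) = \<tau> (t \<otimes> (letter_val G l \<otimes> word_val G w))"
      using l w t by (simp add: act_def \<tau>_mult m_assoc)
    thus ?case
      using Cons l w t by (simp add: a_closed act_T m_closed \<pi>_a m_assoc \<tau>_closed del: mem_Sigma_iff)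
  qed
  have one_T: "\<one> \<in> T" using subgroup.one_closed[OF R] by (simp add: T_def \<tau>_R)
  have m_cancel: "?m \<one> (u @ (x, b) # (x, \<not> b) # v) = ?m \<one> (u @ v)"
    if "u \<in> lists (B \<times> UNIV)" "v \<in> lists (B \<times> UNIV)" "x \<in> B" for u x b v
  proof -
    have "word_val G u \<in> carrier G" using that BG word_val_closed by auto
    hence t: "\<tau> (\<one> \<otimes> word_val G u) \<in> T" by (simp add: T_def \<tau>_closed \<tau>_idem)
    have "?m t ((x, b) # (x, \<not> b) # v) = ?m t v" if "t \<in> T" for t
    proof -
      have "(x, c) \<in> B \<times> UNIV" for c :: bool using \<open>x \<in> B\<close> by simp
      thus ?thesis
        using that \<open>x \<in> B\<close> \<open>v \<in> _\<close> a_cancel[of t x b] act_cancel[of t x b]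
        by (simp add: a_closed act_T m_closed flip: K.m_assoc del: mem_Sigma_iff)
    qed
    with t that one_T show ?thesis by (simp add: m_append del: cocycle_val.simps)
  qed
  obtain wd where wd: "\<And>g. g \<in> carrier G \<Longrightarrow> wd g \<in> lists (B \<times> UNIV)"
    "\<And>g. g \<in> carrier G \<Longrightarrow> word_val G (wd g) = g"
    using free_basis_words[OF B] by blast
  define s where "s = (\<lambda>g. ?m \<one> (wd g))"
  show ?thesis
  proof
    show "s \<in> hom (G\<lparr>carrier := R\<rparr>) K"
    proof (rule homI)
      fix g h assume "g \<in> carrier (G\<lparr>carrier := R\<rparr>)" "h \<in> carrier (G\<lparr>carrier := R\<rparr>)"
      hence g: "g \<in> R" "g \<in> carrier G" and h: "h \<in> R" "h \<in> carrier G" using RG by auto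
      have "?m \<one> (wd (g \<otimes> h)) = ?m \<one> (wd g @ wd h)"
        by (rule free_basis_word_invariant[OF B m_cancel])
           (use g h wd BG in \<open>auto simp: word_val_append\<close>)
      also have "\<dots> = ?m \<one> (wd g) \<otimes>\<^bsub>K\<^esub> ?m \<one> (wd h)"
        using g h wd one_T by (simp add: m_append \<tau>_R)
      finally show "s (g \<otimes>\<^bsub>G\<lparr>carrier := R\<rparr>\<^esub> h) = s g \<otimes>\<^bsub>K\<^esub> s h" by (simp add: s_def)
    qed (use wd m_closed one_T RG in \<open>auto simp: s_def\<close>)
    show "\<pi> (s r) = r" if "r \<in> R" for r
      using that RG wd one_T by (simp add: s_def \<pi>_m \<tau>_R)
  qed
qed

end

section \<open>The abelianised free group and a basis of \<open>R\<close> modulo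
  \<open>S\<close>\<close>

definition exponent_sum :: "'a \<Rightarrow> ('a \<times> bool) list \<Rightarrow> int" where
  "exponent_sum i w = (\<Sum>l\<leftarrow>w. if fst l = i then (if snd l then 1 else - 1) else 0)"

context group
begin

text \<open>The coordinates are exponent sums, well defined by
  \<open>free_basis_word_invariant\<close>. They are dual to \<open>B\<close>, so
  \<open>mem_if_dual_coordinates_vanish\<close> identifies their common kernel with the derived
  subgroup.\<close>

lemma free_basis_coordinates:
  assumes B: "free_basis G B"
  obtains e :: "'a \<Rightarrow> 'a \<Rightarrow> int" where
    "\<And>i g h. g \<in> carrier G \<Longrightarrow> h \<in> carrier G \<Longrightarrow> e i (g \<otimes> h) = e i g + e i h"
    and "\<And>g. g \<in> carrier G \<Longrightarrow> finite {i. e i g \<noteq> 0}"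
    and "derived G (carrier G) = {g \<in> carrier G. \<forall>i. e i g = 0}"
proof -
  have BG: "B \<subseteq> carrier G" using B by (simp add: free_basis_def)
  obtain wd where wd: "\<And>g. g \<in> carrier G \<Longrightarrow> wd g \<in> lists (B \<times> UNIV)"
    "\<And>g. g \<in> carrier G \<Longrightarrow> word_val G (wd g) = g"
    using free_basis_words[OF B] by blast
  define e where "e = (\<lambda>i g. exponent_sum i (wd g))"
  have e: "e i (word_val G w) = exponent_sum i w" if w: "w \<in> lists (B \<times> UNIV)" for i w
    unfolding e_def
    by (rule free_basis_word_invariant[OF B])
       (use w wd word_val_closed[OF BG w] in \<open>auto simp: exponent_sum_def\<close>)
  have add: "e i (g \<otimes> h) = e i g + e i h" if "g \<in> carrier G" "h \<in> carrier G" for i g h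
  proof -
    have "e i (g \<otimes> h) = e i (word_val G (wd g @ wd h))"
      using that wd BG by (simp add: word_val_append)
    also have "\<dots> = exponent_sum i (wd g @ wd h)" using that wd by (intro e) simp
    finally show ?thesis by (simp add: exponent_sum_def e_def)
  qed
  have fin: "finite {i. e i g \<noteq> 0}" for g
  proof -
    have "exponent_sum i w = 0" if "i \<notin> fst ` set w" for i and w :: "('a \<times> bool) list"
      using that by (induction w) (auto simp: exponent_sum_def)
    hence "{i. e i g \<noteq> 0} \<subseteq> fst ` set (wd g)" unfolding e_def by blast
    thus ?thesis by (rule finite_subset) simp
  qed
  have e_letter: "e i x = (if i = x then 1 else 0)" if "x \<in> B" for i x
    using e[of "[(x, True)]" i] that BG by (auto simp: exponent_sum_def letter_val_def)
  have D: "subgroup (derived G (carrier G)) G"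
    using derived_is_subgroup[of "carrier G"] by simp
  have zero: "e i g = 0" if "g \<in> derived G (carrier G)" for i g
  proof -
    note e_pow = additive_int_pow[where \<phi> = "e i", OF subgroup_self add]
    have "subgroup {g \<in> carrier G. e i g = 0} G"
      by (rule subgroupI)
         (auto simp: add e_pow(1)[OF _ _ one_closed] e_pow(2) intro!: exI[of _ \<one>])
    moreover have "e i (comm a b) = 0" if "a \<in> carrier G" "b \<in> carrier G" for a b
      using add[of "comm a b" "b \<otimes> a" i] that by (simp add: comm_swap_mult add)
    ultimately have "comm_subgroup G (carrier G) (carrier G) \<subseteq> {g \<in> carrier G. e i g = 0}"
      by (intro comm_subgroup_least) auto
    thus ?thesis using that by (auto simp: comm_subgroup_self)
  qed
  have "g \<in> derived G (carrier G)" if g: "g \<in> carrier G" "\<And>i. e i g = 0" for g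
  proof (rule mem_if_dual_coordinates_vanish[OF subgroup_self D, where b = "\<lambda>x. x" and I = B and \<phi> = e])
    show "carrier G \<subseteq> generate G ((\<lambda>x. x) ` B \<union> derived G (carrier G))"
      using free_basis_generate[OF B] mono_generate[of B "B \<union> derived G (carrier G)"] by auto
    show "comm p q \<in> derived G (carrier G)" if "p \<in> carrier G" "q \<in> carrier G" for p q
      using comm_subgroup_mem[OF that] by (simp add: comm_subgroup_self)
  qed (use g BG D subgroup.subset[OF D] add zero e_letter in auto)
  with that[of e] add fin zero subgroup.mem_carrier[OF D] show ?thesis by blast
qed

end

lemma ex_wf_linear_order:
  obtains lt :: "'a \<Rightarrow> 'a \<Rightarrow> bool" where "wfP lt"
    "\<And>x y z. lt x y \<Longrightarrow> lt y z \<Longrightarrow> lt x z" "\<And>x y. lt x y \<or> x = y \<or> lt y x"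
proof -
  obtain r :: "('a \<times> 'a) set" where "Well_order r \<and> Field r = UNIV"
    using well_ordering[where ?'a = 'a] by (rule exE)
  hence *: "trans r" "antisym r" "total r" "wf (r - Id)"
    unfolding well_order_on_def linear_order_on_def partial_order_on_def preorder_on_def by auto
  define lt where "lt = (\<lambda>x y. (x, y) \<in> r - Id)"
  show ?thesis
  proof
    have "{(x, y). lt x y} = r - Id" by (auto simp: lt_def)
    thus "wfP lt" using *(4) by (simp add: wfp_def)
    show "lt x y \<or> x = y \<or> lt y x" for x y
      using *(3) by (auto simp: lt_def total_on_def)
    show "lt x z" if "lt x y" "lt y z" for x y z
      using that transD[OF *(1), of x y z] antisymD[OF *(2), of x y] by (auto simp: lt_def)
  qed
qed

lemma finite_linear_order_max:
  fixes lt :: "'a \<Rightarrow> 'a \<Rightarrow> bool"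
  assumes "\<And>x y z. lt x y \<Longrightarrow> lt y z \<Longrightarrow> lt x z" "\<And>x y. lt x y \<or> x = y \<or> lt y x"
    and "finite A" "A \<noteq> {}"
  shows "\<exists>m\<in>A. \<forall>x\<in>A. lt x m \<or> x = m"
  using assms(3,4)
proof (induction rule: finite_ne_induct)
  case (insert x A)
  then obtain m where "m \<in> A" "\<forall>x\<in>A. lt x m \<or> x = m" by blast
  thus ?case using assms(1,2) by (metis insert_iff)
qed auto

context group
begin

text \<open>For each \<open>i\<close> that is the leading index of some element, with respect to a well-order, pick one
  whose leading coefficient divides all the others.\<close>

lemma leading_term_basis:
  fixes e :: "'i \<Rightarrow> 'a \<Rightarrow> int"
  assumes R: "subgroup R G"
    and add: "\<And>i p q. p \<in> R \<Longrightarrow> q \<in> R \<Longrightarrow> e i (p \<otimes> q) = e i p + e i q"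
    and fin: "\<And>r. r \<in> R \<Longrightarrow> finite {i. e i r \<noteq> 0}"
  obtains Xs where "Xs \<subseteq> R" "R \<subseteq> generate G (Xs \<union> {r \<in> R. \<forall>i. e i r = 0})"
    "\<forall>A (n :: 'a \<Rightarrow> int). finite A \<and> A \<subseteq> Xs \<and> (\<forall>i. (\<Sum>x\<in>A. n x * e i x) = 0) \<longrightarrow> (\<forall>x\<in>A. n x = 0)"
proof -
  obtain lt :: "'i \<Rightarrow> 'i \<Rightarrow> bool" where wf: "wfP lt"
    and trans: "\<And>x y z. lt x y \<Longrightarrow> lt y z \<Longrightarrow> lt x z"
    and total: "\<And>x y. lt x y \<or> x = y \<or> lt y x"
    using ex_wf_linear_order by blast
  have irrefl: "\<not> lt i i" for i using wfp_imp_irreflp[OF wf] by (simp add: irreflp_def)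
  have max: "\<exists>m\<in>J. \<forall>x\<in>J. lt x m \<or> x = m" if "finite J" "J \<noteq> {}" for J
    by (rule finite_linear_order_max[OF _ _ that]) (use trans total in blast)+
  \<comment> \<open>\<open>V i\<close> holds the elements with no nonzero coordinate above
    \<open>i\<close>, and \<open>D\<close> the indices that occur as leading ones.\<close>
  define V where "V = (\<lambda>i. {r \<in> R. \<forall>j. lt i j \<longrightarrow> e j r = 0})"
  define D where "D = {i. \<exists>r\<in>V i. e i r \<noteq> 0}"
  have pow: "r [^] n \<in> R" "e i (r [^] n) = n * e i r" if "r \<in> R" for r i and n :: int
    using additive_int_pow(3)[where \<phi> = "e i", OF R add that] subgroup_int_pow_closed[OF R that] by auto
  have RG: "r \<in> carrier G" if "r \<in> R" for r using subgroup.mem_carrier[OF R that] .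
  have reduce: "x [^] (- n) \<otimes> r \<in> V i \<and> e i (x [^] (- n) \<otimes> r) = e i r - n * e i x"
    if "x \<in> V i" "r \<in> V i" for x r i and n :: int
    using that by (simp add: V_def add pow subgroup.m_closed[OF R])
  \<comment> \<open>A nonzero value of \<open>e i\<close> on \<open>V i\<close> of least absolute
    value divides all others: otherwise \<open>reduce\<close> would realise the remainder of a
    division as a smaller nonzero value.\<close>
  have "\<exists>x\<in>V i. e i x \<noteq> 0 \<and> (\<forall>r\<in>V i. e i x dvd e i r)" if "i \<in> D" for i
  proof -
    let ?P = "\<lambda>x. x \<in> V i \<and> e i x \<noteq> 0"
    have "\<exists>x. ?P x" using that by (auto simp: D_def)
    then obtain x where x: "?P x" and min: "\<And>y. ?P y \<Longrightarrow> nat \<bar>e i x\<bar> \<le> nat \<bar>e i y\<bar>"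
      using ex_has_least_nat[of ?P _ "\<lambda>x. nat \<bar>e i x\<bar>"] by blast
    have "e i x dvd e i r" if r: "r \<in> V i" for r
    proof (rule ccontr)
      assume "\<not> e i x dvd e i r"
      hence mod: "e i r mod e i x \<noteq> 0" by (simp add: dvd_eq_mod_eq_0)
      have "e i r - e i r div e i x * e i x = e i r mod e i x" by (simp add: minus_div_mult_eq_mod)
      hence "nat \<bar>e i x\<bar> \<le> nat \<bar>e i r mod e i x\<bar>"
        using min reduce[of x i r "e i r div e i x"] x r mod by metis
      moreover have "\<bar>e i r mod e i x\<bar> < \<bar>e i x\<bar>" using x abs_mod_less by blast
      ultimately show False by linarith
    qed
    with x show ?thesis by blast
  qed
  then obtain x where x: "\<And>i. i \<in> D \<Longrightarrow> x i \<in> V i" "\<And>i. i \<in> D \<Longrightarrow> e i (x i) \<noteq> 0"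
    "\<And>i r. i \<in> D \<Longrightarrow> r \<in> V i \<Longrightarrow> e i (x i) dvd e i r"
    using bchoice[of D "\<lambda>i x. x \<in> V i \<and> e i x \<noteq> 0 \<and> (\<forall>r\<in>V i. e i x dvd e i r)"] by blast
  let ?S = "{r \<in> R. \<forall>i. e i r = 0}"
  have xR: "x ` D \<subseteq> R" using x by (auto simp: V_def)
  let ?T = "generate G (x ` D \<union> ?S)"
  have T: "subgroup ?T G" by (intro generate_is_subgroup) (use xR RG in auto)
  have lead: "\<exists>i. r \<in> V i \<and> e i r \<noteq> 0" if r: "r \<in> R" "r \<notin> ?S" for r
  proof -
    have "{i. e i r \<noteq> 0} \<noteq> {}" using r by auto
    from max[OF fin[OF r(1)] this]
    obtain i where i: "e i r \<noteq> 0" "\<And>j. e j r \<noteq> 0 \<Longrightarrow> lt j i \<or> j = i" by auto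
    have "e j r = 0" if "lt i j" for j using i(2)[of j] that irrefl trans by metis
    thus ?thesis using i r by (auto simp: V_def)
  qed
  \<comment> \<open>A power of \<open>x i\<close> clears the coordinate at \<open>i\<close>. The
    leading index then drops, and \<open>lt\<close> is well-founded.\<close>
  have gen: "r \<in> ?T" if "r \<in> V i" for r i
    using that
  proof (induction i arbitrary: r rule: wfp_induct_rule[OF wf])
    case (1 i)
    have *: "q \<in> ?T" if q: "q \<in> V i" "e i q = 0" for q
    proof (cases "q \<in> ?S")
      case True
      thus ?thesis by (intro generate.incl) simp
    next
      case False
      with q lead[of q] obtain j where j: "q \<in> V j" "e j q \<noteq> 0" by (auto simp: V_def)
      hence "lt j i" using q total[of j i] by (auto simp: V_def)
      thus ?thesis using 1 j by blast
    qed
    show ?case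
    proof (cases "i \<in> D")
      case True
      then obtain n where n: "e i r = n * e i (x i)" using x 1 by (metis dvdE mult.commute)
      have "x i \<in> ?T" using True by (intro generate.incl) simp
      hence "x i [^] (- n) \<in> ?T" using subgroup_int_pow_closed[OF T] by blast
      moreover have "x i [^] (- n) \<otimes> r \<in> ?T"
        using reduce[of "x i" i r n] n True x 1 by (intro *) auto
      ultimately show ?thesis
        using subgroup_mult_cancel_left[OF T] RG 1 by (auto simp: V_def)
    next
      case False
      thus ?thesis using 1 * by (auto simp: D_def)
    qed
  qed
  show ?thesis
  proof
    show "x ` D \<subseteq> R" by (rule xR)
    show "R \<subseteq> ?T"
    proof
      fix r assume r: "r \<in> R"
      show "r \<in> ?T"
      proof (cases "r \<in> ?S")
        case True
        thus ?thesis by (intro generate.incl) simp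
      next
        case False
        thus ?thesis using lead[OF r] gen by blast
      qed
    qed
    show "\<forall>A (n :: 'a \<Rightarrow> int). finite A \<and> A \<subseteq> x ` D \<and> (\<forall>i. (\<Sum>x\<in>A. n x * e i x) = 0)
        \<longrightarrow> (\<forall>x\<in>A. n x = 0)"
    proof (intro allI impI ballI)
      fix A and n :: "'a \<Rightarrow> int" and y
      assume "finite A \<and> A \<subseteq> x ` D \<and> (\<forall>i. (\<Sum>x\<in>A. n x * e i x) = 0)" "y \<in> A"
      hence A: "finite A" "A \<subseteq> x ` D" "\<And>i. (\<Sum>x\<in>A. n x * e i x) = 0" "y \<in> A" by auto
      obtain J where J: "J \<subseteq> D" "finite J" "A = x ` J" using finite_subset_image[OF A(1,2)] by blast
      show "n y = 0"
      proof (rule ccontr)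
        assume "n y \<noteq> 0"
        hence "{j \<in> J. n (x j) \<noteq> 0} \<noteq> {}" using A(4) J by auto
        \<comment> \<open>At the largest index \<open>m\<close> with a nonzero multiplier all other
          summands vanish, because their leading indices lie below \<open>m\<close>; the summand of
          \<open>x m\<close> does not.\<close>
        from max[OF _ this] J
        obtain m where m: "m \<in> J" "n (x m) \<noteq> 0" "\<And>j. j \<in> J \<Longrightarrow> n (x j) \<noteq> 0 \<Longrightarrow> lt j m \<or> j = m"
          by auto
        have rest: "n z * e m z = 0" if "z \<in> A - {x m}" for z
        proof -
          obtain j where j: "j \<in> J" "z = x j" "j \<noteq> m" using \<open>z \<in> _\<close> J by auto
          show ?thesis
          proof (cases "n z = 0")
            case False
            hence "lt j m" using j m by blast
            thus ?thesis using x(1)[of j] j J by (auto simp: V_def)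
          qed simp
        qed
        have "(\<Sum>z\<in>A. n z * e m z) = n (x m) * e m (x m)"
          using J m A(1) by (subst sum.remove[of _ "x m"]) (simp_all only: sum.neutral[OF ballI[OF rest]], auto)
        thus False using A(3)[of m] m x(2)[of m] J by auto
      qed
    qed
  qed
qed

end

section \<open>Additive functionals on the integral group ring\<close>

context ring
begin

lemma additive_prod_mem: "a \<in> A \<Longrightarrow> b \<in> B \<Longrightarrow> a \<otimes> b \<in> additive_prod R A B"
  unfolding additive_prod_def by (rule generate.incl) (auto simp: set_mult_def)

lemma additive_prod_least:
  assumes "subgroup K (add_monoid R)" "\<And>a b. a \<in> A \<Longrightarrow> b \<in> B \<Longrightarrow> a \<otimes> b \<in> K"
  shows "additive_prod R A B \<subseteq> K"
  unfolding additive_prod_def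
  by (rule add.generate_subgroup_incl[OF _ assms(1)]) (use assms(2) in \<open>auto simp: set_mult_def\<close>)

lemma additive_prod_subgroup:
  assumes "A \<subseteq> carrier R" "B \<subseteq> carrier R"
  shows "subgroup (additive_prod R A B) (add_monoid R)"
proof -
  have "A <#>\<^bsub>R\<^esub> B \<subseteq> carrier R" using assms by (auto simp: set_mult_def)
  thus ?thesis
    unfolding additive_prod_def using add.generate_is_subgroup[of "A <#>\<^bsub>R\<^esub> B"] by simp
qed

lemma add_subgroup_mem_carrier: "subgroup K (add_monoid R) \<Longrightarrow> x \<in> K \<Longrightarrow> x \<in> carrier R"
  using subgroup.subset[of K "add_monoid R"] by auto

lemma add_subgroup_minus_closed:
  assumes K: "subgroup K (add_monoid R)" and "x \<in> K" "y \<in> K"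
  shows "x \<ominus> y \<in> K"
proof -
  have "\<ominus> y \<in> K"
    using subgroup.m_inv_closed[OF K assms(3)] by (simp add: a_inv_def)
  thus ?thesis using subgroup.m_closed[OF K assms(2)] by (simp add: a_minus_def)
qed

lemma left_mult_vimage_subgroup:
  assumes K: "subgroup K (add_monoid R)" and x: "x \<in> carrier R"
  shows "subgroup {y \<in> carrier R. x \<otimes> y \<in> K} (add_monoid R)"
proof (rule add.subgroupI)
  show "{y \<in> carrier R. x \<otimes> y \<in> K} \<noteq> {}"
    using x subgroup.one_closed[OF K] by (auto intro!: exI[of _ \<zero>])
  show "\<ominus> y \<in> {y \<in> carrier R. x \<otimes> y \<in> K}" if "y \<in> {y \<in> carrier R. x \<otimes> y \<in> K}" for y
    using that x subgroup.m_inv_closed[OF K, of "x \<otimes> y"] by (simp add: r_minus a_inv_def[symmetric])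
  show "y \<oplus> z \<in> {y \<in> carrier R. x \<otimes> y \<in> K}"
    if "y \<in> {y \<in> carrier R. x \<otimes> y \<in> K}" "z \<in> {y \<in> carrier R. x \<otimes> y \<in> K}" for y z
    using that x subgroup.m_closed[OF K, of "x \<otimes> y" "x \<otimes> z"] by (simp add: r_distr)
qed auto

text \<open>A multiplier from the left is absorbed by the first factor of
  \<open>additive_prod\<close>, so this property passes from \<open>A\<close> to the product
  whatever \<open>B\<close> is. It is the closure on which \<open>group_meet_subgroup\<close> and
  \<open>comm_in_group_meet\<close> rely.\<close>

definition left_ideal :: "'a set \<Rightarrow> bool" where
  "left_ideal J \<longleftrightarrow> subgroup J (add_monoid R) \<and> (\<forall>x\<in>carrier R. \<forall>j\<in>J. x \<otimes> j \<in> J)"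

lemma left_idealD:
  assumes "left_ideal J"
  shows "subgroup J (add_monoid R)" "\<And>x j. x \<in> carrier R \<Longrightarrow> j \<in> J \<Longrightarrow> x \<otimes> j \<in> J"
    "\<And>j. j \<in> J \<Longrightarrow> j \<in> carrier R"
    "\<And>j k. j \<in> J \<Longrightarrow> k \<in> J \<Longrightarrow> j \<oplus> k \<in> J" "\<And>j. j \<in> J \<Longrightarrow> \<ominus> j \<in> J" "\<zero> \<in> J"
    "\<And>j k. j \<in> J \<Longrightarrow> k \<in> J \<Longrightarrow> j \<ominus> k \<in> J"
proof -
  show J: "subgroup J (add_monoid R)" using assms by (simp add: left_ideal_def)
  show "x \<otimes> j \<in> J" if "x \<in> carrier R" "j \<in> J" for x j using assms that by (simp add: left_ideal_def)
  show "j \<in> carrier R" if "j \<in> J" for j using add_subgroup_mem_carrier[OF J that] .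
  show "j \<oplus> k \<in> J" if "j \<in> J" "k \<in> J" for j k using subgroup.m_closed[OF J that] by simp
  show "\<ominus> j \<in> J" if "j \<in> J" for j using subgroup.m_inv_closed[OF J that] by (simp add: a_inv_def)
  show "\<zero> \<in> J" using subgroup.one_closed[OF J] by simp
  show "j \<ominus> k \<in> J" if "j \<in> J" "k \<in> J" for j k using add_subgroup_minus_closed[OF J that] .
qed

lemma additive_prod_left_ideal:
  assumes A: "left_ideal A" and B: "B \<subseteq> carrier R"
  shows "left_ideal (additive_prod R A B)"
proof -
  have sub: "subgroup (additive_prod R A B) (add_monoid R)"
    by (rule additive_prod_subgroup) (use left_idealD(3)[OF A] B in auto)
  have "additive_prod R A B \<subseteq> {y \<in> carrier R. x \<otimes> y \<in> additive_prod R A B}" if x: "x \<in> carrier R" for x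
  proof (rule additive_prod_least[OF left_mult_vimage_subgroup[OF sub x]])
    fix a b assume ab: "a \<in> A" "b \<in> B"
    hence "a \<in> carrier R" "b \<in> carrier R" using left_idealD(3)[OF A] B by auto
    moreover have "(x \<otimes> a) \<otimes> b \<in> additive_prod R A B"
      using ab x left_idealD(2)[OF A] by (intro additive_prod_mem)
    ultimately show "a \<otimes> b \<in> {y \<in> carrier R. x \<otimes> y \<in> additive_prod R A B}"
      using x by (simp add: m_assoc)
  qed
  thus ?thesis using sub unfolding left_ideal_def by blast
qed

lemma set_add_iff: "x \<in> A <+>\<^bsub>R\<^esub> B \<longleftrightarrow> (\<exists>a\<in>A. \<exists>b\<in>B. x = a \<oplus> b)"
  by (auto simp: set_add_def set_mult_def)

lemma set_add_left_ideal:
  assumes A: "left_ideal A" and B: "left_ideal B"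
  shows "left_ideal (A <+>\<^bsub>R\<^esub> B)" "A \<subseteq> A <+>\<^bsub>R\<^esub> B" "B \<subseteq> A <+>\<^bsub>R\<^esub> B"
proof -
  note A' = left_idealD[OF A] and B' = left_idealD[OF B]
  show "A \<subseteq> A <+>\<^bsub>R\<^esub> B"
  proof
    fix a assume "a \<in> A"
    moreover have "a = a \<oplus> \<zero>" using \<open>a \<in> A\<close> A'(3) by simp
    ultimately show "a \<in> A <+>\<^bsub>R\<^esub> B" using B'(6) unfolding set_add_iff by blast
  qed
  show "B \<subseteq> A <+>\<^bsub>R\<^esub> B"
  proof
    fix b assume "b \<in> B"
    moreover have "b = \<zero> \<oplus> b" using \<open>b \<in> B\<close> B'(3) by simp
    ultimately show "b \<in> A <+>\<^bsub>R\<^esub> B" using A'(6) unfolding set_add_iff by blast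
  qed
  have "subgroup (A <+>\<^bsub>R\<^esub> B) (add_monoid R)"
  proof (rule add.subgroupI)
    show "A <+>\<^bsub>R\<^esub> B \<subseteq> carrier R" using A'(3) B'(3) by (auto simp: set_add_iff)
    show "A <+>\<^bsub>R\<^esub> B \<noteq> {}" using A'(6) B'(6) by (auto simp: set_add_def set_mult_def)
    fix x assume "x \<in> A <+>\<^bsub>R\<^esub> B"
    then obtain a b where x: "a \<in> A" "b \<in> B" "x = a \<oplus> b" by (auto simp: set_add_iff)
    hence "\<ominus> x = \<ominus> a \<oplus> \<ominus> b" using A'(3) B'(3) by (simp add: minus_add)
    thus "\<ominus> x \<in> A <+>\<^bsub>R\<^esub> B" using x A'(5) B'(5) unfolding set_add_iff by blast
    fix y assume "y \<in> A <+>\<^bsub>R\<^esub> B"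
    then obtain c d where y: "c \<in> A" "d \<in> B" "y = c \<oplus> d" by (auto simp: set_add_iff)
    have "x \<oplus> y = (a \<oplus> c) \<oplus> (b \<oplus> d)" using x y A'(3) B'(3) by (simp add: a_ac)
    thus "x \<oplus> y \<in> A <+>\<^bsub>R\<^esub> B" using x y A'(4) B'(4) unfolding set_add_iff by blast
  qed
  moreover have "x \<otimes> j \<in> A <+>\<^bsub>R\<^esub> B" if x: "x \<in> carrier R" and j: "j \<in> A <+>\<^bsub>R\<^esub> B" for x j
  proof -
    obtain a b where j: "a \<in> A" "b \<in> B" "j = a \<oplus> b" using j by (auto simp: set_add_iff)
    hence "x \<otimes> j = x \<otimes> a \<oplus> x \<otimes> b" using x A'(3) B'(3) by (simp add: r_distr)
    thus ?thesis using x j A'(2) B'(2) unfolding set_add_iff by blast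
  qed
  ultimately show "left_ideal (A <+>\<^bsub>R\<^esub> B)" unfolding left_ideal_def by blast
qed

end

section \<open>Linear extension of functions from a group to its group ring\<close>

definition lin :: "('a \<Rightarrow> int) \<Rightarrow> ('a \<Rightarrow> int) \<Rightarrow> int" where
  "lin \<kappa> f = (\<Sum>x\<in>supp f. f x * \<kappa> x)"

lemma lin_superset: "finite A \<Longrightarrow> supp f \<subseteq> A \<Longrightarrow> lin \<kappa> f = (\<Sum>x\<in>A. f x * \<kappa> x)"
  unfolding lin_def by (rule sum.mono_neutral_left) (auto simp: supp_def)

lemma lin_zero_fun [simp]: "lin (\<lambda>_. 0) f = 0"
  by (simp add: lin_def)

lemma augmentation_eq_lin: "augmentation f = lin (\<lambda>_. 1) f"
  by (simp add: augmentation_def lin_def)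

lemma lin_group_ring_of: "lin \<kappa> (group_ring_of g) = \<kappa> g"
  by (simp add: lin_def supp_group_ring_of group_ring_of_self)

lemma lin_add:
  assumes "finite (supp f)" "finite (supp g)"
  shows "lin \<kappa> (\<lambda>x. f x + g x) = lin \<kappa> f + lin \<kappa> g"
proof -
  let ?A = "supp f \<union> supp g"
  have "lin \<kappa> (\<lambda>x. f x + g x) = (\<Sum>x\<in>?A. (f x + g x) * \<kappa> x)"
    by (rule lin_superset) (use assms supp_add in simp_all)
  also have "\<dots> = (\<Sum>x\<in>?A. f x * \<kappa> x) + (\<Sum>x\<in>?A. g x * \<kappa> x)"
    by (simp add: distrib_right sum.distrib)
  also have "\<dots> = lin \<kappa> f + lin \<kappa> g"
    using assms by (simp add: lin_superset[of ?A f] lin_superset[of ?A g])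
  finally show ?thesis .
qed

lemma lin_uminus: "lin \<kappa> (\<lambda>x. - f x) = - lin \<kappa> f"
  by (simp add: lin_def supp_def sum_negf)

lemma aug_ideal_restrict_iff:
  "f \<in> aug_ideal (G\<lparr>carrier := H\<rparr>) \<longleftrightarrow> finite (supp f) \<and> supp f \<subseteq> H \<and> lin (\<lambda>_. 1) f = 0"
  by (simp add: aug_ideal_def group_ring_carrier_iff augmentation_eq_lin)

lemma aug_ideal_iff: "f \<in> aug_ideal G \<longleftrightarrow> f \<in> carrier (group_ring G) \<and> lin (\<lambda>_. 1) f = 0"
  by (simp add: aug_ideal_def augmentation_eq_lin)

lemma supp_group_ring_of_diff: "supp (\<lambda>x. group_ring_of g x - group_ring_of h x) \<subseteq> {g, h}"
  by (auto simp: supp_def group_ring_of_def split: if_splits)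

context group
begin

abbreviation ZG where "ZG \<equiv> group_ring G"
abbreviation of_grp :: "'a \<Rightarrow> 'a \<Rightarrow> int" where "of_grp \<equiv> group_ring_of"

interpretation ZG: ring ZG
  by (rule group_ring_ring) (rule group_axioms)

lemma group_ring_uminus: "f \<in> carrier ZG \<Longrightarrow> \<ominus>\<^bsub>ZG\<^esub> f = (\<lambda>x. - f x)"
proof (rule ZG.minus_equality)
  assume "f \<in> carrier ZG"
  moreover have "supp (\<lambda>x. - f x) = supp f" by (simp add: supp_def)
  ultimately show "(\<lambda>x. - f x) \<in> carrier ZG" by (simp add: group_ring_carrier_iff)
qed (auto simp: group_ring_add group_ring_zero)

lemma group_ring_minus:
  "f \<in> carrier ZG \<Longrightarrow> g \<in> carrier ZG \<Longrightarrow> f \<ominus>\<^bsub>ZG\<^esub> g = (\<lambda>x. f x - g x)"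
  by (simp add: a_minus_def group_ring_uminus group_ring_add)

lemma of_grp_closed [simp]: "g \<in> carrier G \<Longrightarrow> of_grp g \<in> carrier ZG"
  by (simp add: group_ring_carrier_iff supp_group_ring_of)

lemma of_grp_mult: "of_grp (g \<otimes> h) = of_grp g \<otimes>\<^bsub>ZG\<^esub> of_grp h"
proof
  fix x
  have "(of_grp g \<otimes>\<^bsub>ZG\<^esub> of_grp h) x = (if g \<otimes> h = x then 1 else 0)"
    by (simp add: group_ring_mult supp_group_ring_of group_ring_of_self)
  thus "of_grp (g \<otimes> h) x = (of_grp g \<otimes>\<^bsub>ZG\<^esub> of_grp h) x" by (auto simp: group_ring_of_def)
qed

lemma of_grp_one: "of_grp \<one> = \<one>\<^bsub>ZG\<^esub>"
  by (simp add: group_ring_one)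

lemma lin_minus:
  assumes "f \<in> carrier ZG" "g \<in> carrier ZG"
  shows "lin \<kappa> (f \<ominus>\<^bsub>ZG\<^esub> g) = lin \<kappa> f - lin \<kappa> g"
proof -
  have "finite (supp (\<lambda>x. - g x))" using assms by (simp add: group_ring_carrier_iff supp_def)
  hence "lin \<kappa> (\<lambda>x. f x + - g x) = lin \<kappa> f + lin \<kappa> (\<lambda>x. - g x)"
    using assms by (intro lin_add) (auto simp: group_ring_carrier_iff)
  thus ?thesis using assms by (simp add: group_ring_minus lin_uminus)
qed

text \<open>Four summands are provided because the cubic Magnus coefficient of a product has four
  terms; shorter formulas are padded with zero functions.\<close>

lemma lin_mult:
  assumes f: "f \<in> carrier ZG" and g: "g \<in> carrier ZG"
    and \<kappa>: "\<And>y z. y \<in> carrier G \<Longrightarrow> z \<in> carrier G \<Longrightarrow>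
      \<kappa> (y \<otimes> z) = a1 y * b1 z + a2 y * b2 z + a3 y * b3 z + a4 y * b4 z"
  shows "lin \<kappa> (f \<otimes>\<^bsub>ZG\<^esub> g) =
    lin a1 f * lin b1 g + lin a2 f * lin b2 g + lin a3 f * lin b3 g + lin a4 f * lin b4 g"
proof -
  let ?P = "(\<lambda>(y, z). y \<otimes> z) ` (supp f \<times> supp g)"
  have fin: "finite (supp f)" "finite (supp g)" and sub: "supp f \<subseteq> carrier G" "supp g \<subseteq> carrier G"
    using f g by (auto simp: group_ring_carrier_iff)
  have finP: "finite ?P" using fin by auto
  have *: "(\<Sum>x\<in>?P. if y \<otimes> z = x then f y * g z * \<kappa> x else 0) = f y * g z * \<kappa> (y \<otimes> z)"
    if "y \<in> supp f" "z \<in> supp g" for y z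
    using that finP by (subst sum.delta') auto
  have "lin \<kappa> (f \<otimes>\<^bsub>ZG\<^esub> g) = (\<Sum>x\<in>?P. (f \<otimes>\<^bsub>ZG\<^esub> g) x * \<kappa> x)"
    by (rule lin_superset[OF finP supp_group_ring_mult])
  also have "\<dots> = (\<Sum>x\<in>?P. \<Sum>y\<in>supp f. \<Sum>z\<in>supp g. if y \<otimes> z = x then f y * g z * \<kappa> x else 0)"
    by (intro sum.cong refl)
       (simp add: group_ring_mult sum_distrib_right if_distrib[of "\<lambda>t. t * _"] cong: if_cong)
  also have "\<dots> = (\<Sum>y\<in>supp f. \<Sum>z\<in>supp g. \<Sum>x\<in>?P. if y \<otimes> z = x then f y * g z * \<kappa> x else 0)"
    by (subst sum.swap, rule sum.cong[OF refl], rule sum.swap)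
  also have "\<dots> = (\<Sum>y\<in>supp f. \<Sum>z\<in>supp g. f y * g z * \<kappa> (y \<otimes> z))"
    by (intro sum.cong refl *)
  also have "\<dots> = (\<Sum>y\<in>supp f. \<Sum>z\<in>supp g. (f y * a1 y) * (g z * b1 z) + (f y * a2 y) * (g z * b2 z)
      + (f y * a3 y) * (g z * b3 z) + (f y * a4 y) * (g z * b4 z))"
    using sub by (intro sum.cong refl) (auto simp: \<kappa> subset_iff algebra_simps)
  also have "\<dots> = lin a1 f * lin b1 g + lin a2 f * lin b2 g + lin a3 f * lin b3 g + lin a4 f * lin b4 g"
    by (simp add: lin_def sum.distrib flip: sum_product)
  finally show ?thesis .
qed

lemma lin_vanishing_subgroup:
  "subgroup {f \<in> carrier ZG. \<forall>\<kappa>\<in>\<Phi>. lin \<kappa> f = 0} (add_monoid ZG)"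
proof (rule ZG.add.subgroupI)
  have "lin \<kappa> \<zero>\<^bsub>ZG\<^esub> = 0" for \<kappa> by (simp add: lin_def group_ring_zero)
  thus "{f \<in> carrier ZG. \<forall>\<kappa>\<in>\<Phi>. lin \<kappa> f = 0} \<noteq> {}"
    by (auto intro!: exI[of _ "\<zero>\<^bsub>ZG\<^esub>"])
  show "\<ominus>\<^bsub>ZG\<^esub> f \<in> {f \<in> carrier ZG. \<forall>\<kappa>\<in>\<Phi>. lin \<kappa> f = 0}"
    if "f \<in> {f \<in> carrier ZG. \<forall>\<kappa>\<in>\<Phi>. lin \<kappa> f = 0}" for f
  proof -
    have "\<ominus>\<^bsub>ZG\<^esub> f \<in> carrier ZG" using that by simp
    thus ?thesis using that by (simp add: group_ring_uminus lin_uminus)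
  qed
  show "f \<oplus>\<^bsub>ZG\<^esub> g \<in> {f \<in> carrier ZG. \<forall>\<kappa>\<in>\<Phi>. lin \<kappa> f = 0}"
    if "f \<in> {f \<in> carrier ZG. \<forall>\<kappa>\<in>\<Phi>. lin \<kappa> f = 0}" "g \<in> {f \<in> carrier ZG. \<forall>\<kappa>\<in>\<Phi>. lin \<kappa> f = 0}" for f g
  proof -
    have "f \<oplus>\<^bsub>ZG\<^esub> g \<in> carrier ZG" using that by simp
    thus ?thesis using that by (simp add: group_ring_add lin_add group_ring_carrier_iff)
  qed
qed auto

text \<open>Left multiplication suffices, because g h - 1 = g (h - 1) + (g - 1) and g^-1 - 1 = -
  g^-1 (g - 1).\<close>

lemma group_meet_subgroup:
  assumes J: "ZG.left_ideal J"
  shows "subgroup (group_meet G J) G"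
proof (rule subgroupI)
  note J' = ZG.left_idealD[OF J]
  show "group_meet G J \<subseteq> carrier G" by (auto simp: group_meet_def)
  have "of_grp \<one> \<ominus>\<^bsub>ZG\<^esub> \<one>\<^bsub>ZG\<^esub> = \<zero>\<^bsub>ZG\<^esub>"
    by (simp add: of_grp_one ZG.minus_eq ZG.r_neg)
  hence "\<one> \<in> group_meet G J"
    using J'(6) by (simp only: group_meet_def mem_Collect_eq one_closed simp_thms)
  thus "group_meet G J \<noteq> {}" by auto
  fix g assume "g \<in> group_meet G J"
  hence g: "g \<in> carrier G" "of_grp g \<ominus>\<^bsub>ZG\<^esub> \<one>\<^bsub>ZG\<^esub> \<in> J" by (auto simp: group_meet_def)
  have c: "of_grp g \<in> carrier ZG" "of_grp (inv g) \<in> carrier ZG" using g by auto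
  have "of_grp (inv g) \<otimes>\<^bsub>ZG\<^esub> of_grp g = \<one>\<^bsub>ZG\<^esub>"
    using g by (simp add: of_grp_one flip: of_grp_mult)
  hence "of_grp (inv g) \<ominus>\<^bsub>ZG\<^esub> \<one>\<^bsub>ZG\<^esub> =
      \<ominus>\<^bsub>ZG\<^esub> (of_grp (inv g) \<otimes>\<^bsub>ZG\<^esub> (of_grp g \<ominus>\<^bsub>ZG\<^esub> \<one>\<^bsub>ZG\<^esub>))"
    using c by (simp add: ZG.minus_eq ZG.r_distr ZG.r_minus ZG.minus_add ZG.a_comm)
  thus "inv g \<in> group_meet G J"
    using g c J'(2,5) by (simp add: group_meet_def)
  fix h assume "h \<in> group_meet G J"
  hence h: "h \<in> carrier G" "of_grp h \<ominus>\<^bsub>ZG\<^esub> \<one>\<^bsub>ZG\<^esub> \<in> J" by (auto simp: group_meet_def)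
  have d: "of_grp h \<in> carrier ZG" using h by simp
  have "of_grp (g \<otimes> h) \<ominus>\<^bsub>ZG\<^esub> \<one>\<^bsub>ZG\<^esub> =
      of_grp g \<otimes>\<^bsub>ZG\<^esub> (of_grp h \<ominus>\<^bsub>ZG\<^esub> \<one>\<^bsub>ZG\<^esub>) \<oplus>\<^bsub>ZG\<^esub> (of_grp g \<ominus>\<^bsub>ZG\<^esub> \<one>\<^bsub>ZG\<^esub>)"
    using c d by (simp add: of_grp_mult ZG.minus_eq ZG.r_distr ZG.r_minus ZG.a_assoc ZG.r_neg1)
  thus "g \<otimes> h \<in> group_meet G J"
    using g h c J'(2,4) by (simp add: group_meet_def)
qed

text \<open>In a left ideal a unit may be factored out only in front. Taking
  \<open>a \<otimes> b\<close> out of \<open>comm a b\<close> leaves the inverses behind, hence the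
  inverses in the hypotheses.\<close>

lemma comm_in_group_meet:
  assumes J: "ZG.left_ideal J" and ab: "a \<in> carrier G" "b \<in> carrier G"
    and 1: "(of_grp (inv a) \<ominus>\<^bsub>ZG\<^esub> \<one>\<^bsub>ZG\<^esub>) \<otimes>\<^bsub>ZG\<^esub> (of_grp (inv b) \<ominus>\<^bsub>ZG\<^esub> \<one>\<^bsub>ZG\<^esub>) \<in> J"
    and 2: "(of_grp (inv b) \<ominus>\<^bsub>ZG\<^esub> \<one>\<^bsub>ZG\<^esub>) \<otimes>\<^bsub>ZG\<^esub> (of_grp (inv a) \<ominus>\<^bsub>ZG\<^esub> \<one>\<^bsub>ZG\<^esub>) \<in> J"
  shows "comm a b \<in> group_meet G J"
proof -
  note J' = ZG.left_idealD[OF J]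
  define x where "x = of_grp (inv a)"
  define y where "y = of_grp (inv b)"
  define u where "u = of_grp (a \<otimes> b)"
  have c: "x \<in> carrier ZG" "y \<in> carrier ZG" "u \<in> carrier ZG" using ab by (auto simp: x_def y_def u_def)
  have uxy: "u \<otimes>\<^bsub>ZG\<^esub> (x \<otimes>\<^bsub>ZG\<^esub> y) = of_grp (comm a b)"
    using ab by (simp add: comm_def x_def y_def u_def m_assoc flip: of_grp_mult)
  have "u \<otimes>\<^bsub>ZG\<^esub> (y \<otimes>\<^bsub>ZG\<^esub> x) = of_grp (a \<otimes> b \<otimes> (inv b \<otimes> inv a))"
    by (simp add: x_def y_def u_def of_grp_mult)
  also have "a \<otimes> b \<otimes> (inv b \<otimes> inv a) = \<one>" using ab by (simp add: m_assoc)
  finally have uyx: "u \<otimes>\<^bsub>ZG\<^esub> (y \<otimes>\<^bsub>ZG\<^esub> x) = \<one>\<^bsub>ZG\<^esub>" by (simp add: of_grp_one)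
  \<comment> \<open>The remainder 1 - x - y common to both expansions, which cancels in their
    difference.\<close>
  define t where "t = \<one>\<^bsub>ZG\<^esub> \<oplus>\<^bsub>ZG\<^esub> (\<ominus>\<^bsub>ZG\<^esub> x \<oplus>\<^bsub>ZG\<^esub> \<ominus>\<^bsub>ZG\<^esub> y)"
  have t: "t \<in> carrier ZG" using c by (simp add: t_def)
  have xy: "(x \<ominus>\<^bsub>ZG\<^esub> \<one>\<^bsub>ZG\<^esub>) \<otimes>\<^bsub>ZG\<^esub> (y \<ominus>\<^bsub>ZG\<^esub> \<one>\<^bsub>ZG\<^esub>) = x \<otimes>\<^bsub>ZG\<^esub> y \<oplus>\<^bsub>ZG\<^esub> t"
    and yx: "(y \<ominus>\<^bsub>ZG\<^esub> \<one>\<^bsub>ZG\<^esub>) \<otimes>\<^bsub>ZG\<^esub> (x \<ominus>\<^bsub>ZG\<^esub> \<one>\<^bsub>ZG\<^esub>) = y \<otimes>\<^bsub>ZG\<^esub> x \<oplus>\<^bsub>ZG\<^esub> t"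
    using c by (simp_all add: t_def ZG.minus_eq ZG.l_distr ZG.r_distr ZG.l_minus ZG.r_minus ZG.minus_add ZG.minus_minus ZG.a_ac)
  have "(x \<ominus>\<^bsub>ZG\<^esub> \<one>\<^bsub>ZG\<^esub>) \<otimes>\<^bsub>ZG\<^esub> (y \<ominus>\<^bsub>ZG\<^esub> \<one>\<^bsub>ZG\<^esub>) \<ominus>\<^bsub>ZG\<^esub>
      (y \<ominus>\<^bsub>ZG\<^esub> \<one>\<^bsub>ZG\<^esub>) \<otimes>\<^bsub>ZG\<^esub> (x \<ominus>\<^bsub>ZG\<^esub> \<one>\<^bsub>ZG\<^esub>) =
      x \<otimes>\<^bsub>ZG\<^esub> y \<ominus>\<^bsub>ZG\<^esub> y \<otimes>\<^bsub>ZG\<^esub> x"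
    unfolding xy yx using c t by algebra
  moreover have "(x \<ominus>\<^bsub>ZG\<^esub> \<one>\<^bsub>ZG\<^esub>) \<otimes>\<^bsub>ZG\<^esub> (y \<ominus>\<^bsub>ZG\<^esub> \<one>\<^bsub>ZG\<^esub>) \<ominus>\<^bsub>ZG\<^esub>
      (y \<ominus>\<^bsub>ZG\<^esub> \<one>\<^bsub>ZG\<^esub>) \<otimes>\<^bsub>ZG\<^esub> (x \<ominus>\<^bsub>ZG\<^esub> \<one>\<^bsub>ZG\<^esub>) \<in> J"
    using 1 2 J'(7) by (simp add: x_def y_def)
  ultimately have "u \<otimes>\<^bsub>ZG\<^esub> (x \<otimes>\<^bsub>ZG\<^esub> y \<ominus>\<^bsub>ZG\<^esub> y \<otimes>\<^bsub>ZG\<^esub> x) \<in> J"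
    using J'(2)[OF c(3)] by simp
  moreover have "u \<otimes>\<^bsub>ZG\<^esub> (x \<otimes>\<^bsub>ZG\<^esub> y \<ominus>\<^bsub>ZG\<^esub> y \<otimes>\<^bsub>ZG\<^esub> x) = of_grp (comm a b) \<ominus>\<^bsub>ZG\<^esub> \<one>\<^bsub>ZG\<^esub>"
    using c by (simp add: ZG.minus_eq ZG.r_distr ZG.r_minus uyx) (simp only: uxy)
  ultimately show ?thesis using ab by (simp add: group_meet_def)
qed

lemma aug_ideal_subset: "aug_ideal G \<subseteq> carrier ZG"
  by (auto simp: aug_ideal_iff)

lemma lin_one_mult:
  "f \<in> carrier ZG \<Longrightarrow> g \<in> carrier ZG \<Longrightarrow> lin (\<lambda>_. 1) (f \<otimes>\<^bsub>ZG\<^esub> g) = lin (\<lambda>_. 1) f * lin (\<lambda>_. 1) g"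
  using lin_mult[of f g "\<lambda>_. 1" "\<lambda>_. 1" "\<lambda>_. 1" "\<lambda>_. 0" "\<lambda>_. 0" "\<lambda>_. 0" "\<lambda>_. 0" "\<lambda>_. 0" "\<lambda>_. 0"] by simp

lemma aug_ideal_left_ideal: "ZG.left_ideal (aug_ideal G)"
proof -
  have "aug_ideal G = {f \<in> carrier ZG. \<forall>\<kappa>\<in>{\<lambda>_. 1}. lin \<kappa> f = 0}" by (auto simp: aug_ideal_iff)
  moreover have "x \<otimes>\<^bsub>ZG\<^esub> j \<in> aug_ideal G" if "x \<in> carrier ZG" "j \<in> aug_ideal G" for x j
    using that by (simp add: aug_ideal_iff lin_one_mult)
  ultimately show ?thesis
    using lin_vanishing_subgroup[of "{\<lambda>_. 1}"] unfolding ZG.left_ideal_def by simp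
qed

lemma aug_power_left_ideal: "ZG.left_ideal (aug_power G n)"
proof (induction n)
  case 0
  show ?case using ZG.add.subgroup_self unfolding ZG.left_ideal_def by simp
next
  case (Suc n)
  show ?case unfolding aug_power.simps by (rule ZG.additive_prod_left_ideal[OF Suc aug_ideal_subset])
qed

lemma aug_power_closed: "x \<in> aug_power G n \<Longrightarrow> x \<in> carrier ZG"
  by (rule ZG.left_idealD(3)[OF aug_power_left_ideal])

text \<open>\<open>aug_power\<close> gains its factors on the right; associativity carries
  \<open>x\<close> past them from the left. At power 0 the product with \<open>x\<close> has
  augmentation 0, and a factor 1 is put in front of it.\<close>

lemma aug_ideal_mult_aug_power:
  assumes x: "x \<in> aug_ideal G" and "y \<in> aug_power G n"
  shows "x \<otimes>\<^bsub>ZG\<^esub> y \<in> aug_power G (Suc n)"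
proof -
  have xc: "x \<in> carrier ZG" using x aug_ideal_subset by auto
  have "aug_power G n \<subseteq> {y \<in> carrier ZG. x \<otimes>\<^bsub>ZG\<^esub> y \<in> aug_power G (Suc n)}"
  proof (induction n)
    case 0
    have "\<one>\<^bsub>ZG\<^esub> \<otimes>\<^bsub>ZG\<^esub> (x \<otimes>\<^bsub>ZG\<^esub> y) \<in> aug_power G (Suc 0)" if "y \<in> carrier ZG" for y
      unfolding aug_power.simps using x that
      by (intro ZG.additive_prod_mem) (auto simp: aug_ideal_iff lin_one_mult)
    thus ?case using xc by auto
  next
    case (Suc n)
    have "additive_prod ZG (aug_power G n) (aug_ideal G) \<subseteq>
        {y \<in> carrier ZG. x \<otimes>\<^bsub>ZG\<^esub> y \<in> aug_power G (Suc (Suc n))}"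
    proof (rule ZG.additive_prod_least[OF ZG.left_mult_vimage_subgroup[OF _ xc]])
      show "subgroup (aug_power G (Suc (Suc n))) (add_monoid ZG)"
        by (rule ZG.left_idealD(1)[OF aug_power_left_ideal])
      fix a b assume ab: "a \<in> aug_power G n" "b \<in> aug_ideal G"
      hence c: "a \<in> carrier ZG" "b \<in> carrier ZG" using aug_power_closed aug_ideal_subset by auto
      have "(x \<otimes>\<^bsub>ZG\<^esub> a) \<otimes>\<^bsub>ZG\<^esub> b \<in> aug_power G (Suc (Suc n))"
        unfolding aug_power.simps(2)[of G "Suc n"] using Suc ab by (intro ZG.additive_prod_mem) auto
      thus "a \<otimes>\<^bsub>ZG\<^esub> b \<in> {y \<in> carrier ZG. x \<otimes>\<^bsub>ZG\<^esub> y \<in> aug_power G (Suc (Suc n))}"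
        using c xc by (simp only: ZG.m_assoc mem_Collect_eq ZG.m_closed simp_thms)
    qed
    thus ?case by simp
  qed
  thus ?thesis using assms(2) by auto
qed

lemma of_grp_minus_one_aug_ideal:
  assumes "H \<subseteq> carrier G" "g \<in> H" "\<one> \<in> H"
  shows "of_grp g \<ominus>\<^bsub>ZG\<^esub> \<one>\<^bsub>ZG\<^esub> \<in> aug_ideal (G\<lparr>carrier := H\<rparr>)"
proof -
  have g: "g \<in> carrier G" using assms by auto
  have eq: "of_grp g \<ominus>\<^bsub>ZG\<^esub> \<one>\<^bsub>ZG\<^esub> = (\<lambda>x. of_grp g x - of_grp \<one> x)"
    using g by (simp add: group_ring_minus flip: of_grp_one)
  have "lin (\<lambda>_. 1) (of_grp g \<ominus>\<^bsub>ZG\<^esub> of_grp \<one>) = 0"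
    using g by (simp add: lin_minus lin_group_ring_of)
  moreover have "supp (of_grp g \<ominus>\<^bsub>ZG\<^esub> \<one>\<^bsub>ZG\<^esub>) \<subseteq> {g, \<one>}"
    unfolding eq by (rule supp_group_ring_of_diff)
  ultimately show ?thesis
    using assms(2,3) finite_subset[of _ "{g, \<one>}"] by (auto simp: aug_ideal_restrict_iff of_grp_one)
qed

lemma lower_central_in_group_meet: "\<gamma> (Suc n) \<subseteq> group_meet G (aug_power G (Suc n))"
proof (induction n)
  case 0
  have "\<one>\<^bsub>ZG\<^esub> \<otimes>\<^bsub>ZG\<^esub> (of_grp g \<ominus>\<^bsub>ZG\<^esub> \<one>\<^bsub>ZG\<^esub>) \<in> aug_power G (Suc 0)" if "g \<in> carrier G" for g
    unfolding aug_power.simps using that of_grp_minus_one_aug_ideal[of "carrier G"]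
    by (intro ZG.additive_prod_mem) auto
  thus ?case by (auto simp: group_meet_def)
next
  case (Suc n)
  have "comm_subgroup G (\<gamma> (Suc n)) (carrier G) \<subseteq> group_meet G (aug_power G (Suc (Suc n)))"
  proof (rule comm_subgroup_least[OF group_meet_subgroup[OF aug_power_left_ideal]])
    fix a b assume a: "a \<in> \<gamma> (Suc n)" and b: "b \<in> carrier G"
    have ac: "a \<in> carrier G" using a by (rule \<gamma>_closed)
    have "inv a \<in> \<gamma> (Suc n)" using a by (rule subgroup.m_inv_closed[OF \<gamma>_subgroup])
    hence 1: "of_grp (inv a) \<ominus>\<^bsub>ZG\<^esub> \<one>\<^bsub>ZG\<^esub> \<in> aug_power G (Suc n)"
      using Suc by (auto simp: group_meet_def)
    have 2: "of_grp (inv b) \<ominus>\<^bsub>ZG\<^esub> \<one>\<^bsub>ZG\<^esub> \<in> aug_ideal G"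
      using of_grp_minus_one_aug_ideal[of "carrier G" "inv b"] b by simp
    show "comm a b \<in> group_meet G (aug_power G (Suc (Suc n)))"
    proof (rule comm_in_group_meet[OF aug_power_left_ideal ac b])
      show "(of_grp (inv a) \<ominus>\<^bsub>ZG\<^esub> \<one>\<^bsub>ZG\<^esub>) \<otimes>\<^bsub>ZG\<^esub> (of_grp (inv b) \<ominus>\<^bsub>ZG\<^esub> \<one>\<^bsub>ZG\<^esub>)
          \<in> aug_power G (Suc (Suc n))"
        unfolding aug_power.simps(2)[of G "Suc n"] using 1 2 by (rule ZG.additive_prod_mem)
      show "(of_grp (inv b) \<ominus>\<^bsub>ZG\<^esub> \<one>\<^bsub>ZG\<^esub>) \<otimes>\<^bsub>ZG\<^esub> (of_grp (inv a) \<ominus>\<^bsub>ZG\<^esub> \<one>\<^bsub>ZG\<^esub>)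
          \<in> aug_power G (Suc (Suc n))"
        using 2 1 by (rule aug_ideal_mult_aug_power)
    qed
  qed
  thus ?case by simp
qed

text \<open>For c in \<open>T\<close> and s in \<open>S\<close>, the products demanded by
  \<open>comm_in_group_meet\<close> fall into the two mixed summands: (c^-1 - 1)(s^-1 - 1) into the
  second, because \<open>T\<close> lies in \<open>\<gamma> 2\<close> and so c^-1 - 1 in the square
  of the augmentation ideal, and the reversed product into the third.\<close>

lemma lower_central_product_in_group_meet:
  assumes S: "subgroup S G"
  defines "T \<equiv> comm_subgroup G (carrier G) S"
  shows "\<gamma> 4 <#> comm_subgroup G T S \<subseteq> group_meet G
    (aug_power G 4 <+>\<^bsub>ZG\<^esub> additive_prod ZG (aug_power G 2) (aug_ideal (G\<lparr>carrier := S\<rparr>))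
      <+>\<^bsub>ZG\<^esub> additive_prod ZG (aug_ideal G) (aug_ideal (G\<lparr>carrier := T\<rparr>)))"
proof -
  have SG: "S \<subseteq> carrier G" using S by (rule subgroup.subset)
  have T: "subgroup T G" unfolding T_def using SG by (intro comm_subgroup_is_subgroup) auto
  have TG: "T \<subseteq> carrier G" using T by (rule subgroup.subset)
  have T2: "T \<subseteq> \<gamma> 2"
    unfolding T_def using SG by (intro comm_subgroup_least[OF \<gamma>_subgroup] \<gamma>_comm) auto
  let ?J2 = "additive_prod ZG (aug_power G 2) (aug_ideal (G\<lparr>carrier := S\<rparr>))"
  let ?J3 = "additive_prod ZG (aug_ideal G) (aug_ideal (G\<lparr>carrier := T\<rparr>))"
  let ?J = "aug_power G 4 <+>\<^bsub>ZG\<^esub> ?J2 <+>\<^bsub>ZG\<^esub> ?J3"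
  have J2: "ZG.left_ideal ?J2"
    by (intro ZG.additive_prod_left_ideal aug_power_left_ideal aug_ideal_subgroup_subset SG)
  have J3: "ZG.left_ideal ?J3"
    by (intro ZG.additive_prod_left_ideal aug_ideal_left_ideal aug_ideal_subgroup_subset TG)
  note J12 = ZG.set_add_left_ideal[OF aug_power_left_ideal[of 4] J2]
  note J = ZG.set_add_left_ideal[OF J12(1) J3]
  have "\<gamma> 4 \<subseteq> group_meet G (aug_power G 4)"
    using lower_central_in_group_meet[of 3] by (simp add: eval_nat_numeral)
  hence 4: "\<gamma> 4 \<subseteq> group_meet G ?J"
    using J12(2) J(2) unfolding group_meet_def by blast
  have "\<gamma> 2 \<subseteq> group_meet G (aug_power G 2)"
    using lower_central_in_group_meet[of 1] by (simp add: eval_nat_numeral)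
  hence T2': "T \<subseteq> group_meet G (aug_power G 2)" using T2 by auto
  have "comm_subgroup G T S \<subseteq> group_meet G ?J"
  proof (rule comm_subgroup_least[OF group_meet_subgroup[OF J(1)]])
    fix c s assume c: "c \<in> T" and s: "s \<in> S"
    have c': "inv c \<in> T" and s': "inv s \<in> S"
      using subgroup.m_inv_closed[OF T c] subgroup.m_inv_closed[OF S s] by auto
    show "comm c s \<in> group_meet G ?J"
    proof (rule comm_in_group_meet[OF J(1)])
      show "(of_grp (inv c) \<ominus>\<^bsub>ZG\<^esub> \<one>\<^bsub>ZG\<^esub>) \<otimes>\<^bsub>ZG\<^esub> (of_grp (inv s) \<ominus>\<^bsub>ZG\<^esub> \<one>\<^bsub>ZG\<^esub>) \<in> ?J"
      proof (rule subsetD[OF J(2)], rule subsetD[OF J12(3)], rule ZG.additive_prod_mem)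
        show "of_grp (inv c) \<ominus>\<^bsub>ZG\<^esub> \<one>\<^bsub>ZG\<^esub> \<in> aug_power G 2"
          using T2' c' by (auto simp: group_meet_def)
        show "of_grp (inv s) \<ominus>\<^bsub>ZG\<^esub> \<one>\<^bsub>ZG\<^esub> \<in> aug_ideal (G\<lparr>carrier := S\<rparr>)"
          using SG s' subgroup.one_closed[OF S] by (rule of_grp_minus_one_aug_ideal)
      qed
      show "(of_grp (inv s) \<ominus>\<^bsub>ZG\<^esub> \<one>\<^bsub>ZG\<^esub>) \<otimes>\<^bsub>ZG\<^esub> (of_grp (inv c) \<ominus>\<^bsub>ZG\<^esub> \<one>\<^bsub>ZG\<^esub>) \<in> ?J"
      proof (rule subsetD[OF J(3)], rule ZG.additive_prod_mem)
        show "of_grp (inv c) \<ominus>\<^bsub>ZG\<^esub> \<one>\<^bsub>ZG\<^esub> \<in> aug_ideal (G\<lparr>carrier := T\<rparr>)"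
          using TG c' subgroup.one_closed[OF T] by (rule of_grp_minus_one_aug_ideal)
        show "of_grp (inv s) \<ominus>\<^bsub>ZG\<^esub> \<one>\<^bsub>ZG\<^esub> \<in> aug_ideal G"
          using of_grp_minus_one_aug_ideal[of "carrier G" "inv s"] SG s' by auto
      qed
    qed (use c s TG SG in auto)
  qed
  thus ?thesis
    using 4 subgroup.m_closed[OF group_meet_subgroup[OF J(1)]] by (auto simp: set_mult_def)
qed

end

section \<open>Magnus coefficients as functionals on the group ring\<close>

context magnus_coefficients
begin

interpretation ZG: ring ZG
  by (rule group_ring_ring) (rule group_axioms)

abbreviation "\<epsilon> f \<equiv> lin (\<lambda>_. 1) f"
abbreviation "C1 p f \<equiv> lin (\<lambda>g. c1 g p) f"
abbreviation "C2 p q f \<equiv> lin (\<lambda>g. c2 g p q) f"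
abbreviation "C3 p q r f \<equiv> lin (\<lambda>g. c3 g p q r) f"

lemma C_mult:
  assumes "f \<in> carrier ZG" "g \<in> carrier ZG"
  shows "C1 p (f \<otimes>\<^bsub>ZG\<^esub> g) = C1 p f * \<epsilon> g + \<epsilon> f * C1 p g"
    and "C2 p q (f \<otimes>\<^bsub>ZG\<^esub> g) = C2 p q f * \<epsilon> g + C1 p f * C1 q g + \<epsilon> f * C2 p q g"
    and "C3 p q r (f \<otimes>\<^bsub>ZG\<^esub> g) = C3 p q r f * \<epsilon> g + C2 p q f * C1 r g + C1 p f * C2 q r g + \<epsilon> f * C3 p q r g"
proof -
  show "C1 p (f \<otimes>\<^bsub>ZG\<^esub> g) = C1 p f * \<epsilon> g + \<epsilon> f * C1 p g"
    using lin_mult[OF assms, of "\<lambda>g. c1 g p" "\<lambda>g. c1 g p" "\<lambda>_. 1" "\<lambda>_. 1" "\<lambda>g. c1 g p"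
        "\<lambda>_. 0" "\<lambda>_. 0" "\<lambda>_. 0" "\<lambda>_. 0"] by (simp add: c1_mult)
  show "C2 p q (f \<otimes>\<^bsub>ZG\<^esub> g) = C2 p q f * \<epsilon> g + C1 p f * C1 q g + \<epsilon> f * C2 p q g"
    using lin_mult[OF assms, of "\<lambda>g. c2 g p q" "\<lambda>g. c2 g p q" "\<lambda>_. 1" "\<lambda>g. c1 g p" "\<lambda>g. c1 g q"
        "\<lambda>_. 1" "\<lambda>g. c2 g p q" "\<lambda>_. 0" "\<lambda>_. 0"] by (simp add: c2_mult)
  show "C3 p q r (f \<otimes>\<^bsub>ZG\<^esub> g) = C3 p q r f * \<epsilon> g + C2 p q f * C1 r g + C1 p f * C2 q r g + \<epsilon> f * C3 p q r g"
    using lin_mult[OF assms, of "\<lambda>g. c3 g p q r" "\<lambda>g. c3 g p q r" "\<lambda>_. 1" "\<lambda>g. c2 g p q" "\<lambda>g. c1 g r"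
        "\<lambda>g. c1 g p" "\<lambda>g. c2 g q r" "\<lambda>_. 1" "\<lambda>g. c3 g p q r"] by (simp add: c3_mult)
qed

lemma group_meet_coefficients:
  assumes S: "S \<subseteq> carrier G" "\<And>s x. s \<in> S \<Longrightarrow> x \<in> Xs \<Longrightarrow> c1 s x = 0"
    and T: "T \<subseteq> carrier G" "\<And>t p. t \<in> T \<Longrightarrow> c1 t p = 0"
      "\<And>t x y. t \<in> T \<Longrightarrow> x \<in> Xs \<Longrightarrow> y \<in> Xs \<Longrightarrow> c2 t x y = 0"
    and w: "w \<in> group_meet G
      (aug_power G 4 <+>\<^bsub>ZG\<^esub> additive_prod ZG (aug_power G 2) (aug_ideal (G\<lparr>carrier := S\<rparr>))
        <+>\<^bsub>ZG\<^esub> additive_prod ZG (aug_ideal G) (aug_ideal (G\<lparr>carrier := T\<rparr>)))"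
  shows "c1 w p = 0" "c2 w p q = 0" "q \<in> Xs \<Longrightarrow> r \<in> Xs \<Longrightarrow> c3 w p q r = 0"
proof -
  \<comment> \<open>Right multiplication by an element of augmentation 0 leads from each of these
    sets to the next. \<open>?V4\<close> restricts the cubic positions to those ending in two
    letters of \<open>Xs\<close>, so that it also contains the mixed summands.\<close>
  let ?V1 = "{f \<in> carrier ZG. \<epsilon> f = 0}"
  let ?V2 = "{f \<in> carrier ZG. \<epsilon> f = 0 \<and> (\<forall>p. C1 p f = 0)}"
  let ?V3 = "{f \<in> carrier ZG. \<epsilon> f = 0 \<and> (\<forall>p. C1 p f = 0) \<and> (\<forall>p q. C2 p q f = 0)}"
  let ?V4 = "{f \<in> carrier ZG. \<epsilon> f = 0 \<and> (\<forall>p. C1 p f = 0) \<and> (\<forall>p q. C2 p q f = 0) \<and>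
      (\<forall>p. \<forall>q\<in>Xs. \<forall>r\<in>Xs. C3 p q r f = 0)}"
  have V1: "subgroup ?V1 (add_monoid ZG)"
    using lin_vanishing_subgroup[of "{\<lambda>_. 1}"] by simp
  have "?V2 = {f \<in> carrier ZG. \<forall>\<kappa>\<in>{\<lambda>_. 1} \<union> {\<kappa>. \<exists>p. \<kappa> = (\<lambda>g. c1 g p)}. lin \<kappa> f = 0}"
    by auto
  hence V2: "subgroup ?V2 (add_monoid ZG)" by (simp only: lin_vanishing_subgroup)
  have "?V3 = {f \<in> carrier ZG. \<forall>\<kappa>\<in>{\<lambda>_. 1} \<union> {\<kappa>. \<exists>p. \<kappa> = (\<lambda>g. c1 g p)}
      \<union> {\<kappa>. \<exists>p q. \<kappa> = (\<lambda>g. c2 g p q)}. lin \<kappa> f = 0}"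
    by auto
  hence V3: "subgroup ?V3 (add_monoid ZG)" by (simp only: lin_vanishing_subgroup)
  have "?V4 = {f \<in> carrier ZG. \<forall>\<kappa>\<in>{\<lambda>_. 1} \<union> {\<kappa>. \<exists>p. \<kappa> = (\<lambda>g. c1 g p)}
      \<union> {\<kappa>. \<exists>p q. \<kappa> = (\<lambda>g. c2 g p q)}
      \<union> {\<kappa>. \<exists>p q r. q \<in> Xs \<and> r \<in> Xs \<and> \<kappa> = (\<lambda>g. c3 g p q r)}. lin \<kappa> f = 0}"
    by auto
  hence V4: "subgroup ?V4 (add_monoid ZG)" by (simp only: lin_vanishing_subgroup)
  have aug: "f \<in> carrier ZG \<and> \<epsilon> f = 0" if "f \<in> aug_ideal G" for f
    using that by (simp add: aug_ideal_iff)
  have p1: "aug_power G 1 \<subseteq> ?V1"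
    unfolding One_nat_def aug_power.simps
    by (rule ZG.additive_prod_least[OF V1]) (auto simp: aug lin_one_mult)
  have p2: "aug_power G 2 \<subseteq> ?V2"
    unfolding numeral_2_eq_2 aug_power.simps(2)[of G "Suc 0"]
    by (rule ZG.additive_prod_least[OF V2])
       (use p1 in \<open>auto simp: aug lin_one_mult C_mult subset_iff\<close>)
  have p3: "aug_power G 3 \<subseteq> ?V3"
    unfolding numeral_3_eq_3 aug_power.simps(2)[of G "Suc (Suc 0)"]
    by (rule ZG.additive_prod_least[OF V3])
       (use p2 in \<open>auto simp: aug lin_one_mult C_mult subset_iff numeral_2_eq_2\<close>)
  have "aug_power G 4 = additive_prod ZG (aug_power G 3) (aug_ideal G)"
    by (simp add: eval_nat_numeral)
  moreover have "additive_prod ZG (aug_power G 3) (aug_ideal G) \<subseteq> ?V4"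
    by (rule ZG.additive_prod_least[OF V4])
       (use p3 in \<open>auto simp: aug lin_one_mult C_mult subset_iff\<close>)
  ultimately have p4: "aug_power G 4 \<subseteq> ?V4" by simp
  have lin_zero: "lin \<kappa> f = 0" if "supp f \<subseteq> H" "\<And>h. h \<in> H \<Longrightarrow> \<kappa> h = 0" for \<kappa> f and H :: "'a set"
    unfolding lin_def by (rule sum.neutral) (use that in auto)
  have J2: "additive_prod ZG (aug_power G 2) (aug_ideal (G\<lparr>carrier := S\<rparr>)) \<subseteq> ?V4"
  proof (rule ZG.additive_prod_least[OF V4])
    fix a b assume a: "a \<in> aug_power G 2" and b: "b \<in> aug_ideal (G\<lparr>carrier := S\<rparr>)"
    have b': "b \<in> carrier ZG" "\<epsilon> b = 0" "supp b \<subseteq> S"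
      using b aug_ideal_subgroup_subset[OF S(1)] by (auto simp: aug_ideal_restrict_iff)
    have "C1 x b = 0" if "x \<in> Xs" for x
      by (rule lin_zero[OF b'(3)]) (use S(2) that in blast)
    moreover have "a \<in> ?V2" using a p2 by blast
    \<comment> \<open>In the cubic coefficient only \<open>C2 p q a * C1 r b\<close> remains, with
      \<open>b\<close> supported on \<open>S\<close> and \<open>r\<close> in
      \<open>Xs\<close>.\<close>
    ultimately show "a \<otimes>\<^bsub>ZG\<^esub> b \<in> ?V4" using b' by (simp add: lin_one_mult C_mult)
  qed
  have J3: "additive_prod ZG (aug_ideal G) (aug_ideal (G\<lparr>carrier := T\<rparr>)) \<subseteq> ?V4"
  proof (rule ZG.additive_prod_least[OF V4])
    fix a b assume a: "a \<in> aug_ideal G" and b: "b \<in> aug_ideal (G\<lparr>carrier := T\<rparr>)"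
    have b': "b \<in> carrier ZG" "\<epsilon> b = 0" "supp b \<subseteq> T"
      using b aug_ideal_subgroup_subset[OF T(1)] by (auto simp: aug_ideal_restrict_iff)
    have "C1 p b = 0" for p
      by (rule lin_zero[OF b'(3)]) (use T(2) in blast)
    moreover have "C2 x y b = 0" if "x \<in> Xs" "y \<in> Xs" for x y
      by (rule lin_zero[OF b'(3)]) (use T(3) that in blast)
    \<comment> \<open>Here only \<open>C1 p a * C2 q r b\<close> remains, with \<open>b\<close>
      supported on \<open>T\<close> and \<open>q\<close>, \<open>r\<close> in
      \<open>Xs\<close>.\<close>
    ultimately show "a \<otimes>\<^bsub>ZG\<^esub> b \<in> ?V4" using b' aug[OF a] by (simp add: lin_one_mult C_mult)
  qed
  have wG: "w \<in> carrier G" using w by (simp add: group_meet_def)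
  have sum: "x \<in> ?V4" if x: "x \<in> A <+>\<^bsub>ZG\<^esub> B" and AB: "A \<subseteq> ?V4" "B \<subseteq> ?V4" for x A B
  proof -
    obtain a b where ab: "a \<in> A" "b \<in> B" "x = a \<oplus>\<^bsub>ZG\<^esub> b" using x by (auto simp: ZG.set_add_iff)
    show ?thesis
      using subgroup.m_closed[OF V4 subsetD[OF AB(1) ab(1)] subsetD[OF AB(2) ab(2)]] ab(3) by simp
  qed
  have "of_grp w \<ominus>\<^bsub>ZG\<^esub> of_grp \<one> \<in> ?V4"
    by (rule sum[OF _ subsetI[OF sum[OF _ p4 J2]] J3]) (use w in \<open>simp_all add: group_meet_def of_grp_one\<close>)
  thus "c1 w p = 0" "c2 w p q = 0" "q \<in> Xs \<Longrightarrow> r \<in> Xs \<Longrightarrow> c3 w p q r = 0"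
    using wG by (simp_all add: lin_minus lin_group_ring_of)
qed

end

section \<open>Adapted Magnus sections\<close>

context group
begin

lemma \<gamma>_normal: "\<gamma> (Suc n) \<lhd> G"
  unfolding normal_inv_iff
proof (intro conjI ballI)
  show "subgroup (\<gamma> (Suc n)) G" by (rule \<gamma>_subgroup)
  fix x h assume x: "x \<in> carrier G" and h: "h \<in> \<gamma> (Suc n)"
  have "comm x h \<in> \<gamma> (Suc n)"
    using lower_central_comm(2)[OF subgroup_self h x] lower_central_antimono[OF subgroup_self] by blast
  hence "comm x h \<otimes> h \<in> \<gamma> (Suc n)" using h by (rule subgroup.m_closed[OF \<gamma>_subgroup])
  thus "x \<otimes> h \<otimes> inv x \<in> \<gamma> (Suc n)" using conj_eq_comm[OF \<gamma>_closed[OF h] x] by simp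
qed

lemma comm_subgroup_consistent:
  assumes H: "subgroup H G" and AB: "A \<subseteq> H" "B \<subseteq> H"
  shows "comm_subgroup (G\<lparr>carrier := H\<rparr>) A B = comm_subgroup G A B"
proof -
  let ?C = "\<lambda>K. \<Union>a\<in>A. \<Union>b\<in>B. {a \<otimes> b \<otimes> inv\<^bsub>K\<^esub> a \<otimes> inv\<^bsub>K\<^esub> b}"
  have "?C (G\<lparr>carrier := H\<rparr>) = ?C G"
    by (intro SUP_cong refl) (use AB H in \<open>auto simp: subset_iff\<close>)
  moreover have "?C G \<subseteq> H"
    using subgroup_comm_closed[OF H] AB by (auto simp: comm_def)
  ultimately show ?thesis
    unfolding comm_subgroup_def using generate_consistent[OF _ H] by simp
qed

lemma lower_central_consistent:
  assumes H: "subgroup H G"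
  shows "lower_central (G\<lparr>carrier := H\<rparr>) H n = lower_central G H n"
proof -
  interpret H: group "G\<lparr>carrier := H\<rparr>" using H by (rule subgroup_imp_group)
  have sub: "lower_central (G\<lparr>carrier := H\<rparr>) H n \<subseteq> H" for n
    using subgroup.subset[OF H.\<gamma>_subgroup] by simp
  have "lower_central (G\<lparr>carrier := H\<rparr>) H (Suc n) = lower_central G H (Suc n)" for n
  proof (induction n)
    case (Suc n)
    thus ?case using sub[of "Suc n"] by (simp add: comm_subgroup_consistent[OF H])
  qed simp
  thus ?thesis by (cases n) auto
qed

end

section \<open>Commutators and the lower central series under homomorphisms\<close>

lemma (in group_hom) hom_comm: "\<lbrakk>a \<in> carrier G; b \<in> carrier G\<rbrakk> \<Longrightarrow> h (G.comm a b) = H.comm (h a) (h b)"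
  by (simp add: G.comm_def H.comm_def)

lemma (in group_hom) subgroup_vimage:
  assumes N: "subgroup N H"
  shows "subgroup {x \<in> carrier G. h x \<in> N} G"
  by (rule G.subgroupI)
     (use subgroup.one_closed[OF N] subgroup.m_closed[OF N] subgroup.m_inv_closed[OF N] in
       \<open>auto intro!: exI[of _ "\<one>\<^bsub>G\<^esub>"]\<close>)

lemma (in group_hom) lower_central_hom:
  assumes "a \<in> G.\<gamma> (Suc n)"
  shows "h a \<in> H.\<gamma> (Suc n)"
proof -
  have "G.\<gamma> (Suc n) \<subseteq> {x \<in> carrier G. h x \<in> H.\<gamma> (Suc n)}"
  proof (induction n)
    case (Suc n)
    have "comm_subgroup G (G.\<gamma> (Suc n)) (carrier G) \<subseteq> {x \<in> carrier G. h x \<in> H.\<gamma> (Suc (Suc n))}"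
    proof (rule G.comm_subgroup_least[OF subgroup_vimage[OF H.\<gamma>_subgroup]])
      fix a b assume "a \<in> G.\<gamma> (Suc n)" "b \<in> carrier G"
      moreover from this Suc have "h a \<in> H.\<gamma> (Suc n)" "a \<in> carrier G" by auto
      ultimately show "G.comm a b \<in> {x \<in> carrier G. h x \<in> H.\<gamma> (Suc (Suc n))}"
        using H.lower_central_comm(1)[OF H.subgroup_self, of "h a" n "h b"] by (simp add: hom_comm)
    qed
    thus ?case by simp
  qed auto
  thus ?thesis using assms by auto
qed

text \<open>A section of \<open>\<pi>\<close> transports the Magnus coefficients of \<open>E\<close> to \<open>G\<close>, and \<open>\<pi>\<close> transports
  membership in commutator subgroups back.\<close>

lemma group_meet_subset_lower_central_product:
  fixes G (structure) and E (structure)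
  assumes G: "group G" and mg: "magnus_generated E c1 c2 c3 l Z lt"
    and \<pi>: "\<pi> \<in> hom E G" and s: "s \<in> hom G E" "\<And>r. r \<in> carrier G \<Longrightarrow> \<pi> (s r) = r"
    and S: "subgroup S G" and Xs: "Xs \<subseteq> Z" and lS: "\<And>z. z \<in> Z \<Longrightarrow> z \<notin> Xs \<Longrightarrow> \<pi> (l z) \<in> S"
    and c1_S: "\<And>u x. \<lbrakk>u \<in> carrier E; \<pi> u \<in> S; x \<in> Xs\<rbrakk> \<Longrightarrow> c1 u x = 0"
  defines "T \<equiv> comm_subgroup G (carrier G) S"
  shows "group_meet G
    (aug_power G 4 <+>\<^bsub>group_ring G\<^esub> additive_prod (group_ring G) (aug_power G 2) (aug_ideal (G\<lparr>carrier := S\<rparr>))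
      <+>\<^bsub>group_ring G\<^esub> additive_prod (group_ring G) (aug_ideal G) (aug_ideal (G\<lparr>carrier := T\<rparr>)))
    \<subseteq> lower_central G (carrier G) 4 <#>\<^bsub>G\<^esub> comm_subgroup G T S"
proof
  interpret G: group G by (rule G)
  interpret E: magnus_generated E c1 c2 c3 l Z lt by (rule mg)
  interpret \<pi>: group_hom E G \<pi> by unfold_locales (rule \<pi>)
  interpret s: group_hom G E s by unfold_locales (rule s(1))
  interpret GM: magnus_coefficients G "\<lambda>r. c1 (s r)" "\<lambda>r. c2 (s r)" "\<lambda>r. c3 (s r)"
    by unfold_locales (simp_all add: E.c1_mult E.c2_mult E.c3_mult)
  have SG: "S \<subseteq> carrier G" using S by (rule subgroup.subset)
  have T: "subgroup T G" unfolding T_def using SG by (intro G.comm_subgroup_is_subgroup) auto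
  have TG: "T \<subseteq> carrier G" using T by (rule subgroup.subset)
  have c1_s: "c1 (s y) x = 0" if "y \<in> S" "x \<in> Xs" for x y
    using that SG s(2) by (intro c1_S) auto
  \<comment> \<open>By \<open>c2_comm\<close> each quadratic term of a generating commutator
    contains a linear coefficient of an element of \<open>S\<close> at a letter of
    \<open>Xs\<close>.\<close>
  have T_coeff: "T \<subseteq> {a \<in> carrier G. (\<forall>p. c1 (s a) p = 0) \<and>
      (\<forall>p q. p \<in> Xs \<and> q \<in> Xs \<longrightarrow> c2 (s a) p q = 0)}"
    unfolding T_def
  proof (rule G.comm_subgroup_least[OF GM.c2_vanishing_subgroup])
    fix a b assume "a \<in> carrier G" "b \<in> S"
    thus "G.comm a b \<in> {a \<in> carrier G. (\<forall>p. c1 (s a) p = 0) \<and>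
        (\<forall>p q. p \<in> Xs \<and> q \<in> Xs \<longrightarrow> c2 (s a) p q = 0)}"
      using SG c1_s by (auto simp: GM.c1_comm GM.c2_comm)
  qed
  define N where "N = G.\<gamma> 4 <#>\<^bsub>G\<^esub> comm_subgroup G T S"
  have TS: "subgroup (comm_subgroup G T S) G" by (rule G.comm_subgroup_is_subgroup[OF TG SG])
  have \<gamma>4: "G.\<gamma> 4 \<lhd> G" using G.\<gamma>_normal[of 3] by (simp add: eval_nat_numeral)
  have N: "subgroup N G" unfolding N_def by (rule G.mult_norm_subgroup[OF \<gamma>4 TS])
  have N_mult: "a \<otimes>\<^bsub>G\<^esub> b \<in> N" if "a \<in> G.\<gamma> 4" "b \<in> comm_subgroup G T S" for a b
    unfolding N_def set_mult_def using that by blast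
  have N_left: "a \<in> N" if "a \<in> G.\<gamma> 4" for a
    using N_mult[OF that subgroup.one_closed[OF TS]] G.\<gamma>_closed[OF that] by simp
  have N_right: "b \<in> N" if "b \<in> comm_subgroup G T S" for b
    using N_mult[OF subgroup.one_closed[OF G.\<gamma>_subgroup] that] subgroup.mem_carrier[OF TS that]
    by simp
  fix w assume w: "w \<in> group_meet G
    (aug_power G 4 <+>\<^bsub>group_ring G\<^esub> additive_prod (group_ring G) (aug_power G 2) (aug_ideal (G\<lparr>carrier := S\<rparr>))
      <+>\<^bsub>group_ring G\<^esub> additive_prod (group_ring G) (aug_ideal G) (aug_ideal (G\<lparr>carrier := T\<rparr>)))"
  have wG: "w \<in> carrier G" using w by (simp add: group_meet_def)
  have coeff: "c1 (s w) p = 0" "c2 (s w) p q = 0" "q \<in> Xs \<Longrightarrow> r \<in> Xs \<Longrightarrow> c3 (s w) p q r = 0" for p q r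
    by (rule GM.group_meet_coefficients[OF SG c1_s TG _ _ w]; use T_coeff in blast)+
  have "s w \<in> E.\<gamma> 2" using wG coeff(1) by (intro E.in_\<gamma>2_if_c1_vanishes) auto
  hence "s w \<in> E.\<gamma> 3" using coeff(2) by (rule E.in_\<gamma>3_if_c2_vanishes)
  have "s w \<in> {u \<in> carrier E. \<pi> u \<in> N}"
  \<comment> \<open>The criterion needs generating letters, so it is applied in \<open>E\<close> to
    the preimages of \<open>S\<close> and \<open>N\<close>; \<open>\<pi> (s w) = w\<close> leads
    back to \<open>G\<close>.\<close>
  proof (rule E.in_subgroup_if_c3_vanishes[OF Xs, where S = "{u \<in> carrier E. \<pi> u \<in> S}"])
    show "E.\<gamma> 4 \<subseteq> {u \<in> carrier E. \<pi> u \<in> N}"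
    proof
      fix u assume u: "u \<in> E.\<gamma> 4"
      have "\<pi> u \<in> G.\<gamma> (Suc 3)" by (rule \<pi>.lower_central_hom) (use u in \<open>simp add: eval_nat_numeral\<close>)
      thus "u \<in> {u \<in> carrier E. \<pi> u \<in> N}"
        using N_left E.\<gamma>_closed[OF u] by (simp add: eval_nat_numeral)
    qed
    show "E.comm (E.comm e y) z \<in> {u \<in> carrier E. \<pi> u \<in> N}"
      if "e \<in> carrier E" "y \<in> {u \<in> carrier E. \<pi> u \<in> S}" "z \<in> {u \<in> carrier E. \<pi> u \<in> S}" for e y z
    proof -
      have "G.comm (\<pi> e) (\<pi> y) \<in> T"
        unfolding T_def using that by (intro G.comm_subgroup_mem) auto
      hence "G.comm (G.comm (\<pi> e) (\<pi> y)) (\<pi> z) \<in> N"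
        using that by (intro N_right G.comm_subgroup_mem) auto
      thus ?thesis using that by (simp add: \<pi>.hom_comm)
    qed
    show "subgroup {u \<in> carrier E. \<pi> u \<in> N} E" by (rule \<pi>.subgroup_vimage[OF N])
  qed (use \<open>s w \<in> E.\<gamma> 3\<close> coeff(3) c1_S lS E.l_closed in auto)
  thus "w \<in> G.\<gamma> 4 <#>\<^bsub>G\<^esub> comm_subgroup G T S" using s(2)[OF wG] by (simp add: N_def)
qed

section \<open>The Magnus group and the section over \<open>R\<close>\<close>

type_synonym 'z magnus = "('z \<Rightarrow> int) \<times> ('z \<Rightarrow> 'z \<Rightarrow> int) \<times> ('z \<Rightarrow> 'z \<Rightarrow> 'z \<Rightarrow> int)"

text \<open>The units \<open>1 + a1 + a2 + a3\<close> of the ring of non-commutative power series modulo terms of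
  degree 4.\<close>

definition magnus_group :: "'z magnus monoid" where
  "magnus_group = \<lparr>carrier = UNIV,
     monoid.mult = (\<lambda>(a1, a2, a3) (b1, b2, b3).
       (\<lambda>p. a1 p + b1 p,
        \<lambda>p q. a2 p q + a1 p * b1 q + b2 p q,
        \<lambda>p q r. a3 p q r + a2 p q * b1 r + a1 p * b2 q r + b3 p q r)),
     one = (\<lambda>_. 0, \<lambda>_ _. 0, \<lambda>_ _ _. 0)\<rparr>"

lemma magnus_group_group: "group (magnus_group :: 'z magnus monoid)"
proof (rule groupI)
  fix x :: "'z magnus"
  obtain a1 a2 a3 where x: "x = (a1, a2, a3)" by (cases x)
  show "\<exists>y\<in>carrier magnus_group. y \<otimes>\<^bsub>magnus_group\<^esub> x = \<one>\<^bsub>magnus_group\<^esub>"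
    \<comment> \<open>The inverse is the geometric series 1 - a + a^2 - a^3 for a = a1 + a2 + a3,
      sorted by degree.\<close>
    by (rule bexI[of _ "(\<lambda>p. - a1 p, \<lambda>p q. - a2 p q + a1 p * a1 q,
          \<lambda>p q r. - a3 p q r + a2 p q * a1 r + a1 p * a2 q r - a1 p * a1 q * a1 r)"])
       (simp_all add: magnus_group_def x fun_eq_iff algebra_simps)
qed (auto simp: magnus_group_def fun_eq_iff algebra_simps)

context group
begin

text \<open>The coordinates of the abelianised group have common kernel \<open>S\<close> on
  \<open>R\<close>, so \<open>leading_term_basis\<close> supplies \<open>Xs\<close>. The delicate
  claim is the last one: it says that linear coefficients at \<open>Xs\<close> are governed by the
  second component, and it would be lost without that component.\<close>

lemma free_subgroup_magnus_section:
  assumes B: "free_basis G B" and R: "subgroup R G"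
  defines "S \<equiv> R \<inter> derived G (carrier G)"
  obtains E :: "('a magnus \<times> 'a) monoid" and c1 c2 c3 l Z lt s Xs where
    "magnus_generated E c1 c2 c3 l (Z :: 'a set) lt" "Xs \<subseteq> Z"
    "snd \<in> hom E (G\<lparr>carrier := R\<rparr>)" "s \<in> hom (G\<lparr>carrier := R\<rparr>) E" "\<And>r. r \<in> R \<Longrightarrow> snd (s r) = r"
    "\<And>z. z \<in> Z \<Longrightarrow> z \<notin> Xs \<Longrightarrow> snd (l z) \<in> S"
    "\<And>u x. u \<in> carrier E \<Longrightarrow> snd u \<in> S \<Longrightarrow> x \<in> Xs \<Longrightarrow> c1 u x = 0"
proof -
  have RG: "r \<in> carrier G" if "r \<in> R" for r using subgroup.mem_carrier[OF R that] .
  obtain e :: "'a \<Rightarrow> 'a \<Rightarrow> int" where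
    e_mult: "\<And>i g h. g \<in> carrier G \<Longrightarrow> h \<in> carrier G \<Longrightarrow> e i (g \<otimes> h) = e i g + e i h"
    and e_fin: "\<And>g. g \<in> carrier G \<Longrightarrow> finite {i. e i g \<noteq> 0}"
    and e_derived: "derived G (carrier G) = {g \<in> carrier G. \<forall>i. e i g = 0}"
    by (rule free_basis_coordinates[OF B]) (rule that)
  have S_eq: "S = {r \<in> R. \<forall>i. e i r = 0}" using RG by (auto simp: S_def e_derived)
  obtain Xs where XsR: "Xs \<subseteq> R" and R_gen: "R \<subseteq> generate G (Xs \<union> {r \<in> R. \<forall>i. e i r = 0})"
    and indep: "\<forall>A (n :: 'a \<Rightarrow> int). finite A \<and> A \<subseteq> Xs \<and> (\<forall>i. (\<Sum>x\<in>A. n x * e i x) = 0) \<longrightarrow> (\<forall>x\<in>A. n x = 0)"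
  proof (rule leading_term_basis[of R e, OF R])
    show "e i (p \<otimes> q) = e i p + e i q" if "p \<in> R" "q \<in> R" for i p q
      using that by (intro e_mult RG)
    show "finite {i. e i r \<noteq> 0}" if "r \<in> R" for r using that by (intro e_fin RG)
  qed (rule that)
  define Z where "Z = Xs \<union> S"
  have ZR: "Z \<subseteq> R" using XsR by (auto simp: Z_def S_def)
  obtain lt :: "'a \<Rightarrow> 'a \<Rightarrow> bool" where wf: "wfP lt"
    and trans: "\<And>x y z. lt x y \<Longrightarrow> lt y z \<Longrightarrow> lt x z"
    and total: "\<And>x y. lt x y \<or> x = y \<or> lt y x"
    by (rule ex_wf_linear_order) (rule that)
  define P where "P = (magnus_group :: 'a magnus monoid) \<times>\<times> G"
  interpret P: group P unfolding P_def by (rule DirProd_group[OF magnus_group_group group_axioms])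
  define c1 where "c1 = (\<lambda>u :: 'a magnus \<times> 'a. fst (fst u))"
  define c2 where "c2 = (\<lambda>u :: 'a magnus \<times> 'a. fst (snd (fst u)))"
  define c3 where "c3 = (\<lambda>u :: 'a magnus \<times> 'a. snd (snd (fst u)))"
  interpret P: magnus_coefficients P c1 c2 c3
    by unfold_locales
       (simp_all add: P_def mult_DirProd' magnus_group_def split_def c1_def c2_def c3_def)
  define l where "l = (\<lambda>z :: 'a. ((\<lambda>p. if p = z then 1 else 0 :: int, \<lambda>_ _. 0, \<lambda>_ _ _. 0) :: 'a magnus, z))"
  have carrier_P: "u \<in> carrier P \<longleftrightarrow> snd u \<in> carrier G" for u
    by (cases u) (simp add: P_def magnus_group_def)
  have lP: "l ` Z \<subseteq> carrier P" using ZR RG by (auto simp: carrier_P l_def)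
  define E0 where "E0 = generate P (l ` Z)"
  have E0: "subgroup E0 P" unfolding E0_def using lP by (rule P.generate_is_subgroup)
  define E where "E = P\<lparr>carrier := E0\<rparr>"
  interpret E: group E unfolding E_def using E0 by (rule P.subgroup_imp_group)
  have E0P: "u \<in> carrier P" if "u \<in> E0" for u using subgroup.mem_carrier[OF E0 that] .
  interpret snd: group_hom P G snd
    by unfold_locales (auto simp: hom_def carrier_P P_def mult_DirProd')
  have "snd ` E0 = generate G (snd ` l ` Z)"
    unfolding E0_def by (rule snd.generate_img[OF lP, symmetric])
  also have "snd ` l ` Z = Z" by (force simp: l_def)
  also have "generate G Z = R"
    using generate_subgroup_incl[OF ZR R] R_gen by (auto simp: Z_def S_eq)
  finally have snd_E0: "snd ` E0 = R" .
  have snd_hom: "snd \<in> hom E (G\<lparr>carrier := R\<rparr>)"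
    using snd_E0 E0P by (auto simp: hom_def E_def)
  have mg: "magnus_generated E c1 c2 c3 l Z lt"
  proof unfold_locales
    have "l ` Z \<subseteq> E0" unfolding E0_def by (auto intro: generate.incl)
    thus "z \<in> Z \<Longrightarrow> l z \<in> carrier E" "carrier E \<subseteq> generate E (l ` Z)" for z
      using P.generate_consistent[OF _ E0, of "l ` Z"] by (auto simp: E_def E0_def)
    show "lt p q \<Longrightarrow> \<not> lt q p" for p q
      using trans[of p q p] wfp_imp_irreflp[OF wf] by (auto simp: irreflp_def)
    show "lt p q \<Longrightarrow> lt q r \<Longrightarrow> lt p r" for p q r by (rule trans)
    show "lt p q \<or> p = q \<or> lt q p" for p q by (rule total)
  qed (simp_all add: E_def E0P P.c1_mult P.c2_mult P.c3_mult, simp add: c1_def l_def)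
  obtain s where s: "s \<in> hom (G\<lparr>carrier := R\<rparr>) E" "\<And>r. r \<in> R \<Longrightarrow> snd (s r) = r"
  proof (rule free_subgroup_projective[OF B R E.group_axioms])
    show "snd \<in> hom E G" using snd_hom R subgroup.subset[OF R] by (auto simp: hom_def)
    show "snd ` carrier E = R" using snd_E0 by (simp add: E_def)
  qed (rule that)
  \<comment> \<open>Modulo \<open>S\<close>, \<open>snd u\<close> is the combination of the elements
    of \<open>Xs\<close> with multipliers \<open>c1 u x\<close>; \<open>H\<close> expresses this in
    coordinates. It holds for the letters and carries over to products and inverses. The finite set
    \<open>A\<close> gives the sum a meaning when \<open>Xs\<close> is infinite. Over
    \<open>S\<close> the left side is zero, and independence makes the multipliers vanish.\<close>
  define H where "H = {u \<in> carrier P. snd u \<in> R \<and> (\<exists>A. finite A \<and> A \<subseteq> Xs \<and> (\<forall>x\<in>Xs - A. c1 u x = 0)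
      \<and> (\<forall>i. e i (snd u) = (\<Sum>x\<in>A. c1 u x * e i x)))}"
  have H: "subgroup H P"
  proof (rule P.subgroupI)
    have e_inv: "e i (inv g) = - e i g" and e_one: "e i \<one> = 0" if "g \<in> carrier G" for i g
      using additive_int_pow(1,2)[where \<phi> = "e i", OF subgroup_self e_mult that] by auto
    show "H \<subseteq> carrier P" by (auto simp: H_def)
    have "\<one>\<^bsub>P\<^esub> \<in> H"
      using e_one[OF one_closed] subgroup.one_closed[OF R] by (auto simp: H_def intro!: exI[of _ "{}"])
    thus "H \<noteq> {}" by auto
    fix u assume "u \<in> H"
    then obtain A where u: "u \<in> carrier P" "snd u \<in> R" and A: "finite A" "A \<subseteq> Xs"
      "\<And>x. x \<in> Xs - A \<Longrightarrow> c1 u x = 0" "\<And>i. e i (snd u) = (\<Sum>x\<in>A. c1 u x * e i x)"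
      by (auto simp: H_def)
    have "inv\<^bsub>P\<^esub> u \<in> carrier P" "snd (inv\<^bsub>P\<^esub> u) \<in> R"
      using u subgroup.m_inv_closed[OF R] by simp_all
    moreover have "e i (snd (inv\<^bsub>P\<^esub> u)) = (\<Sum>x\<in>A. c1 (inv\<^bsub>P\<^esub> u) x * e i x)" for i
      using u RG A(4) by (simp add: e_inv P.c1_inv sum_negf)
    moreover have "c1 (inv\<^bsub>P\<^esub> u) x = 0" if "x \<in> Xs - A" for x
      using u A(3)[OF that] by (simp add: P.c1_inv)
    ultimately show "inv\<^bsub>P\<^esub> u \<in> H" using A(1,2) unfolding H_def by blast
    fix v assume "v \<in> H"
    then obtain A' where v: "v \<in> carrier P" "snd v \<in> R" and A': "finite A'" "A' \<subseteq> Xs"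
      "\<And>x. x \<in> Xs - A' \<Longrightarrow> c1 v x = 0" "\<And>i. e i (snd v) = (\<Sum>x\<in>A'. c1 v x * e i x)"
      by (auto simp: H_def)
    have "u \<otimes>\<^bsub>P\<^esub> v \<in> carrier P" "snd (u \<otimes>\<^bsub>P\<^esub> v) \<in> R"
      using u v subgroup.m_closed[OF R] by simp_all
    moreover have "e i (snd (u \<otimes>\<^bsub>P\<^esub> v)) = (\<Sum>x\<in>A \<union> A'. c1 (u \<otimes>\<^bsub>P\<^esub> v) x * e i x)" for i
    proof -
      have "e i (snd u) = (\<Sum>x\<in>A \<union> A'. c1 u x * e i x)"
        unfolding A(4) by (rule sum.mono_neutral_left) (use A A' in auto)
      moreover have "e i (snd v) = (\<Sum>x\<in>A \<union> A'. c1 v x * e i x)"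
        unfolding A'(4) by (rule sum.mono_neutral_left) (use A A' in auto)
      ultimately show ?thesis using u v RG
        by (simp add: e_mult P.c1_mult distrib_right sum.distrib)
    qed
    moreover have "c1 (u \<otimes>\<^bsub>P\<^esub> v) x = 0" if "x \<in> Xs - (A \<union> A')" for x
      using u v A(3)[of x] A'(3)[of x] that by (simp add: P.c1_mult)
    moreover have "finite (A \<union> A')" "A \<union> A' \<subseteq> Xs" using A A' by auto
    ultimately show "u \<otimes>\<^bsub>P\<^esub> v \<in> H" unfolding H_def by blast
  qed
  have "l ` Z \<subseteq> H"
  proof
    fix u assume "u \<in> l ` Z"
    then obtain z where z: "z \<in> Z" "u = l z" by blast
    have u: "u \<in> carrier P" "snd u \<in> R" "snd u = z" "\<And>x. c1 u x = (if x = z then 1 else 0)"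
      using z lP ZR by (auto simp: l_def c1_def)
    show "u \<in> H"
    proof (cases "z \<in> Xs")
      case True
      have "finite {z} \<and> {z} \<subseteq> Xs \<and> (\<forall>x\<in>Xs - {z}. c1 u x = 0)
          \<and> (\<forall>i. e i (snd u) = (\<Sum>x\<in>{z}. c1 u x * e i x))"
        using True u by simp
      thus ?thesis unfolding H_def using u(1,2) by blast
    next
      case False
      hence "\<forall>i. e i z = 0" using z by (auto simp: Z_def S_eq)
      hence "finite {} \<and> {} \<subseteq> Xs \<and> (\<forall>x\<in>Xs - {}. c1 u x = 0)
          \<and> (\<forall>i. e i (snd u) = (\<Sum>x\<in>{}. c1 u x * e i x))"
        using False u by auto
      thus ?thesis unfolding H_def using u(1,2) by blast
    qed
  qed
  hence E0H: "E0 \<subseteq> H" unfolding E0_def by (rule P.generate_subgroup_incl[OF _ H])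
  have c1_S: "c1 u x = 0" if u: "u \<in> carrier E" "snd u \<in> S" and x: "x \<in> Xs" for u x
  proof -
    have "u \<in> H" using u E0H by (auto simp: E_def)
    then obtain A where A: "finite A" "A \<subseteq> Xs" "\<And>x. x \<in> Xs - A \<Longrightarrow> c1 u x = 0"
      "\<And>i. e i (snd u) = (\<Sum>x\<in>A. c1 u x * e i x)"
      by (auto simp: H_def)
    have "(\<Sum>x\<in>A. c1 u x * e i x) = 0" for i using A(4)[of i] u by (simp add: S_eq)
    hence "\<forall>x\<in>A. c1 u x = 0" using indep A(1,2) by blast
    thus ?thesis using A(3) x by blast
  qed
  show ?thesis
    by (rule that[OF mg _ snd_hom s _ c1_S]) (auto simp: Z_def l_def)
qed

end

section \<open>Passage from subgroups of \<open>F\<close> to the group \<open>R\<close>\<close>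

theorem proposition3p2:
  fixes F :: "('a, 'b) monoid_scheme" and R :: "'a set"
  assumes "free_group F" and "R \<lhd> F"
  shows
    "let S = R \<inter> derived F (carrier F);
         G = F\<lparr>carrier := R\<rparr>;
         \<Delta> = (\<lambda>H. aug_ideal (F\<lparr>carrier := H\<rparr>))
     in group_meet G
          (aug_power G 4
           <+>\<^bsub>group_ring G\<^esub> additive_prod (group_ring G) (aug_power G 2) (\<Delta> S)
           <+>\<^bsub>group_ring G\<^esub> additive_prod (group_ring G) (\<Delta> R) (\<Delta> (comm_subgroup F R S)))
        = lower_central F R 4 <#>\<^bsub>F\<^esub> comm_subgroup F (comm_subgroup F R S) S"
proof -
  interpret F: group F using assms(1) by (simp add: free_group_def)
  obtain B where B: "free_basis F B" using assms(1) by (auto simp: free_group_def)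
  have R: "subgroup R F" using assms(2) by (rule normal_imp_subgroup)
  \<comment> \<open>The group ring side of the claim lives in \<open>G\<close>, the other side in
    \<open>F\<close>. Commutator subgroups and set products of subgroups of \<open>R\<close> agree
    in both, so everything is moved to \<open>G\<close>.\<close>
  define G where "G = F\<lparr>carrier := R\<rparr>"
  define S where "S = R \<inter> derived F (carrier F)"
  interpret G: group G unfolding G_def using R by (rule F.subgroup_imp_group)
  have "subgroup S F"
    unfolding S_def using R F.derived_is_subgroup[of "carrier F"] by (intro F.subgroups_Inter_pair) auto
  hence S: "subgroup S G"
    unfolding G_def by (rule F.subgroup_incl[OF _ R]) (simp add: S_def)
  define T where "T = comm_subgroup G (carrier G) S"
  have SR: "S \<subseteq> R" by (simp add: S_def)
  have "T \<subseteq> carrier G"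
    unfolding T_def
    by (rule subgroup.subset[OF G.comm_subgroup_is_subgroup]) (use SR in \<open>auto simp: G_def\<close>)
  hence TR: "T \<subseteq> R" by (simp add: G_def)
  have T_eq: "comm_subgroup F R S = T"
    unfolding T_def G_def using SR by (simp add: F.comm_subgroup_consistent[OF R])
  have "comm_subgroup F T S = comm_subgroup G T S"
    unfolding G_def by (rule F.comm_subgroup_consistent[OF R TR SR, symmetric])
  moreover have "lower_central F R 4 = lower_central G (carrier G) 4"
    unfolding G_def by (simp add: F.lower_central_consistent[OF R])
  moreover have "A <#>\<^bsub>F\<^esub> C = A <#>\<^bsub>G\<^esub> C" for A C by (simp add: set_mult_def G_def)
  moreover have "group_meet G
      (aug_power G 4 <+>\<^bsub>group_ring G\<^esub> additive_prod (group_ring G) (aug_power G 2) (aug_ideal (G\<lparr>carrier := S\<rparr>))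
        <+>\<^bsub>group_ring G\<^esub> additive_prod (group_ring G) (aug_ideal G) (aug_ideal (G\<lparr>carrier := T\<rparr>)))
      = lower_central G (carrier G) 4 <#>\<^bsub>G\<^esub> comm_subgroup G T S" (is "?L = ?R")
  proof
    show "?R \<subseteq> ?L" unfolding T_def by (rule G.lower_central_product_in_group_meet[OF S])
    obtain E :: "('a magnus \<times> 'a) monoid" and c1 c2 c3 l Z lt s Xs where
      E: "magnus_generated E c1 c2 c3 l (Z :: 'a set) lt" "Xs \<subseteq> Z"
      "snd \<in> hom E G" "s \<in> hom G E" "\<And>r. r \<in> R \<Longrightarrow> snd (s r) = r"
      "\<And>z. z \<in> Z \<Longrightarrow> z \<notin> Xs \<Longrightarrow> snd (l z) \<in> S"
      "\<And>u x. u \<in> carrier E \<Longrightarrow> snd u \<in> S \<Longrightarrow> x \<in> Xs \<Longrightarrow> c1 u x = 0"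
      by (rule F.free_subgroup_magnus_section[OF B R, folded G_def S_def]) (rule that)
    show "?L \<subseteq> ?R"
      unfolding T_def
      by (rule group_meet_subset_lower_central_product[OF G.group_axioms E(1,3,4) _ S E(2,6,7)])
         (use E(5) in \<open>simp_all add: G_def\<close>)
  qed
  ultimately show ?thesis
    unfolding Let_def S_def[symmetric] G_def[symmetric] T_eq by (simp add: G_def)
qed

end
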